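(* Let $\Sigma,\Sigma'\subset\mathbb{R}^4/\mathbb{R}$ be tropical curves whose support is a fan. Suppose that $Z_\Sigma=Z_{\Sigma'}$ (equality of weighted polyhedral complexes in $\mathbb{R}^6/\mathbb{R}$), where $Z_\Sigma=\varphi(\Sigma)+\Gamma_0$ and $Z_{\Sigma'}=\varphi(\Sigma')+\Gamma_0$. Then $\Sigma=\Sigma'$ (as weighted polyhedral complexes).
   Context: $K$ is an algebraically closed field with a nontrivial valuation with value group $\Gamma_{\mathrm{val}}\subset\mathbb{R}$; min convention. $\mathbb{R}^{m+1}/\mathbb{R}$ is the quotient of $\mathbb{R}^{m+1}$ by the line spanned by $(1,\dots,1)$. A tropical variety is a pure-dimensional balanced weighted $\Gamma_{\mathrm{val}}$-rational polyhedral complex (not necessarily realizable as the tropicalization of an algebraic variety); a tropical curve is one of dimension $1$. Its support is the union of the maximal polyhedra of nonzero weight. Weighted complexes are identified if they agree up to subdivision and cells of weight $0$. Here $n=3$, $k=1$. $\mathrm{Gr}(1,3)\subset\mathbb{P}^5$ is the Plücker-embedded Grassmannian of lines in $\mathbb{P}^3$, with coordinates $p_{ij}$, $0\le i<j\le3$. $\varphi:\mathbb{R}^4/\mathbb{R}\to\mathbb{R}^6/\mathbb{R}$ is the linear map $\varphi(a_0,a_1,a_2,a_3)=(a_i+a_j)_{i<j}$ (injective with saturated image lattice; $\varphi$ of a weighted complex carries over the weights). $\Gamma_0=\mathrm{Trop}(\mathscr{G}_u)\subset\mathbb{R}^6/\mathbb{R}$, with its usual multiplicities, is the tropicalization of the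 intersection with the torus of $\mathscr{G}_u=\{L\in\mathrm{Gr}(1,3)\mid[1:1:1:1]\in L\}$. $Z_\Sigma$ is called the tropical Chow hypersurface of $\Sigma$. Minkowski sum of weighted polyhedral complexes $\Sigma_1,\Sigma_2$ of pure dimension $d_1,d_2$: as a set $\{a+b\mid a\in\Sigma_1,b\in\Sigma_2\}$. For maximal $\sigma_1\in\Sigma_1,\sigma_2\in\Sigma_2$ of weights $m_{\sigma_1},m_{\sigma_2}$, the weight of $\sigma_1+\sigma_2$ is $0$ if $\dim(\sigma_1+\sigma_2)\ne d_1+d_2$ and $m_{\sigma_1}m_{\sigma_2}[N_{\sigma_1+\sigma_2}:N_{\sigma_1}+N_{\sigma_2}]$ otherwise, where $N_\sigma$ is the lattice of integer points in the linear space parallel to the affine span of $\sigma$. After choosing a polyhedral structure on the sum in which each $\sigma_1+\sigma_2$ is a union of polyhedra, the weight of a maximal polyhedron $\sigma$ is the sum of the weights of all $\sigma_1+\sigma_2$ containing $\sigma$. *)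

theory Defs
  imports
    "HOL-Analysis.Analysis"
    "HOL-Library.Poly_Mapping"
    "HOL-Library.Extended_Nat"
    "HOL-Algebra.Algebraic_Closure_Type"
begin

section \<open>Nontrivially valued fields\<close>

text \<open>The value of \<open>val 0\<close>, mathematically infinite, is unspecified; every use below treats \<open>0\<close>
  separately.\<close>

class valued_field = Fields.field +
  fixes val :: "'a \<Rightarrow> real"
  assumes val_mult: "x \<noteq> 0 \<Longrightarrow> y \<noteq> 0 \<Longrightarrow> val (x * y) = val x + val y"
    and val_add: "x \<noteq> 0 \<Longrightarrow> y \<noteq> 0 \<Longrightarrow> x + y \<noteq> 0 \<Longrightarrow> min (val x) (val y) \<le> val (x + y)"
    and val_nontrivial: "\<exists>x. x \<noteq> 0 \<and> val x \<noteq> 0"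

definition value_group :: "'a::valued_field itself \<Rightarrow> real set" where
  "value_group _ = {val x | x::'a. x \<noteq> 0}"

definition val_ring :: "'a::valued_field set" where
  "val_ring = {x. x = 0 \<or> 0 \<le> val x}"

definition val_max_ideal :: "'a::valued_field set" where
  "val_max_ideal = {x. x = 0 \<or> 0 < val x}"

lemma val_1 [simp]: "val (1::'a::valued_field) = 0"
  using val_mult[of "1::'a" 1] by simp

lemma val_uminus [simp]: "val (- x) = val (x::'a::valued_field)"
proof (cases "x = 0")
  case False
  have "val (- 1 :: 'a) = 0"
    using val_mult[of "- 1::'a" "- 1"] by simp
  with False show ?thesis
    using val_mult[of "- 1" x] by simp
qed simp

lemma val_inverse: "x \<noteq> 0 \<Longrightarrow> val (inverse x) = - val (x::'a::valued_field)"
  using val_mult[of x "inverse x"] by simp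

lemma val_ring_0 [simp]: "0 \<in> val_ring" and val_ring_1 [simp]: "1 \<in> val_ring"
  by (auto simp: val_ring_def)

lemma val_ring_add: "x \<in> val_ring \<Longrightarrow> y \<in> val_ring \<Longrightarrow> x + y \<in> val_ring"
  unfolding val_ring_def using val_add[of x y] by fastforce

lemma val_ring_uminus: "x \<in> val_ring \<Longrightarrow> - x \<in> val_ring"
  by (auto simp: val_ring_def)

lemma val_ring_mult: "x \<in> val_ring \<Longrightarrow> y \<in> val_ring \<Longrightarrow> x * y \<in> val_ring"
  unfolding val_ring_def using val_mult[of x y] by fastforce

lemma val_max_ideal_0 [simp]: "0 \<in> val_max_ideal"
  by (auto simp: val_max_ideal_def)

lemma val_max_ideal_add: "x \<in> val_max_ideal \<Longrightarrow> y \<in> val_max_ideal \<Longrightarrow> x + y \<in> val_max_ideal"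
  unfolding val_max_ideal_def using val_add[of x y] by fastforce

lemma val_max_ideal_uminus: "x \<in> val_max_ideal \<Longrightarrow> - x \<in> val_max_ideal"
  by (auto simp: val_max_ideal_def)

lemma val_max_ideal_mult: "x \<in> val_max_ideal \<Longrightarrow> y \<in> val_ring \<Longrightarrow> x * y \<in> val_max_ideal"
  unfolding val_max_ideal_def val_ring_def using val_mult[of x y] by fastforce

lemma val_ring_inverse: "x \<in> val_ring \<Longrightarrow> x \<notin> val_max_ideal \<Longrightarrow> inverse x \<in> val_ring"
  unfolding val_max_ideal_def val_ring_def using val_inverse[of x] by fastforce

definition residue_rel :: "'a::valued_field \<Rightarrow> 'a \<Rightarrow> bool" where
  "residue_rel x y \<longleftrightarrow> x \<in> val_ring \<and> y \<in> val_ring \<and> x - y \<in> val_max_ideal"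

lemma residue_rel_trans: "residue_rel x y \<Longrightarrow> residue_rel y z \<Longrightarrow> residue_rel x z"
  unfolding residue_rel_def using val_max_ideal_add[of "x - y" "y - z"] by simp

lemma residue_rel_sym: "residue_rel x y \<Longrightarrow> residue_rel y x"
  unfolding residue_rel_def using val_max_ideal_uminus[of "x - y"] by simp

quotient_type (overloaded) 'a residue = "'a::valued_field" / partial: residue_rel
proof (rule part_equivpI)
  show "\<exists>x::'a. residue_rel x x"
    by (rule exI[of _ 0]) (simp add: residue_rel_def)
  show "symp (residue_rel :: 'a \<Rightarrow> 'a \<Rightarrow> bool)"
    by (rule sympI) (rule residue_rel_sym)
  show "transp (residue_rel :: 'a \<Rightarrow> 'a \<Rightarrow> bool)"
    by (rule transpI) (rule residue_rel_trans)
qed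

lemma residue_rel_add:
  assumes "residue_rel x x'" "residue_rel y y'"
  shows "residue_rel (x + y) (x' + y')"
proof -
  have "x + y - (x' + y') = (x - x') + (y - y')" by simp
  then show ?thesis
    using assms by (metis residue_rel_def val_ring_add val_max_ideal_add)
qed

lemma residue_rel_uminus:
  assumes "residue_rel x x'"
  shows "residue_rel (- x) (- x')"
proof -
  have "- x - - x' = - (x - x')" by simp
  then show ?thesis
    using assms by (metis residue_rel_def val_ring_uminus val_max_ideal_uminus)
qed

lemma residue_rel_mult:
  assumes "residue_rel x x'" "residue_rel y y'"
  shows "residue_rel (x * y) (x' * y')"
proof -
  have "x * y - x' * y' = (x - x') * y + (y - y') * x'" by (simp add: algebra_simps)
  then show ?thesis
    using assms by (metis residue_rel_def val_ring_mult val_max_ideal_mult val_max_ideal_add)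
qed

lemma residue_rel_inverse:
  assumes "residue_rel x x'"
  shows "residue_rel (if x \<in> val_max_ideal then 0 else inverse x)
                     (if x' \<in> val_max_ideal then 0 else inverse x')"
proof -
  have iff: "x \<in> val_max_ideal \<longleftrightarrow> x' \<in> val_max_ideal"
    using assms val_max_ideal_add[of "x - x'" x'] val_max_ideal_add[of "- (x - x')" x]
      val_max_ideal_uminus[of "x - x'"] by (auto simp: residue_rel_def)
  show ?thesis
  proof (cases "x \<in> val_max_ideal")
    case True
    with iff show ?thesis by (simp add: residue_rel_def)
  next
    case False
    with iff have x': "x' \<notin> val_max_ideal" by simp
    from False x' have nz: "x \<noteq> 0" "x' \<noteq> 0" by auto
    have inv: "inverse x \<in> val_ring" "inverse x' \<in> val_ring"
      using assms False x' by (auto simp: residue_rel_def intro: val_ring_inverse)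
    have "inverse x - inverse x' = (- (x - x')) * (inverse x * inverse x')"
      using nz by (simp add: field_simps)
    moreover have "(- (x - x')) * (inverse x * inverse x') \<in> val_max_ideal"
      using assms inv
      by (intro val_max_ideal_mult val_max_ideal_uminus val_ring_mult) (auto simp: residue_rel_def)
    ultimately show ?thesis
      using False x' inv by (simp add: residue_rel_def)
  qed
qed

instantiation residue :: (valued_field) "Fields.field"
begin

lift_definition zero_residue :: "'a residue" is 0
  by (simp add: residue_rel_def)

lift_definition one_residue :: "'a residue" is 1
  by (simp add: residue_rel_def)

lift_definition plus_residue :: "'a residue \<Rightarrow> 'a residue \<Rightarrow> 'a residue" is "(+)"
  by (rule residue_rel_add)

lift_definition uminus_residue :: "'a residue \<Rightarrow> 'a residue" is uminus
  by (rule residue_rel_uminus)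

definition minus_residue :: "'a residue \<Rightarrow> 'a residue \<Rightarrow> 'a residue" where
  "minus_residue x y = x + (- y)"

lift_definition times_residue :: "'a residue \<Rightarrow> 'a residue \<Rightarrow> 'a residue" is "(*)"
  by (rule residue_rel_mult)

lift_definition inverse_residue :: "'a residue \<Rightarrow> 'a residue"
  is "\<lambda>x. if x \<in> val_max_ideal then 0 else inverse x"
  by (rule residue_rel_inverse)

definition divide_residue :: "'a residue \<Rightarrow> 'a residue \<Rightarrow> 'a residue" where
  "divide_residue x y = x * inverse y"

instance
proof
  fix a b c :: "'a residue"
  show "a + b + c = a + (b + c)"
    by transfer (auto simp: residue_rel_def algebra_simps intro: val_ring_add)
  show "a + b = b + a"
    by transfer (auto simp: residue_rel_def algebra_simps intro: val_ring_add)
  show "0 + a = a"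
    by transfer (auto simp: residue_rel_def)
  show "- a + a = 0"
    by transfer (auto simp: residue_rel_def)
  show "a - b = a + - b"
    by (simp add: minus_residue_def)
  show "a * b * c = a * (b * c)"
    by transfer (auto simp: residue_rel_def algebra_simps intro: val_ring_mult)
  show "a * b = b * a"
    by transfer (auto simp: residue_rel_def algebra_simps intro: val_ring_mult)
  show "1 * a = a"
    by transfer (auto simp: residue_rel_def)
  show "(a + b) * c = a * c + b * c"
    by transfer (auto simp: residue_rel_def algebra_simps intro: val_ring_add val_ring_mult)
  show "(0::'a residue) \<noteq> 1"
    by transfer (auto simp: residue_rel_def val_max_ideal_def)
  show "a \<noteq> 0 \<Longrightarrow> inverse a * a = 1"
  proof transfer
    fix a :: 'a
    assume "residue_rel a a" "\<not> residue_rel a 0"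
    then have "a \<notin> val_max_ideal" "a \<noteq> 0"
      by (auto simp: residue_rel_def)
    then show "residue_rel ((if a \<in> val_max_ideal then 0 else inverse a) * a) 1"
      by (simp add: residue_rel_def)
  qed
  show "a div b = a * inverse b"
    by (simp add: divide_residue_def)
  show "inverse (0::'a residue) = 0"
    by transfer (auto simp: residue_rel_def)
qed

end

text \<open>Reduction modulo the maximal ideal; only its values on \<open>val_ring\<close> are meaningful.\<close>

lift_definition red :: "'a::valued_field \<Rightarrow> 'a residue" is "\<lambda>x. if x \<in> val_ring then x else 0"
  by (simp add: residue_rel_def)


section \<open>Tropicalization of subvarieties of the torus\<close>

text \<open>Laurent polynomials are finitely supported maps from exponent vectors to coefficients.\<close>

type_synonym ('n, 'a) laurent = "(int^'n) \<Rightarrow>\<^sub>0 'a"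

definition torus :: "('a::zero^'n) set" where
  "torus = {p. \<forall>i. p $ i \<noteq> 0}"

definition laurent_monom :: "'a::Fields.field^'n \<Rightarrow> int^'n \<Rightarrow> 'a" where
  "laurent_monom p m = (\<Prod>i\<in>UNIV. p $ i powi (m $ i))"

definition laurent_eval :: "('n::finite, 'a::Fields.field) laurent \<Rightarrow> 'a^'n \<Rightarrow> 'a" where
  "laurent_eval f p = (\<Sum>m\<in>Poly_Mapping.keys f. Poly_Mapping.lookup f m * laurent_monom p m)"

definition torus_ideal :: "('a::Fields.field^'n) set \<Rightarrow> ('n::finite, 'a) laurent set" where
  "torus_ideal Y = {f. \<forall>p\<in>Y \<inter> torus. laurent_eval f p = 0}"

definition trop_term :: "('n::finite, 'a::valued_field) laurent \<Rightarrow> real^'n \<Rightarrow> int^'n \<Rightarrow> real" where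
  "trop_term f w m = val (Poly_Mapping.lookup f m) + (\<Sum>i\<in>UNIV. w $ i * of_int (m $ i))"

definition trop_hypersurface :: "('n::finite, 'a::valued_field) laurent \<Rightarrow> (real^'n) set" where
  "trop_hypersurface f = {w. f = 0 \<or>
     (\<exists>m\<in>Poly_Mapping.keys f. \<exists>m'\<in>Poly_Mapping.keys f. m \<noteq> m' \<and>
        (\<forall>l\<in>Poly_Mapping.keys f. trop_term f w m \<le> trop_term f w l) \<and>
        (\<forall>l\<in>Poly_Mapping.keys f. trop_term f w m' \<le> trop_term f w l))}"

definition trop_set :: "('n::finite, 'a::valued_field) laurent set \<Rightarrow> (real^'n) set" where
  "trop_set I = (\<Inter>f\<in>I. trop_hypersurface f)"

text \<open>For \<open>t\<close> in the torus with coordinatewise valuation \<open>w\<close>, \<open>init_ideal t I\<close> is the initial ideal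
  \<open>in\<^sub>w(I)\<close> over the residue field: the reductions of those \<open>f(t x)\<close>, \<open>f \<in> I\<close>, that have coefficients
  in the valuation ring.  Another choice of \<open>t\<close> over the same \<open>w\<close> changes it by an automorphism
  rescaling the coordinates.\<close>

definition laurent_twist :: "'a::Fields.field^'n \<Rightarrow> ('n::finite, 'a) laurent \<Rightarrow> ('n, 'a) laurent" where
  "laurent_twist t f = Poly_Mapping.mapp (\<lambda>m c. c * laurent_monom t m) f"

definition init_ideal ::
    "'a::valued_field^'n \<Rightarrow> ('n::finite, 'a) laurent set \<Rightarrow> ('n, 'a residue) laurent set" where
  "init_ideal t I = {Poly_Mapping.map red (laurent_twist t f) | f.
     f \<in> I \<and> (\<forall>m. Poly_Mapping.lookup (laurent_twist t f) m \<in> val_ring)}"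

definition minimal_primes :: "'a::comm_ring_1 set \<Rightarrow> 'a set set" where
  "minimal_primes I = {P. primeideal P ring_of_type_algebra \<and> I \<subseteq> P \<and>
     (\<forall>Q. primeideal Q ring_of_type_algebra \<and> I \<subseteq> Q \<and> Q \<subseteq> P \<longrightarrow> Q = P)}"

text \<open>The submodules of the localization \<open>(R/I)\<^sub>P\<close> correspond, by taking preimages in \<open>R\<close>, to the
  ideals \<open>J \<supseteq> I\<close> of \<open>R\<close> that are saturated with respect to \<open>R - P\<close>; so the supremum of the
  lengths of chains of such ideals is the length of \<open>(R/I)\<^sub>P\<close> as an \<open>R\<^sub>P\<close>-module.\<close>

definition local_ideals :: "'a::comm_ring_1 set \<Rightarrow> 'a set \<Rightarrow> 'a set set" where
  "local_ideals I P = {J. ideal J ring_of_type_algebra \<and> I \<subseteq> J \<and>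
     (\<forall>s f. s \<notin> P \<and> s * f \<in> J \<longrightarrow> f \<in> J)}"

definition local_length :: "'a::comm_ring_1 set \<Rightarrow> 'a set \<Rightarrow> enat" where
  "local_length I P =
     (SUP C \<in> {C. subset.chain (local_ideals I P) C \<and> finite C \<and> C \<noteq> {}}. enat (card C - 1))"

text \<open>Laurent polynomial rings over a field are Noetherian, so the sum is finite when
  \<open>ideal_mult\<close> is used for them.\<close>

definition ideal_mult :: "'a::comm_ring_1 set \<Rightarrow> enat" where
  "ideal_mult I = (\<Sum>P\<in>minimal_primes I. local_length I P)"


section \<open>Weighted polyhedral complexes\<close>

text \<open>Subsets of \<open>\<real>\<^sup>n/\<real>(1,\<dots>,1)\<close> are represented by their preimages in \<open>\<real>\<^sup>n\<close>, that is, by subsets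
  invariant under translation by multiples of \<open>(1,\<dots>,1)\<close>.  Passing to the preimage commutes with
  unions, intersections, faces, relative interiors, polyhedrality, (\<open>\<Gamma>\<close>-)rationality and Minkowski
  sums; it raises dimensions by one, which \<open>tdim\<close> corrects.  The preimage of the lattice
  \<open>N\<^sub>\<sigma> \<subseteq> \<int>\<^sup>n/\<int>(1,\<dots>,1)\<close> is the lattice \<open>lat \<sigma>\<close> below; as all these preimages contain \<open>(1,\<dots>,1)\<close>,
  indices and membership are the same before and after passing to the quotient.\<close>

definition tdim :: "(real^'n) set \<Rightarrow> int" where
  "tdim S = aff_dim S - 1"

definition lin_space :: "(real^'n) set \<Rightarrow> (real^'n) set" where
  "lin_space S = span {x - y | x y. x \<in> S \<and> y \<in> S}"

definition lat :: "(real^'n) set \<Rightarrow> (real^'n) set" where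
  "lat S = lin_space S \<inter> {x. \<forall>i. x $ i \<in> \<int>}"

definition polyhedral_complex :: "(real^'n) set set \<Rightarrow> bool" where
  "polyhedral_complex C \<longleftrightarrow> finite C \<and>
     (\<forall>S\<in>C. polyhedron S \<and> S \<noteq> {} \<and> (\<forall>x\<in>S. \<forall>c. x + (\<chi> i. c) \<in> S)) \<and>
     (\<forall>S\<in>C. \<forall>F. F face_of S \<and> F \<noteq> {} \<longrightarrow> F \<in> C) \<and>
     (\<forall>S\<in>C. \<forall>T\<in>C. S \<inter> T face_of S \<and> S \<inter> T face_of T)"

definition rational_polyhedron :: "real set \<Rightarrow> (real^'n) set \<Rightarrow> bool" where
  "rational_polyhedron G S \<longleftrightarrow>
     (\<exists>H. finite H \<and> (\<forall>(a, b)\<in>H. (\<forall>i. a $ i \<in> \<rat>) \<and> b \<in> G) \<and> S = {x. \<forall>(a, b)\<in>H. a \<bullet> x \<le> b})"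

definition max_cells :: "(real^'n) set set \<Rightarrow> (real^'n) set set" where
  "max_cells C = {S \<in> C. \<forall>T\<in>C. S \<subseteq> T \<longrightarrow> T = S}"

definition pure_dim :: "int \<Rightarrow> (real^'n) set set \<Rightarrow> bool" where
  "pure_dim d C \<longleftrightarrow> (\<forall>S\<in>max_cells C. tdim S = d)"

definition complex_dim :: "(real^'n) set set \<Rightarrow> int" where
  "complex_dim C = Max (tdim ` C)"

text \<open>Only the weights of maximal cells are meaningful.\<close>

datatype ('n::finite) wcomplex =
  WComplex (cells: "(real^'n) set set") (weight: "(real^'n) set \<Rightarrow> int")

definition support :: "'n::finite wcomplex \<Rightarrow> (real^'n) set" where
  "support A = \<Union>{S \<in> max_cells (cells A). weight A S \<noteq> 0}"

text \<open>\<open>u\<close> generates \<open>N\<^sub>S / N\<^sub>T\<close> and points from the facet \<open>T\<close> into \<open>S\<close>.\<close>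

definition primitive_normal :: "(real^'n) set \<Rightarrow> (real^'n) set \<Rightarrow> real^'n \<Rightarrow> bool" where
  "primitive_normal T S u \<longleftrightarrow>
     lat S = {of_int z *\<^sub>R u + v | z v. v \<in> lat T} \<and> (\<exists>x\<in>T. \<exists>e>0. x + e *\<^sub>R u \<in> S)"

definition balanced :: "int \<Rightarrow> 'n::finite wcomplex \<Rightarrow> bool" where
  "balanced d A \<longleftrightarrow> (\<forall>T\<in>cells A. tdim T = d - 1 \<longrightarrow>
     (\<exists>u. (\<forall>S\<in>max_cells (cells A). T \<subseteq> S \<longrightarrow> primitive_normal T S (u S)) \<and>
          (\<Sum>S | S \<in> max_cells (cells A) \<and> T \<subseteq> S. of_int (weight A S) *\<^sub>R u S) \<in> lat T))"

definition tropical_variety :: "real set \<Rightarrow> int \<Rightarrow> 'n::finite wcomplex \<Rightarrow> bool" where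
  "tropical_variety G d A \<longleftrightarrow> polyhedral_complex (cells A) \<and>
     (\<forall>S\<in>cells A. rational_polyhedron G S) \<and> pure_dim d (cells A) \<and> balanced d A"

abbreviation tropical_curve :: "real set \<Rightarrow> 'n::finite wcomplex \<Rightarrow> bool" where
  "tropical_curve G A \<equiv> tropical_variety G 1 A"

definition fan :: "(real^'n) set set \<Rightarrow> bool" where
  "fan F \<longleftrightarrow> polyhedral_complex F \<and> (\<forall>S\<in>F. cone S)"

definition is_fan_set :: "(real^'n) set \<Rightarrow> bool" where
  "is_fan_set S \<longleftrightarrow> (\<exists>F. fan F \<and> S = \<Union>F)"

definition nonzero_part :: "'n::finite wcomplex \<Rightarrow> 'n::finite wcomplex" where
  "nonzero_part A = WComplex
     {T \<in> cells A. \<exists>S\<in>max_cells (cells A). weight A S \<noteq> 0 \<and> T \<subseteq> S} (weight A)"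

definition subdivision_of :: "'n::finite wcomplex \<Rightarrow> 'n::finite wcomplex \<Rightarrow> bool" where
  "subdivision_of B A \<longleftrightarrow> polyhedral_complex (cells B) \<and> \<Union>(cells B) = \<Union>(cells A) \<and>
     (\<forall>T\<in>cells B. \<exists>S\<in>cells A. T \<subseteq> S) \<and>
     (\<forall>T\<in>max_cells (cells B). \<forall>S\<in>max_cells (cells A). T \<subseteq> S \<longrightarrow> weight B T = weight A S)"

text \<open>Equality of weighted complexes: agreement up to subdivision and cells of weight \<open>0\<close>.\<close>

definition wcomplex_eq :: "'n::finite wcomplex \<Rightarrow> 'n::finite wcomplex \<Rightarrow> bool"  (infix \<open>\<approx>\<^sub>w\<close> 50) where
  "A \<approx>\<^sub>w B \<longleftrightarrow>
     (\<exists>C. subdivision_of C (nonzero_part A) \<and> subdivision_of C (nonzero_part B))"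

text \<open>Push-forward along an injective linear map with saturated image lattice.\<close>

definition push_wcomplex :: "(real^'n \<Rightarrow> real^'m) \<Rightarrow> 'n::finite wcomplex \<Rightarrow> 'm::finite wcomplex" where
  "push_wcomplex f A = WComplex ((`) f ` cells A) (\<lambda>S. weight A (f -` S))"

text \<open>The number of cosets of the subgroup \<open>H\<close> in \<open>L\<close>.\<close>

definition lattice_index :: "(real^'n) set \<Rightarrow> (real^'n) set \<Rightarrow> nat" where
  "lattice_index L H = card ((\<lambda>x. x +o H) ` L)"

definition minkowski_weight ::
    "'n::finite wcomplex \<Rightarrow> 'n::finite wcomplex \<Rightarrow> (real^'n) set \<Rightarrow> (real^'n) set \<Rightarrow> int" where
  "minkowski_weight A B S T =
     (if tdim (S + T) \<noteq> complex_dim (cells A) + complex_dim (cells B) then 0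
      else weight A S * weight B T * int (lattice_index (lat (S + T)) (lat S + lat T)))"

text \<open>The Minkowski sum depends on the choice of a polyhedral structure; \<open>minkowski_sum A B Z\<close> says
  that \<open>Z\<close> is the Minkowski sum of \<open>A\<close> and \<open>B\<close> for some such choice.\<close>

definition minkowski_sum :: "'n::finite wcomplex \<Rightarrow> 'n::finite wcomplex \<Rightarrow> 'n::finite wcomplex \<Rightarrow> bool" where
  "minkowski_sum A B Z \<longleftrightarrow> polyhedral_complex (cells Z) \<and>
     \<Union>(cells Z) = {a + b | a b. a \<in> \<Union>(cells A) \<and> b \<in> \<Union>(cells B)} \<and>
     (\<forall>S\<in>max_cells (cells A). \<forall>T\<in>max_cells (cells B). \<exists>F\<subseteq>cells Z. S + T = \<Union>F) \<and>
     (\<forall>U\<in>max_cells (cells Z). weight Z U =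
        (\<Sum>(S, T) | S \<in> max_cells (cells A) \<and> T \<in> max_cells (cells B) \<and> U \<subseteq> S + T.
           minkowski_weight A B S T))"

text \<open>\<open>Y\<close> is the set of all homogeneous coordinate vectors of the points of a projective variety, and
  \<open>A\<close> is a polyhedral structure on the tropicalization of its intersection with the torus,
  weighted by the usual multiplicities: the sum, over the minimal primes \<open>P\<close> of the initial ideal
  \<open>in\<^sub>w(I)\<close> at a point \<open>w\<close> of the relative interior of the cell, of the multiplicity of \<open>in\<^sub>w(I)\<close>
  along \<open>P\<close>.  Points \<open>w\<close> with coordinates in the value group are dense in every cell.  The homogeneous
  Laurent ideal in all coordinates is the extension of the ideal in the degree-zero Laurent
  polynomials, with the same minimal primes and lengths.\<close>

definition tropicalization :: "('a::valued_field^'n) set \<Rightarrow> 'n::finite wcomplex \<Rightarrow> bool" where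
  "tropicalization Y A \<longleftrightarrow> polyhedral_complex (cells A) \<and>
     (\<forall>S\<in>cells A. rational_polyhedron (value_group TYPE('a)) S) \<and>
     (\<exists>d. pure_dim d (cells A)) \<and>
     \<Union>(cells A) = trop_set (torus_ideal Y) \<and>
     (\<forall>S\<in>max_cells (cells A). \<forall>t\<in>torus. (\<chi> i. val (t $ i)) \<in> rel_interior S \<longrightarrow>
        (\<exists>k. ideal_mult (init_ideal t (torus_ideal Y)) = enat k \<and> weight A S = int k))"


section \<open>Lines in projective 3-space\<close>

text \<open>Coordinates on \<open>\<real>\<^sup>4\<close> are indexed by the type \<open>4 = {0, 1, 2, 3}\<close>, Pluecker coordinates by the
  pairs \<open>i < j\<close>.\<close>

typedef pidx = "{(i, j). i < j} :: (4 \<times> 4) set"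
proof -
  have "(0::4) < 1" by (simp add: less_bit0_def bit0.Rep_0 bit0.Rep_1)
  then show ?thesis by blast
qed

instance pidx :: finite
proof
  have "finite (range Rep_pidx)" by simp
  then show "finite (UNIV :: pidx set)"
    by (rule finite_imageD) (auto intro: injI simp: Rep_pidx_inject)
qed

abbreviation fst_idx :: "pidx \<Rightarrow> 4" where "fst_idx e \<equiv> fst (Rep_pidx e)"
abbreviation snd_idx :: "pidx \<Rightarrow> 4" where "snd_idx e \<equiv> snd (Rep_pidx e)"

definition pluecker :: "'a::Fields.field^4 \<Rightarrow> 'a^4 \<Rightarrow> 'a^pidx" where
  "pluecker x y = (\<chi> e. x $ fst_idx e * y $ snd_idx e - x $ snd_idx e * y $ fst_idx e)"

text \<open>A line in projective 3-space is a 2-dimensional subspace \<open>L\<close>; the homogeneous coordinate vectors of its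
  Pluecker point are the vectors of minors of its bases.\<close>

definition lines :: "('a::Fields.field^4) set set" where
  "lines = {L. vec.subspace L \<and> vec.dim L = 2}"

definition pluecker_vectors :: "('a::Fields.field^4) set \<Rightarrow> ('a^pidx) set" where
  "pluecker_vectors L = {pluecker x y | x y. vec.span {x, y} = L}"

definition lines_through_unit_point :: "('a::Fields.field^pidx) set" where
  "lines_through_unit_point = (\<Union>L\<in>{L \<in> lines. (\<chi> i. 1) \<in> L}. pluecker_vectors L)"

definition phi :: "real^4 \<Rightarrow> real^pidx" where
  "phi a = (\<chi> e. a $ fst_idx e + a $ snd_idx e)"

end

theory Submission
  imports Defs
begin

text \<open>
  The torus part of \<open>\<G>\<^sub>u\<close> consists of the points \<open>(u\<^sub>j - u\<^sub>i)\<close>, so \<open>\<Gamma>\<^sub>0\<close> is the space of four-leaf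
  trees: in every triangle \<open>i, j, k\<close> the minimum of the coordinates is attained twice.  On the cone
  spanned by two opposite edges \<open>ij\<close>, \<open>kl\<close> the initial ideal is prime, hence has nonzero multiplicity
  there.

  For a generic point \<open>a\<close> of the curve consider the weight of the Minkowski sum at \<open>x = \<phi>(a) + y\<close>,
  where \<open>y\<close> is a short generic vector in the cone of \<open>ij\<close> and \<open>kl\<close>.  Any other contribution
  \<open>x = \<phi>(a') + y'\<close> with \<open>y' \<in> \<Gamma>\<^sub>0\<close> has \<open>a' - a\<close> of a very restricted shape.  If \<open>a\<close> is not on a
  coordinate axis, a suitable choice of the pairing and genericity exclude it; if \<open>a\<close> is on the positive
  half of an axis, then \<open>a'\<close> is off the axes; and if \<open>a\<close> is on a negative half, then \<open>a'\<close> is off the axes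
  or on a positive half.  In this order the weights of the curve can be read off from those of the sum.
  The fan condition makes the linear space of a cell containing \<open>a\<close> the span of \<open>a\<close> and
  \<open>(1,1,1,1)\<close>, so that contributions of differently subdivided curves can be compared.
\<close>

text \<open>A weight of the sum adds up all decompositions x = \<phi>(a') + y', and these can
  overlap on open sets, so genericity alone cannot isolate one point of the curve. For x = \<phi>(a)
  + y with y over the edges ij and kl, the displacement a' - a is, modulo (1,1,1,1), a multiple of
  e_i + e_j, or one of the two pairs has its coordinates torn apart. The former is harmless: a plane
  of the curve that comes close enough to a passes through a. The latter puts a combination of a and
  e_i + e_j into the span of the plane of a' and one unit vector; this is a proper condition when
  a_i differs from a_j and a_k from a_l. On an axis three coordinates agree and no pairing separates
  both pairs, which forces the order by axes. The factor with which a enters depends only on its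
  plane and the chosen cell of \<open>\<Gamma>\<^sub>0\<close>, so it is common to both curves and
  cancels once it is nonzero. As the quotients are represented by preimages, the cells of the curve,
  of \<open>\<Gamma>\<^sub>0\<close> and of the sum have dimensions 2, 3 and 4 = 2 + 3 - 1, the line
  of (1,1,1,1) being shared.\<close>

no_notation fps_nth (infixl \<open>$\<close> 75)

text \<open>Otherwise there are x outside the old subspaces and y outside \<open>L\<close>, so x
  lies in \<open>L\<close> and the open segment from x to y avoids \<open>L\<close>. Its infinitely
  many points lie in finitely many old subspaces; two of them share one, which then contains the
  whole line and with it x.\<close>

lemma convex_subset_Union_affine:
  fixes C :: "'a::real_vector set"
  assumes "finite \<A>" "\<And>L. L \<in> \<A> \<Longrightarrow> affine L" "convex C" "C \<noteq> {}" "C \<subseteq> \<Union>\<A>"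
  shows "\<exists>L\<in>\<A>. C \<subseteq> L"
  using assms
proof (induction \<A> rule: finite_induct)
  case empty
  then show ?case by auto
next
  case (insert L \<A>)
  show ?case
  proof (cases "C \<subseteq> \<Union>\<A> \<or> C \<subseteq> L")
    case True
    then show ?thesis using insert by auto
  next
    case False
    then obtain x y where x: "x \<in> C" "x \<notin> \<Union>\<A>" and y: "y \<in> C" "y \<notin> L"
      by blast
    with insert.prems have xL: "x \<in> L" by auto
    define p where "p t = (1 - t) *\<^sub>R x + t *\<^sub>R y" for t :: real
    have aff: "x \<in> M" if "affine M" "p s \<in> M" "p t \<in> M" "s \<noteq> t" for M s t
    proof -
      have "x = (t / (t - s)) *\<^sub>R p s + (- s / (t - s)) *\<^sub>R p t"
      proof -
        have "(t - s) *\<^sub>R x = t *\<^sub>R p s + (- s) *\<^sub>R p t"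
          by (simp add: p_def algebra_simps)
        moreover have "x = (1 / (t - s)) *\<^sub>R ((t - s) *\<^sub>R x)" using that(4) by simp
        ultimately have "x = (1 / (t - s)) *\<^sub>R (t *\<^sub>R p s + (- s) *\<^sub>R p t)" by simp
        then show ?thesis by (simp add: scaleR_right_distrib scaleR_right_diff_distrib divide_inverse mult.commute)
      qed
      moreover have "t / (t - s) + - s / (t - s) = 1"
        using that(4) by (simp add: diff_divide_distrib [symmetric] add_divide_distrib [symmetric])
      ultimately show ?thesis using that unfolding affine_def by metis
    qed
    have mem: "\<exists>M\<in>\<A>. p t \<in> M" if "t \<in> {0<..<1}" for t
    proof -
      have "p t \<in> C" using that insert.prems(2) x(1) y(1) by (auto simp: p_def convex_alt)
      moreover have "p t \<notin> L"
      proof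
        assume "p t \<in> L"
        have "y = (1 - 1 / t) *\<^sub>R x + (1 / t) *\<^sub>R p t"
          using that by (simp add: p_def algebra_simps divide_simps)
             (simp add: scaleR_add_left [symmetric] add_divide_distrib [symmetric])
        moreover have "(1 - 1 / t) + 1 / t = 1" by simp
        ultimately show False
          using \<open>p t \<in> L\<close> xL insert.prems(1)[of L] y(2) unfolding affine_def by (metis insertI1)
      qed
      ultimately show ?thesis using insert.prems(4) by auto
    qed
    then obtain m where m: "m t \<in> \<A> \<and> p t \<in> m t" if "t \<in> {0<..<1}" for t
      by metis
    have "\<not> inj_on m {0<..<1::real}"
    proof
      assume "inj_on m {0<..<1::real}"
      moreover have "finite (m ` {0<..<1::real})"
        using m insert.hyps(1) by (meson finite_subset image_subsetI)
      ultimately show False using finite_imageD[of m] infinite_Ioo[of 0 "1::real"] by simp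
    qed
    then obtain s t where "s \<in> {0<..<1}" "t \<in> {0<..<1}" "s \<noteq> t" "m s = m t"
      by (auto simp: inj_on_def)
    then have "x \<in> m s" using aff[of "m s" s t] m insert.prems(1) by (metis insertI2)
    then show ?thesis using x(2) m \<open>s \<in> _\<close> by auto
  qed
qed

text \<open>Source of the generic points below: the convex set has to be compared with one affine
  space at a time only, usually by dimension.\<close>

lemma convex_avoid_affine:
  fixes C :: "'a::real_vector set"
  assumes "finite \<A>" "\<And>L. L \<in> \<A> \<Longrightarrow> affine L" "convex C" "C \<noteq> {}" "\<And>L. L \<in> \<A> \<Longrightarrow> \<not> C \<subseteq> L"
  shows "\<exists>x\<in>C. \<forall>L\<in>\<A>. x \<notin> L"
  using convex_subset_Union_affine[OF assms(1-4)] assms(5) by blast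

subsection \<open>Cells of a polyhedral complex\<close>

lemma polyhedral_complexD:
  assumes "polyhedral_complex C"
  shows "finite C" and "S \<in> C \<Longrightarrow> polyhedron S" and "S \<in> C \<Longrightarrow> S \<noteq> {}"
    and "S \<in> C \<Longrightarrow> x \<in> S \<Longrightarrow> x + (\<chi> i. c) \<in> S"
    and "S \<in> C \<Longrightarrow> F face_of S \<Longrightarrow> F \<noteq> {} \<Longrightarrow> F \<in> C"
    and "S \<in> C \<Longrightarrow> T \<in> C \<Longrightarrow> S \<inter> T face_of S"
    and "S \<in> C \<Longrightarrow> convex S" and "S \<in> C \<Longrightarrow> closed S"
proof -
  show "finite C" using assms by (simp add: polyhedral_complex_def)
  have S: "\<forall>S\<in>C. polyhedron S \<and> S \<noteq> {} \<and> (\<forall>x\<in>S. \<forall>c. x + (\<chi> i. c) \<in> S)"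
    and F: "\<forall>S\<in>C. \<forall>F. F face_of S \<and> F \<noteq> {} \<longrightarrow> F \<in> C"
    and I: "\<forall>S\<in>C. \<forall>T\<in>C. S \<inter> T face_of S \<and> S \<inter> T face_of T"
    using assms by (auto simp only: polyhedral_complex_def)
  show "polyhedron S" "S \<noteq> {}" "convex S" "closed S" if "S \<in> C"
    using S that polyhedron_imp_convex polyhedron_imp_closed by auto
  show "x + (\<chi> i. c) \<in> S" if "S \<in> C" "x \<in> S" using S that by simp
  show "F \<in> C" if "S \<in> C" "F face_of S" "F \<noteq> {}" using F that by simp
  show "S \<inter> T face_of S" if "S \<in> C" "T \<in> C" using I that by simp
qed

lemma max_cellsD:
  assumes "S \<in> max_cells C"
  shows "S \<in> C" and "T \<in> C \<Longrightarrow> S \<subseteq> T \<Longrightarrow> T = S"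
  using assms by (simp_all add: max_cells_def)

lemma ex_max_cell:
  assumes "finite C" "S \<in> C"
  shows "\<exists>T\<in>max_cells C. S \<subseteq> T"
proof -
  have "\<exists>T\<in>C. S \<subseteq> T \<and> (\<forall>U\<in>C. T \<subseteq> U \<longrightarrow> T = U)"
    using finite_has_maximal2[OF assms] by metis
  then show ?thesis unfolding max_cells_def by auto
qed

text \<open>Take a minimal face containing \<open>x\<close>: were \<open>x\<close> on its relative
  frontier, a facet of it would be a smaller one.\<close>

lemma ex_face_rel_interior:
  fixes S :: "'a::euclidean_space set"
  assumes "polyhedron S" "x \<in> S"
  shows "\<exists>G. G face_of S \<and> x \<in> rel_interior G"
proof -
  have "finite {F. F face_of S \<and> x \<in> F}"
    using finite_polyhedron_faces[OF assms(1)] by (rule rev_finite_subset) auto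
  moreover have "S \<in> {F. F face_of S \<and> x \<in> F}"
    using assms face_of_refl polyhedron_imp_convex by auto
  ultimately obtain G where G: "G face_of S" "x \<in> G"
    and min: "\<And>F. F face_of S \<Longrightarrow> x \<in> F \<Longrightarrow> F \<subseteq> G \<Longrightarrow> F = G"
    using finite_has_minimal2[of "{F. F face_of S \<and> x \<in> F}" S] by auto
  have "x \<in> rel_interior G"
  proof (rule ccontr)
    assume "x \<notin> rel_interior G"
    have pG: "polyhedron G" using G assms(1) face_of_polyhedron_polyhedron by blast
    have "x \<in> rel_frontier G"
      using \<open>x \<notin> rel_interior G\<close> G(2) closure_subset by (auto simp: rel_frontier_def)
    then obtain F where "F facet_of G" "x \<in> F"
      using rel_frontier_of_polyhedron[OF pG] by auto
    then have "F face_of S" "F \<subseteq> G" "F \<noteq> G"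
      using G(1) face_of_trans facet_of_imp_face_of facet_of_imp_subset facet_of_irrefl by blast+
    then show False using min \<open>x \<in> F\<close> by blast
  qed
  with G show ?thesis by blast
qed

text \<open>The intersection is a face of \<open>U\<close> that meets the relative interior of
  \<open>U\<close>, and only \<open>U\<close> itself is such a face.\<close>

lemma rel_interior_cell_subset:
  assumes "polyhedral_complex C" "U \<in> C" "F \<in> C" "x \<in> rel_interior U" "x \<in> F"
  shows "U \<subseteq> F"
proof -
  have "U \<inter> F face_of U" using assms polyhedral_complexD(6) by blast
  then have "U \<inter> F = U"
    using assms(4,5) face_of_disjoint_rel_interior[of "U \<inter> F" U] rel_interior_subset by blast
  then show ?thesis by blast
qed

text \<open>The face of \<open>U\<close> with \<open>x\<close> in its relative interior is again a
  cell; as \<open>x\<close> is on no non-maximal cell, that face is maximal and therefore all of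
  \<open>U\<close>.\<close>

lemma rel_interior_max_cell:
  assumes "polyhedral_complex C" "U \<in> C" "x \<in> U" "\<And>N. N \<in> C - max_cells C \<Longrightarrow> x \<notin> N"
  shows "U \<in> max_cells C" "x \<in> rel_interior U"
proof -
  show U: "U \<in> max_cells C" using assms by blast
  obtain G where G: "G face_of U" "x \<in> rel_interior G"
    using ex_face_rel_interior[OF polyhedral_complexD(2)[OF assms(1,2)] assms(3)] by blast
  then have "G \<in> C" using assms polyhedral_complexD(5) by (metis emptyE rel_interior_empty)
  then have "G \<in> max_cells C" using G assms(4) rel_interior_subset by blast
  moreover have "G \<subseteq> U" using G(1) face_of_imp_subset by blast
  ultimately have "G = U" using max_cellsD(2) assms(2) by metis
  then show "x \<in> rel_interior U" using G by simp
qed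

lemma max_cell_eq:
  assumes "polyhedral_complex C" "U \<in> max_cells C" "F \<in> C" "x \<in> rel_interior U" "x \<in> F"
  shows "F = U"
  using rel_interior_cell_subset[OF assms(1) _ assms(3-5)] max_cellsD[OF assms(2)] assms(3) by metis

lemma nonmax_cell_aff_dim:
  assumes "polyhedral_complex C" "N \<in> C - max_cells C"
  obtains T where "T \<in> max_cells C" "aff_dim N < aff_dim T"
proof -
  obtain T where T: "T \<in> max_cells C" "N \<subseteq> T"
    using ex_max_cell[OF polyhedral_complexD(1)[OF assms(1)]] assms(2) by blast
  then have "T \<in> C" by (simp add: max_cells_def)
  have "T \<inter> N face_of T" using assms \<open>T \<in> C\<close> polyhedral_complexD(6) by blast
  then have "N face_of T" "N \<noteq> T" using T assms by (auto simp: Int_absorb1)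
  then have "aff_dim N < aff_dim T"
    using face_of_aff_dim_lt \<open>T \<in> C\<close> assms polyhedral_complexD(7) by blast
  with T that show thesis by blast
qed

subsection \<open>Weights at a generic point\<close>

lemma cells_nonzero_part:
  assumes "polyhedral_complex (cells A)"
  shows "\<Union>(cells (nonzero_part A)) = support A"
    and "max_cells (cells (nonzero_part A)) = {S \<in> max_cells (cells A). weight A S \<noteq> 0}"
proof -
  show "\<Union>(cells (nonzero_part A)) = support A"
    by (auto simp: nonzero_part_def support_def max_cells_def)
  show "max_cells (cells (nonzero_part A)) = {S \<in> max_cells (cells A). weight A S \<noteq> 0}"
    by (auto simp: nonzero_part_def max_cells_def)
qed

lemma subdivision_ofD:
  assumes "subdivision_of B A"
  shows "polyhedral_complex (cells B)" and "\<Union>(cells B) = \<Union>(cells A)"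
    and "T \<in> cells B \<Longrightarrow> \<exists>S\<in>cells A. T \<subseteq> S"
    and "T \<in> max_cells (cells B) \<Longrightarrow> S \<in> max_cells (cells A) \<Longrightarrow> T \<subseteq> S \<Longrightarrow> weight B T = weight A S"
  using assms by (simp_all add: subdivision_of_def)

text \<open>\<open>T\<close> lies in some cell of the nonzero part. That cell meets the relative
  interior of the maximal cell \<open>U\<close>, hence equals \<open>U\<close>, and the subdivision
  transfers the weight. Only membership of \<open>x\<close> in \<open>T\<close> is asked, so one
  \<open>T\<close> can be compared with two complexes.\<close>

lemma subdivision_weight:
  assumes A: "polyhedral_complex (cells A)" and C: "subdivision_of C (nonzero_part A)"
    and U: "U \<in> max_cells (cells A)" "weight A U \<noteq> 0" "x \<in> rel_interior U"
    and T: "T \<in> max_cells (cells C)" "x \<in> T"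
  shows "weight C T = weight A U"
proof -
  have "T \<in> cells C" using T(1) by (simp add: max_cells_def)
  then obtain S where S: "S \<in> cells (nonzero_part A)" "T \<subseteq> S"
    using subdivision_ofD(3)[OF C] by metis
  then have "S \<in> cells A" by (simp add: nonzero_part_def)
  then have "S = U" using max_cell_eq[OF A U(1) _ U(3)] S(2) T(2) by (metis subsetD)
  then have "T \<subseteq> U" using S(2) by simp
  have "U \<in> max_cells (cells (nonzero_part A))" using cells_nonzero_part(2)[OF A] U by blast
  with C T \<open>T \<subseteq> U\<close> have "weight C T = weight (nonzero_part A) U"
    using subdivision_ofD(4) by metis
  then show ?thesis by (simp add: nonzero_part_def)
qed

text \<open>Both weights are read off from one maximal cell of the common subdivision through
  \<open>x\<close>. The subdivision covers exactly the two supports, which is how \<open>x\<close>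
  is known to lie in a cell of \<open>B\<close> of nonzero weight.\<close>

lemma wcomplex_eq_weight:
  assumes eq: "A \<approx>\<^sub>w B" and A: "polyhedral_complex (cells A)" and B: "polyhedral_complex (cells B)"
    and U: "U \<in> max_cells (cells A)" "x \<in> rel_interior U" "weight A U \<noteq> 0"
    and x: "\<And>N. N \<in> cells B - max_cells (cells B) \<Longrightarrow> x \<notin> N"
  obtains V where "V \<in> max_cells (cells B)" "x \<in> rel_interior V" "weight B V = weight A U"
proof -
  obtain C where C: "subdivision_of C (nonzero_part A)" "subdivision_of C (nonzero_part B)"
    using eq by (auto simp only: wcomplex_eq_def)
  have "x \<in> support A" using U rel_interior_subset by (auto simp: support_def)
  moreover have "\<Union>(cells C) = support A" "\<Union>(cells C) = support B"
    
    using subdivision_ofD(2)[OF C(1)] subdivision_ofD(2)[OF C(2)]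
      cells_nonzero_part(1)[OF A] cells_nonzero_part(1)[OF B] by simp_all
  ultimately have x': "x \<in> \<Union>(cells C)" "x \<in> support B" by auto
  then obtain V where V: "V \<in> max_cells (cells B)" "weight B V \<noteq> 0" "x \<in> V"
    by (auto simp: support_def)
  then have V': "x \<in> rel_interior V"
    using rel_interior_max_cell(2)[OF B _ V(3) x] by (simp add: max_cells_def)
  have "finite (cells C)" using polyhedral_complexD(1) subdivision_ofD(1) C(1) by metis
  then obtain T where T: "T \<in> max_cells (cells C)" "x \<in> T"
    using x'(1) ex_max_cell by (metis UnionE subset_iff)
  have "weight B V = weight A U"
    using subdivision_weight[OF A C(1) U(1,3,2) T] subdivision_weight[OF B C(2) V(1,2) V' T] by simp
  with V V' that show thesis by blast
qed

text \<open>The Minkowski weight as a function of points. It does not refer to a polyhedral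
  structure of the sum, so it can be computed independently of the chosen one.\<close>

definition mink_local :: "'n::finite wcomplex \<Rightarrow> 'n wcomplex \<Rightarrow> real^'n \<Rightarrow> int" where
  "mink_local A B x = (\<Sum>(S, T) | S \<in> max_cells (cells A) \<and> T \<in> max_cells (cells B) \<and> x \<in> S + T.
           minkowski_weight A B S T)"

lemma minkowski_sumD:
  assumes "minkowski_sum A B Z"
  shows "polyhedral_complex (cells Z)"
    and "\<Union>(cells Z) = {a + b | a b. a \<in> \<Union>(cells A) \<and> b \<in> \<Union>(cells B)}"
    and "S \<in> max_cells (cells A) \<Longrightarrow> T \<in> max_cells (cells B) \<Longrightarrow> \<exists>F\<subseteq>cells Z. S + T = \<Union>F"
    and "U \<in> max_cells (cells Z) \<Longrightarrow> weight Z U =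
        (\<Sum>(S, T) | S \<in> max_cells (cells A) \<and> T \<in> max_cells (cells B) \<and> U \<subseteq> S + T.
           minkowski_weight A B S T)"
  using assms by (simp_all only: minkowski_sum_def)

text \<open>\<open>S + T\<close> is a union of cells of \<open>Z\<close>, and any cell that meets
  the relative interior of \<open>U\<close> contains \<open>U\<close>; so containing
  \<open>x\<close> and containing \<open>U\<close> are the same condition.\<close>

lemma mink_local_weight:
  assumes Z: "minkowski_sum A B Z" and U: "U \<in> max_cells (cells Z)" "x \<in> rel_interior U"
  shows "mink_local A B x = weight Z U"
proof -
  have pc: "polyhedral_complex (cells Z)" by (rule minkowski_sumD(1)[OF Z])
  have iff: "x \<in> S + T \<longleftrightarrow> U \<subseteq> S + T" if ST: "S \<in> max_cells (cells A)" "T \<in> max_cells (cells B)" for S T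
  proof
    assume "x \<in> S + T"
    moreover obtain F where "F \<subseteq> cells Z" "S + T = \<Union>F"
      using minkowski_sumD(3)[OF Z ST] by blast
    ultimately show "U \<subseteq> S + T"
      using rel_interior_cell_subset[OF pc max_cellsD(1)[OF U(1)] _ U(2)]
      by (metis UnionE Union_upper subset_trans subsetD)
  qed (use U rel_interior_subset in blast)
  then have "{(S, T). S \<in> max_cells (cells A) \<and> T \<in> max_cells (cells B) \<and> x \<in> S + T} =
      {(S, T). S \<in> max_cells (cells A) \<and> T \<in> max_cells (cells B) \<and> U \<subseteq> S + T}"
    by (auto simp: iff)
  then show ?thesis using minkowski_sumD(4)[OF Z U(1)] by (simp only: mink_local_def)
qed

lemma mink_local_outside:
  assumes Z: "minkowski_sum A B Z" and x: "x \<notin> \<Union>(cells Z)"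
  shows "mink_local A B x = 0"
proof -
  have none: "{(S, T). S \<in> max_cells (cells A) \<and> T \<in> max_cells (cells B) \<and> x \<in> S + T} = {}"
    using minkowski_sumD(2)[OF Z] x by (auto simp: set_plus_def dest!: max_cellsD(1))
  show ?thesis unfolding mink_local_def none by simp
qed

text \<open>Equality of weighted complexes only speaks about cells of nonzero weight, so the
  comparison starts from whichever side is nonzero at \<open>x\<close>; if neither is, both
  vanish.\<close>

lemma mink_local_eq:
  assumes Z: "minkowski_sum A B Z" and Z': "minkowski_sum A' B Z'" and eq: "Z \<approx>\<^sub>w Z'"
    and x: "\<And>N. N \<in> cells Z - max_cells (cells Z) \<Longrightarrow> x \<notin> N"
    and x': "\<And>N. N \<in> cells Z' - max_cells (cells Z') \<Longrightarrow> x \<notin> N"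
  shows "mink_local A B x = mink_local A' B x"
proof -
  have pc: "polyhedral_complex (cells Z)" and pc': "polyhedral_complex (cells Z')"
    by (rule minkowski_sumD(1)[OF Z] minkowski_sumD(1)[OF Z'])+
  have eq': "Z' \<approx>\<^sub>w Z" using eq by (auto simp only: wcomplex_eq_def)
  have one: "mink_local A' B x = mink_local A B x"
    if Z: "minkowski_sum A B Z" and Z': "minkowski_sum A' B Z'" and eq: "Z \<approx>\<^sub>w Z'"
      and x: "\<And>N. N \<in> cells Z - max_cells (cells Z) \<Longrightarrow> x \<notin> N"
      and x': "\<And>N. N \<in> cells Z' - max_cells (cells Z') \<Longrightarrow> x \<notin> N"
      and nz: "mink_local A B x \<noteq> 0" for A A' Z Z'
  proof -
    have pc: "polyhedral_complex (cells Z)" and pc': "polyhedral_complex (cells Z')"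
      by (rule minkowski_sumD(1)[OF Z] minkowski_sumD(1)[OF Z'])+
    obtain U where U: "U \<in> cells Z" "x \<in> U" using mink_local_outside[OF Z] nz by blast
    then have U': "U \<in> max_cells (cells Z)" "x \<in> rel_interior U"
      using rel_interior_max_cell[OF pc U x] by auto
    have w: "weight Z U = mink_local A B x" using mink_local_weight[OF Z U'] by simp
    then obtain V where "V \<in> max_cells (cells Z')" "x \<in> rel_interior V" "weight Z' V = weight Z U"
      using wcomplex_eq_weight[OF eq pc pc' U' _ x'] nz by metis
    then show ?thesis using w mink_local_weight[OF Z'] by metis
  qed
  show ?thesis
    using one[OF Z Z' eq x x'] one[OF Z' Z eq' x' x] by metis
qed


subsection \<open>Linear spaces and lattices of cells\<close>

lemma subspace_lin_space: "subspace (lin_space S)"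
  by (simp add: lin_space_def)

lemma lin_space_eq:
  assumes "x \<in> S"
  shows "lin_space S = span ((\<lambda>y. y - x) ` S)"
proof
  have "u - v \<in> span ((\<lambda>y. y - x) ` S)" if "u \<in> S" "v \<in> S" for u v
  proof -
    have "u - v = (u - x) - (v - x)" by simp
    then show ?thesis using that by (metis span_diff span_base image_eqI)
  qed
  then show "lin_space S \<subseteq> span ((\<lambda>y. y - x) ` S)"
    unfolding lin_space_def by (intro span_minimal) auto
  show "span ((\<lambda>y. y - x) ` S) \<subseteq> lin_space S"
    unfolding lin_space_def using assms by (intro span_mono) auto
qed

lemma diff_in_lin_space: "x \<in> S \<Longrightarrow> y \<in> S \<Longrightarrow> x - y \<in> lin_space S"
  unfolding lin_space_def by (rule span_base) blast

lemma aff_dim_lin_space: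
  assumes "S \<noteq> {}"
  shows "aff_dim S = int (dim (lin_space S))"
proof -
  obtain x where "x \<in> S" using assms by blast
  then show ?thesis
    using aff_dim_eq_dim[OF hull_inc[of x S affine]] lin_space_eq[of x S]
    by (simp add: image_def)
qed

lemma lin_space_linear_image:
  assumes "linear f"
  shows "lin_space (f ` S) = f ` lin_space S"
proof -
  have "{x - y | x y. x \<in> f ` S \<and> y \<in> f ` S} = f ` {x - y | x y. x \<in> S \<and> y \<in> S}"
  proof (intro equalityI subsetI)
    fix z assume "z \<in> {x - y | x y. x \<in> f ` S \<and> y \<in> f ` S}"
    then obtain u v where "z = f u - f v" "u \<in> S" "v \<in> S" by blast
    then have "z = f (u - v)" "u - v \<in> {x - y | x y. x \<in> S \<and> y \<in> S}"
      by (auto simp: linear_diff[OF assms])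
    then show "z \<in> f ` {x - y | x y. x \<in> S \<and> y \<in> S}" by (rule image_eqI)
  next
    fix z assume "z \<in> f ` {x - y | x y. x \<in> S \<and> y \<in> S}"
    then obtain u v where "z = f u - f v" "u \<in> S" "v \<in> S" by (auto simp: linear_diff[OF assms])
    then show "z \<in> {x - y | x y. x \<in> f ` S \<and> y \<in> f ` S}" by blast
  qed
  then show ?thesis
    unfolding lin_space_def by (simp add: linear_span_image[OF assms])
qed

lemma lin_space_plus:
  assumes "S \<noteq> {}" "T \<noteq> {}"
  shows "lin_space (S + T) = lin_space S + lin_space T"
proof
  have "lin_space S + lin_space T = {x + y | x y. x \<in> lin_space S \<and> y \<in> lin_space T}"
    by (auto simp: set_plus_def)
  then have "subspace (lin_space S + lin_space T)"
    using subspace_sums[OF subspace_lin_space[of S] subspace_lin_space[of T]] by simp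
  moreover have "(a + b) - (c + d) \<in> lin_space S + lin_space T"
    if "a \<in> S" "b \<in> T" "c \<in> S" "d \<in> T" for a b c d
    using diff_in_lin_space[OF that(1,3)] diff_in_lin_space[OF that(2,4)]
    by (metis add_diff_add set_plus_intro)
  ultimately show "lin_space (S + T) \<subseteq> lin_space S + lin_space T"
    unfolding lin_space_def[of "S + T"] by (intro span_minimal) (auto simp: set_plus_def)
  obtain s t where st: "s \<in> S" "t \<in> T" using assms by blast
  have "lin_space S \<subseteq> lin_space (S + T)"
    unfolding lin_space_def
  proof (intro span_mono subsetI)
    fix z assume "z \<in> {x - y | x y. x \<in> S \<and> y \<in> S}"
    then obtain x y where "z = x - y" "x \<in> S" "y \<in> S" by blast
    then have "z = (x + t) - (y + t)" "x + t \<in> S + T" "y + t \<in> S + T" using st by auto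
    then show "z \<in> {x - y | x y. x \<in> S + T \<and> y \<in> S + T}" by blast
  qed
  moreover have "lin_space T \<subseteq> lin_space (S + T)"
    unfolding lin_space_def
  proof (intro span_mono subsetI)
    fix z assume "z \<in> {x - y | x y. x \<in> T \<and> y \<in> T}"
    then obtain x y where "z = x - y" "x \<in> T" "y \<in> T" by blast
    then have "z = (s + x) - (s + y)" "s + x \<in> S + T" "s + y \<in> S + T" using st by auto
    then show "z \<in> {x - y | x y. x \<in> S + T \<and> y \<in> S + T}" by blast
  qed
  ultimately show "lin_space S + lin_space T \<subseteq> lin_space (S + T)"
    using subspace_add[OF subspace_lin_space[of "S + T"]] by (auto simp: set_plus_def subset_iff)
qed

section \<open>Finite lattice indices and rational linear spaces\<close>

lemma finite_bounded_integral_vectors: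
  "finite {x::real^'n. (\<forall>i. x $ i \<in> \<int>) \<and> norm x \<le> M}"
proof (rule finite_subset)
  have "finite {k::real \<in> \<int>. \<bar>k\<bar> \<le> M}" by (rule finite_abs_int_segment)
  then have "finite (PiE UNIV (\<lambda>_::'n. {k::real \<in> \<int>. \<bar>k\<bar> \<le> M}))"
    by (intro finite_PiE) auto
  then show "finite (vec_lambda ` (PiE UNIV (\<lambda>_::'n. {k::real \<in> \<int>. \<bar>k\<bar> \<le> M})))" by simp
  show "{x::real^'n. (\<forall>i. x $ i \<in> \<int>) \<and> norm x \<le> M}
      \<subseteq> vec_lambda ` (PiE UNIV (\<lambda>_::'n. {k::real \<in> \<int>. \<bar>k\<bar> \<le> M}))"
  proof
    fix x :: "real^'n" assume x: "x \<in> {x. (\<forall>i. x $ i \<in> \<int>) \<and> norm x \<le> M}"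
    then have "vec_nth x \<in> PiE UNIV (\<lambda>_::'n. {k::real \<in> \<int>. \<bar>k\<bar> \<le> M})"
      using component_le_norm_cart[of x] by (auto intro: order_trans)
    then show "x \<in> vec_lambda ` (PiE UNIV (\<lambda>_::'n. {k::real \<in> \<int>. \<bar>k\<bar> \<le> M}))"
      by (rule image_eqI[rotated]) (simp add: vec_nth_inverse)
  qed
qed

text \<open>\<open>lattice_index\<close> is a cardinality and would be 0 for infinitely many cosets,
  so positivity needs finiteness: subtracting the integral parts of the coordinates with respect to
  \<open>B\<close> represents every coset by an integer vector of bounded norm.\<close>

lemma lattice_index_pos:
  fixes L H B :: "(real^'n) set"
  assumes B: "finite B" "B \<subseteq> H" "\<And>b i. b \<in> B \<Longrightarrow> b $ i \<in> \<int>" and L: "L \<subseteq> span B" "L \<noteq> {}"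
    and int: "\<And>x i. x \<in> L \<Longrightarrow> x $ i \<in> \<int>"
    and H: "0 \<in> H" "\<And>x y. x \<in> H \<Longrightarrow> y \<in> H \<Longrightarrow> x + y \<in> H" "\<And>x. x \<in> H \<Longrightarrow> - x \<in> H"
  shows "lattice_index L H > 0"
proof -
  have Hm: "of_int k *\<^sub>R x \<in> H" if "x \<in> H" for k x
  proof -
    have nat: "of_nat n *\<^sub>R x \<in> H" for n
    proof (induction n)
      case 0
      then show ?case using H(1) by simp
    next
      case (Suc n)
      then show ?case using H(2)[OF that Suc] by (simp add: scaleR_add_left)
    qed
    show ?thesis
    proof (cases "k \<ge> 0")
      case True
      then show ?thesis using nat[of "Int.nat k"] by simp
    next
      case False
      then have "of_int k *\<^sub>R x = - (of_nat (Int.nat (- k)) *\<^sub>R x)" by simp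
      then show ?thesis using nat H(3) by metis
    qed
  qed
  have Hs: "(\<Sum>b\<in>B'. f b) \<in> H" if "finite B'" "\<And>b. b \<in> B' \<Longrightarrow> f b \<in> H" for B' f
    using that by (induction B' rule: finite_induct) (use H in simp_all)
  define R where "R = {x::real^'n. (\<forall>i. x $ i \<in> \<int>) \<and> norm x \<le> (\<Sum>b\<in>B. norm b)}"
  have "(\<lambda>x. x +o H) ` L \<subseteq> (\<lambda>x. x +o H) ` R"
  proof
    fix K assume "K \<in> (\<lambda>x. x +o H) ` L"
    then obtain x where x: "x \<in> L" "K = x +o H" by blast
    then obtain c where c: "x = (\<Sum>b\<in>B. c b *\<^sub>R b)"
      using L(1) span_finite[OF B(1)] by (auto simp: subset_iff)
    define h where "h = (\<Sum>b\<in>B. of_int \<lfloor>c b\<rfloor> *\<^sub>R b)"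
    have h: "h \<in> H" unfolding h_def using B(1,2) Hm by (intro Hs) auto
    have xh: "x - h = (\<Sum>b\<in>B. frac (c b) *\<^sub>R b)"
      unfolding c h_def frac_def by (simp add: sum_subtractf scaleR_diff_left)
    have "norm (x - h) \<le> (\<Sum>b\<in>B. norm b)"
      unfolding xh
      by (rule sum_norm_le) (simp add: mult_left_le_one_le frac_ge_0 less_imp_le[OF frac_lt_1])
    moreover have "(x - h) $ i \<in> \<int>" for i
      unfolding h_def using int[OF x(1)] B(3) by (auto intro!: Ints_diff Ints_sum Ints_mult)
    ultimately have "x - h \<in> R" unfolding R_def by simp
    moreover have "K = (x - h) +o H"
    proof -
      have "x + y \<in> (x - h) +o H" if "y \<in> H" for y
        using H(2)[OF h that] by (auto simp: elt_set_plus_def intro!: bexI[of _ "h + y"])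
      moreover have "(x - h) + y \<in> x +o H" if "y \<in> H" for y
        using H(2)[OF H(3)[OF h] that] by (auto simp: elt_set_plus_def intro!: bexI[of _ "- h + y"])
      ultimately show ?thesis unfolding x(2) by (auto simp: elt_set_plus_def)
    qed
    ultimately show "K \<in> (\<lambda>x. x +o H) ` R" by blast
  qed
  moreover have "finite R" unfolding R_def by (rule finite_bounded_integral_vectors)
  ultimately have "finite ((\<lambda>x. x +o H) ` L)" using finite_subset by blast
  then show ?thesis unfolding lattice_index_def using L(2) by (simp add: card_gt_0_iff)
qed

text \<open>Gaussian elimination, one equation at a time: if some spanning vector \<open>b0\<close>
  violates the new equation, projecting along \<open>b0\<close> onto the kernel keeps the spanning
  vectors rational.\<close>

lemma rational_kernel_span:
  fixes A :: "(real^'n) set"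
  assumes "finite A" "\<And>a i. a \<in> A \<Longrightarrow> a $ i \<in> \<rat>"
  shows "\<exists>B. finite B \<and> (\<forall>b\<in>B. \<forall>i. b $ i \<in> \<rat>) \<and> {x. \<forall>a\<in>A. a \<bullet> x = 0} = span B"
  using assms
proof (induction A rule: finite_induct)
  case empty
  have "(b::real^'n) $ i \<in> \<rat>" if "b \<in> Basis" for b i
    using that by (auto simp: Basis_vec_def axis_def)
  then show ?case by (intro exI[of _ Basis]) simp
next
  case (insert a A)
  have "\<exists>B. finite B \<and> (\<forall>b\<in>B. \<forall>i. b $ i \<in> \<rat>) \<and> {x. \<forall>a\<in>A. a \<bullet> x = 0} = span B"
    by (rule insert.IH) (simp add: insert.prems)
  then obtain B where B: "finite B" "\<forall>b\<in>B. \<forall>i. b $ i \<in> \<rat>" "{x. \<forall>a\<in>A. a \<bullet> x = 0} = span B"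
    by (elim exE conjE)
  have eq: "{x. \<forall>a\<in>insert a A. a \<bullet> x = 0} = {x \<in> span B. a \<bullet> x = 0}" unfolding B(3)[symmetric] by auto
  show ?case
  proof (cases "\<forall>b\<in>B. a \<bullet> b = 0")
    case True
    then have "a \<bullet> x = 0" if "x \<in> span B" for x
      using that orthogonal_to_span[of x B a] by (simp add: orthogonal_def)
    then have "{x \<in> span B. a \<bullet> x = 0} = span B" by auto
    then show ?thesis using eq B by (intro exI[of _ B]) auto
  next
    case False
    then obtain b0 where b0: "b0 \<in> B" "a \<bullet> b0 \<noteq> 0" by blast
    have rat: "a \<bullet> b \<in> \<rat>" if "b \<in> B" for b
      unfolding inner_vec_def using that insert.prems B(2)
      by (auto simp: inner_real_def intro!: Rats_sum Rats_mult)
    define r where "r x = x - ((a \<bullet> x) / (a \<bullet> b0)) *\<^sub>R b0" for x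
    have "linear r" unfolding r_def
      by (rule linearI) (auto simp: inner_add_right add_divide_distrib algebra_simps)
    have "{x \<in> span B. a \<bullet> x = 0} = r ` span B"
    proof
      show "{x \<in> span B. a \<bullet> x = 0} \<subseteq> r ` span B"
      proof
        fix x assume "x \<in> {x \<in> span B. a \<bullet> x = 0}"
        then have "x = r x" "x \<in> span B" by (auto simp: r_def)
        then show "x \<in> r ` span B" by (rule image_eqI)
      qed
      have "a \<bullet> r x = 0" for x using b0 by (simp add: r_def inner_diff_right)
      then show "r ` span B \<subseteq> {x \<in> span B. a \<bullet> x = 0}"
        using b0 by (auto simp: r_def intro!: span_diff span_scale intro: span_base)
    qed
    also have "\<dots> = span (r ` B)" using linear_span_image[OF \<open>linear r\<close>] by simp
    finally have "{x \<in> span B. a \<bullet> x = 0} = span (r ` B)" .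
    moreover have "r b $ i \<in> \<rat>" if "b \<in> B" for b i
      unfolding r_def using that rat b0 B(2) by (auto intro!: Rats_diff Rats_mult Rats_divide)
    ultimately show ?thesis using eq B(1) by (intro exI[of _ "r ` B"]) auto
  qed
qed

lemma rational_vector_denominator:
  fixes b :: "real^'n"
  assumes "\<And>i. b $ i \<in> \<rat>"
  shows "\<exists>d::real. d \<noteq> 0 \<and> (\<forall>i. (d *\<^sub>R b) $ i \<in> \<int>)"
proof -
  have "\<exists>q::int. q \<noteq> 0 \<and> of_int q * b $ i \<in> \<int>" for i
  proof -
    obtain p q :: int where "q > 0" "b $ i = of_int p / of_int q"
      by (rule Rats_cases'[OF assms[of i]])
    then have "q \<noteq> 0" by simp
    with \<open>b $ i = _\<close> have "of_int q * b $ i = of_int p" by simp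
    with \<open>q \<noteq> 0\<close> show ?thesis by (intro exI[of _ q]) simp
  qed
  then obtain q :: "'n \<Rightarrow> int" where q: "\<And>i. q i \<noteq> 0" "\<And>i. of_int (q i) * b $ i \<in> \<int>" by metis
  have "of_int (\<Prod>j\<in>UNIV. q j) * b $ i \<in> \<int>" for i
  proof -
    have "of_int (\<Prod>j\<in>UNIV. q j) * b $ i = of_int (\<Prod>j\<in>UNIV - {i}. q j) * (of_int (q i) * b $ i)"
      by (subst prod.remove[of UNIV i]) (auto simp: mult_ac)
    then show ?thesis using q(2)[of i] by (simp only: Ints_mult Ints_of_int)
  qed
  then show ?thesis using q(1) by (intro exI[of _ "of_int (\<Prod>j\<in>UNIV. q j)"]) auto
qed

text \<open>The linear space is the common kernel of the inequalities that are equalities on all of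
  \<open>S\<close>; the remaining ones are strict at a relative interior point and leave room for a
  small step in every direction of the kernel. Clearing denominators makes a rational spanning set
  integral.\<close>

lemma rational_polyhedron_lin_space:
  fixes S :: "(real^'n) set"
  assumes "rational_polyhedron G S" "S \<noteq> {}"
  shows "\<exists>B. finite B \<and> (\<forall>b\<in>B. \<forall>i. b $ i \<in> \<int>) \<and> lin_space S = span B"
proof -
  obtain H where H: "finite H" "\<And>a b i. (a, b) \<in> H \<Longrightarrow> a $ i \<in> \<rat>"
    and S: "S = {x. \<forall>(a, b)\<in>H. a \<bullet> x \<le> b}"
  proof -
    obtain H where H: "finite H" "\<forall>(a, b)\<in>H. (\<forall>i. a $ i \<in> \<rat>) \<and> b \<in> G"
      "S = {x. \<forall>(a, b)\<in>H. a \<bullet> x \<le> b}"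
      using assms(1)[unfolded rational_polyhedron_def] by (elim exE conjE)
    then show thesis using that[of H] by auto
  qed
  have SD: "x \<in> S \<longleftrightarrow> (\<forall>h\<in>H. fst h \<bullet> x \<le> snd h)" for x
    unfolding S by (simp add: case_prod_beta)
  have "S = (\<Inter>h\<in>H. {x. fst h \<bullet> x \<le> snd h})" using SD by auto
  then have "convex S" by (simp add: convex_INT convex_halfspace_le)
  define A where "A = fst ` {h \<in> H. \<forall>x\<in>S. fst h \<bullet> x = snd h}"
  obtain x0 where x0: "x0 \<in> rel_interior S"
    using \<open>convex S\<close> assms(2) rel_interior_eq_empty by blast
  have x0S: "x0 \<in> S" using x0 rel_interior_subset by blast
  \<comment> \<open>If \<open>h\<close> were tight at \<open>x0\<close>, prolonging the segment from
    a point with slack through \<open>x0\<close> would violate \<open>h\<close> inside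
    \<open>S\<close>.\<close>
  have strict: "fst h \<bullet> x0 < snd h" if h: "h \<in> H" "fst h \<notin> A" for h
  proof (rule ccontr)
    assume "\<not> fst h \<bullet> x0 < snd h"
    moreover have "fst h \<bullet> x0 \<le> snd h" using x0S h(1) SD by simp
    ultimately have e: "fst h \<bullet> x0 = snd h" by simp
    obtain x1 where x1: "x1 \<in> S" "fst h \<bullet> x1 \<noteq> snd h" using h unfolding A_def by blast
    moreover have "fst h \<bullet> x1 \<le> snd h" using x1(1) h(1) SD by simp
    ultimately have x1': "fst h \<bullet> x1 < snd h" by simp
    obtain t where t: "t > 1" "(1 - t) *\<^sub>R x1 + t *\<^sub>R x0 \<in> S"
      using convex_rel_interior_iff[OF \<open>convex S\<close> assms(2), of x0] x0 x1(1) by auto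
    have "fst h \<bullet> ((1 - t) *\<^sub>R x1 + t *\<^sub>R x0) \<le> snd h" using t(2) h(1) SD by simp
    then have "(1 - t) * (fst h \<bullet> x1) + t * snd h \<le> snd h" by (simp add: inner_add_right e)
    then have "(1 - t) * (fst h \<bullet> x1) \<le> (1 - t) * snd h" by (simp add: algebra_simps)
    then show False using t(1) x1' by (simp add: mult_le_cancel_left)
  qed
  have "lin_space S = {x. \<forall>a\<in>A. a \<bullet> x = 0}"
  proof
    show "lin_space S \<subseteq> {x. \<forall>a\<in>A. a \<bullet> x = 0}"
      unfolding lin_space_def
    proof (rule span_minimal)
      show "subspace {x. \<forall>a\<in>A. a \<bullet> x = 0}"
        by (auto simp: subspace_def inner_add_right)
    qed (auto simp: A_def inner_diff_right)
    show "{x. \<forall>a\<in>A. a \<bullet> x = 0} \<subseteq> lin_space S"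
    proof
      fix d assume d: "d \<in> {x. \<forall>a\<in>A. a \<bullet> x = 0}"
      have "\<exists>e>0. \<forall>t. 0 \<le> t \<and> t \<le> e \<longrightarrow> fst h \<bullet> (x0 + t *\<^sub>R d) \<le> snd h" if "h \<in> H" for h
      proof (cases "fst h \<in> A")
        case True
        then have "fst h \<bullet> (x0 + t *\<^sub>R d) \<le> snd h" for t
          using d x0S that SD by (simp add: inner_add_right)
        then show ?thesis by (intro exI[of _ 1]) auto
      next
        case False
        \<comment> \<open>\<open>m\<close> is the slack at \<open>x0\<close>; dividing it by 1 plus
          the absolute speed avoids a distinction by the sign of the speed.\<close>
        define m where "m = snd h - fst h \<bullet> x0"
        have m: "m > 0" using strict[OF that False] by (simp add: m_def)
        have "fst h \<bullet> (x0 + t *\<^sub>R d) \<le> snd h" if "0 \<le> t" "t \<le> m / (1 + \<bar>fst h \<bullet> d\<bar>)" for t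
        proof -
          have "t * (fst h \<bullet> d) \<le> t * (1 + \<bar>fst h \<bullet> d\<bar>)"
            using that by (intro mult_left_mono) auto
          also have "\<dots> \<le> m" using that by (simp add: le_divide_eq)
          finally show ?thesis by (simp add: inner_add_right m_def)
        qed
        moreover have "m / (1 + \<bar>fst h \<bullet> d\<bar>) > 0" using m by (intro divide_pos_pos) auto
        ultimately show ?thesis by blast
      qed
      then obtain e where e: "\<And>h. h \<in> H \<Longrightarrow> e h > 0"
        "\<And>h t. h \<in> H \<Longrightarrow> 0 \<le> t \<Longrightarrow> t \<le> e h \<Longrightarrow> fst h \<bullet> (x0 + t *\<^sub>R d) \<le> snd h"
        by metis
      define t where "t = Min (insert 1 (e ` H))"
      have t: "t > 0" "\<And>h. h \<in> H \<Longrightarrow> t \<le> e h" unfolding t_def using H(1) e(1) by auto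
      then have "x0 + t *\<^sub>R d \<in> S" using e(2)[of _ t] by (simp add: SD)
      then have "t *\<^sub>R d \<in> lin_space S" using diff_in_lin_space[OF _ x0S] by fastforce
      then have "(1 / t) *\<^sub>R (t *\<^sub>R d) \<in> lin_space S" by (rule subspace_mul[OF subspace_lin_space])
      then show "d \<in> lin_space S" using t(1) by simp
    qed
  qed
  moreover have "\<exists>B. finite B \<and> (\<forall>b\<in>B. \<forall>i. b $ i \<in> \<rat>) \<and> {x. \<forall>a\<in>A. a \<bullet> x = 0} = span B"
    by (rule rational_kernel_span) (use H in \<open>auto simp: A_def\<close>)
  ultimately obtain B where B: "finite B" "\<forall>b\<in>B. \<forall>i. b $ i \<in> \<rat>" "lin_space S = span B"
    by auto
  have "\<forall>b\<in>B. \<exists>d::real. d \<noteq> 0 \<and> (\<forall>i. (d *\<^sub>R b) $ i \<in> \<int>)"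
    using rational_vector_denominator B(2) by blast
  then obtain d where d: "\<forall>b\<in>B. d b \<noteq> 0 \<and> (\<forall>i. (d b *\<^sub>R b) $ i \<in> \<int>)"
    by (rule bchoice[THEN exE])
  then have "lin_space S = span ((\<lambda>b. d b *\<^sub>R b) ` B)" using span_image_scale[OF B(1), of d] B(3) by simp
  then show ?thesis using B(1) d by (intro exI[of _ "(\<lambda>b. d b *\<^sub>R b) ` B"]) auto
qed


subsection \<open>Common refinements\<close>

text \<open>A face is determined by one point of its relative interior. The faces of
  \<open>S\<close> and \<open>T\<close> having that point in their relative interiors intersect in a
  face of the intersection with the same property, which must be \<open>F\<close>.\<close>

lemma face_of_Int_split:
  fixes S T :: "'a::euclidean_space set"
  assumes "polyhedron S" "polyhedron T" "F face_of (S \<inter> T)" "F \<noteq> {}"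
  obtains G H where "G face_of S" "H face_of T" "F = G \<inter> H"
proof -
  have "convex F" using assms(3) face_of_imp_convex by blast
  then obtain x where x: "x \<in> rel_interior F" using assms(4) rel_interior_eq_empty by blast
  then have "x \<in> S" "x \<in> T" using assms(3) rel_interior_subset face_of_imp_subset by blast+
  obtain G where G: "G face_of S" "x \<in> rel_interior G"
    using ex_face_rel_interior[OF assms(1) \<open>x \<in> S\<close>] by blast
  obtain H where H: "H face_of T" "x \<in> rel_interior H"
    using ex_face_rel_interior[OF assms(2) \<open>x \<in> T\<close>] by blast
  have conv: "convex G" "convex H" using G H face_of_imp_convex by blast+
  have "rel_interior (G \<inter> H) = rel_interior G \<inter> rel_interior H"
    using convex_rel_interior_inter_two[OF conv] G(2) H(2) by blast
  then have xGH: "x \<in> rel_interior (G \<inter> H)" using G(2) H(2) by simp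
  have "G \<inter> H face_of S \<inter> T" using G(1) H(1) by (rule face_of_Int_Int)
  then have "F = G \<inter> H" using face_of_eq[OF assms(3)] x xGH by blast
  with G(1) H(1) that show thesis by blast
qed

lemma polyhedral_complex_common_refinement:
  assumes C: "polyhedral_complex C" and D: "polyhedral_complex D"
  shows "polyhedral_complex {S \<inter> T | S T. S \<in> C \<and> T \<in> D \<and> S \<inter> T \<noteq> {}}" (is "polyhedral_complex ?R")
  unfolding polyhedral_complex_def
proof (intro conjI ballI allI impI)
  have "?R \<subseteq> (\<lambda>(S, T). S \<inter> T) ` (C \<times> D)" by auto
  then show "finite ?R"
    by (rule finite_subset) (simp add: polyhedral_complexD(1)[OF C] polyhedral_complexD(1)[OF D])
next
  fix U assume "U \<in> ?R"
  then obtain S T where U: "U = S \<inter> T" "S \<in> C" "T \<in> D" "S \<inter> T \<noteq> {}" by blast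
  show "polyhedron U" unfolding U(1)
    using polyhedral_complexD(2)[OF C U(2)] polyhedral_complexD(2)[OF D U(3)] by (rule polyhedron_Int)
  show "U \<noteq> {}" using U by simp
  show "x + (\<chi> i. c) \<in> U" if "x \<in> U" for x c
    using that polyhedral_complexD(4)[OF C U(2)] polyhedral_complexD(4)[OF D U(3)] unfolding U(1) by simp
next
  fix U F assume "U \<in> ?R" and F: "F face_of U \<and> F \<noteq> {}"
  then obtain S T where U: "U = S \<inter> T" "S \<in> C" "T \<in> D" by blast
  obtain G H where GH: "G face_of S" "H face_of T" "F = G \<inter> H"
    using face_of_Int_split[of S T F] polyhedral_complexD(2)[OF C U(2)] polyhedral_complexD(2)[OF D U(3)] F
    unfolding U(1) by metis
  then have "G \<noteq> {}" "H \<noteq> {}" using F by auto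
  then have "G \<in> C" "H \<in> D"
    using polyhedral_complexD(5)[OF C U(2) GH(1)] polyhedral_complexD(5)[OF D U(3) GH(2)] by auto
  then show "F \<in> ?R" using GH(3) F by blast
next
  have one: "U \<inter> V face_of U" if UV: "U \<in> ?R" "V \<in> ?R" for U V
  proof -
    obtain S T where U: "U = S \<inter> T" "S \<in> C" "T \<in> D" using UV(1) by blast
    obtain S' T' where V: "V = S' \<inter> T'" "S' \<in> C" "T' \<in> D" using UV(2) by blast
    have "(S \<inter> S') \<inter> (T \<inter> T') face_of S \<inter> T"
      using polyhedral_complexD(6)[OF C U(2) V(2)] polyhedral_complexD(6)[OF D U(3) V(3)]
      by (rule face_of_Int_Int)
    moreover have "(S \<inter> S') \<inter> (T \<inter> T') = U \<inter> V" using U V by blast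
    ultimately show ?thesis using U by simp
  qed
  fix U V assume UV: "U \<in> ?R" "V \<in> ?R"
  show "U \<inter> V face_of U" using one[OF UV] .
  show "U \<inter> V face_of V" using one[OF UV(2,1)] by (simp add: Int_commute)
qed

section \<open>Recovering a weighted complex from its weights at generic points\<close>

lemma polyhedral_complex_nonzero_part:
  assumes "polyhedral_complex (cells A)"
  shows "polyhedral_complex (cells (nonzero_part A))"
proof -
  have sub: "S \<in> cells A" if "S \<in> cells (nonzero_part A)" for S
    using that by (simp add: nonzero_part_def)
  have face: "F \<in> cells (nonzero_part A)" if "S \<in> cells (nonzero_part A)" "F face_of S" "F \<noteq> {}" for S F
    using that polyhedral_complexD(5)[OF assms sub[OF that(1)] that(2,3)] face_of_imp_subset[OF that(2)]
    by (simp add: nonzero_part_def) (meson subset_trans)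
  show ?thesis
    unfolding polyhedral_complex_def
  proof (intro conjI ballI allI impI)
    show "finite (cells (nonzero_part A))"
      using polyhedral_complexD(1)[OF assms] by (simp add: nonzero_part_def)
  next
    fix S T assume ST: "S \<in> cells (nonzero_part A)" "T \<in> cells (nonzero_part A)"
    show "S \<inter> T face_of S" using polyhedral_complexD(6)[OF assms sub[OF ST(1)] sub[OF ST(2)]] .
    show "S \<inter> T face_of T"
      using polyhedral_complexD(6)[OF assms sub[OF ST(2)] sub[OF ST(1)]] by (simp add: Int_commute)
  next
    fix S F assume "S \<in> cells (nonzero_part A)" "F face_of S \<and> F \<noteq> {}"
    then show "F \<in> cells (nonzero_part A)" using face by simp
  next
    fix S assume S: "S \<in> cells (nonzero_part A)"
    show "polyhedron S" using polyhedral_complexD(2)[OF assms sub[OF S]] .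
    show "S \<noteq> {}" using polyhedral_complexD(3)[OF assms sub[OF S]] .
    show "x + (\<chi> i. c) \<in> S" if "x \<in> S" for x c
      using polyhedral_complexD(4)[OF assms sub[OF S] that] .
  qed
qed

text \<open>The weight as a function of points, which makes differently subdivided complexes
  comparable. On non-maximal cells it is a sum over the adjacent cells; it is identified with the
  weight of a cell only in relative interiors of maximal cells.\<close>

definition weight_at :: "'n::finite wcomplex \<Rightarrow> real^'n \<Rightarrow> int" where
  "weight_at A x = (\<Sum>S | S \<in> max_cells (cells A) \<and> weight A S \<noteq> 0 \<and> x \<in> S. weight A S)"

lemma weight_at_max_cell:
  assumes A: "polyhedral_complex (cells A)" and S: "S \<in> max_cells (cells A)" "weight A S \<noteq> 0"
    and x: "x \<in> rel_interior S"
  shows "weight_at A x = weight A S"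
proof -
  have "x \<in> S" using x rel_interior_subset by blast
  then have "{T. T \<in> max_cells (cells A) \<and> weight A T \<noteq> 0 \<and> x \<in> T} = {S}"
    using S max_cell_eq[OF A S(1) _ x] max_cellsD(1) by auto
  then show ?thesis by (simp add: weight_at_def)
qed

lemma weight_at_outside: "x \<notin> support A \<Longrightarrow> weight_at A x = 0"
  unfolding weight_at_def support_def by (rule sum.neutral) auto

lemma closed_support:
  assumes "polyhedral_complex (cells A)"
  shows "closed (support A)"
proof -
  have "finite {S \<in> max_cells (cells A). weight A S \<noteq> 0}"
    using polyhedral_complexD(1)[OF assms] by (simp add: max_cells_def)
  then show ?thesis unfolding support_def
    by (rule closed_Union) (use polyhedral_complexD(8)[OF assms] max_cellsD(1) in blast)
qed

text \<open>The part of \<open>S\<close> near \<open>x\<close> is relatively open, so it has the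
  dimension of \<open>S\<close> and lies in no affine hull of a set of smaller dimension.\<close>

lemma convex_Int_ball_avoid:
  fixes S :: "'a::euclidean_space set"
  assumes "convex S" "x \<in> S" "e > 0" "finite \<E>" "\<And>E. E \<in> \<E> \<Longrightarrow> aff_dim E < aff_dim S"
  obtains a where "a \<in> S" "dist x a < e" "a \<notin> \<Union>\<E>"
proof -
  have ne: "S \<inter> ball x e \<noteq> {}" using assms(2,3) by auto
  have "\<exists>a\<in>S \<inter> ball x e. \<forall>L\<in>(hull) affine ` \<E>. a \<notin> L"
  proof (rule convex_avoid_affine)
    show "convex (S \<inter> ball x e)" using assms(1) by (intro convex_Int convex_ball)
    show "\<not> S \<inter> ball x e \<subseteq> L" if L: "L \<in> (hull) affine ` \<E>" for L
    proof
      assume "S \<inter> ball x e \<subseteq> L"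
      moreover obtain E where "E \<in> \<E>" "L = affine hull E" using L by blast
      ultimately have "aff_dim (S \<inter> ball x e) \<le> aff_dim E" 
        using aff_dim_subset[of "S \<inter> ball x e" "affine hull E"] by simp
      then show False
        using aff_dim_convex_Int_open[OF assms(1) open_ball ne] assms(5)[OF \<open>E \<in> \<E>\<close>] by simp
    qed
  qed (use assms ne in auto)
  then obtain a where "a \<in> S \<inter> ball x e" "\<forall>L\<in>(hull) affine ` \<E>. a \<notin> L" by blast
  then show thesis using that[of a] hull_subset[of _ affine] by (auto simp: subset_iff)
qed

text \<open>A point of the support of \<open>A\<close> outside the closed support of
  \<open>B\<close> would have generic neighbours in its cell at which \<open>A\<close> has nonzero
  weight and \<open>B\<close> weight 0.\<close>

lemma support_subset_generic:
  assumes A: "polyhedral_complex (cells A)" and B: "polyhedral_complex (cells B)" and fin: "finite \<F>"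
    and nonmax: "cells A - max_cells (cells A) \<subseteq> \<F>"
    and dim: "\<And>E S. E \<in> \<F> \<Longrightarrow> S \<in> max_cells (cells A) \<Longrightarrow> aff_dim E < aff_dim S"
    and gen: "\<And>a. a \<notin> \<Union>\<F> \<Longrightarrow> weight_at A a = weight_at B a"
  shows "support A \<subseteq> support B"
proof
  fix x assume "x \<in> support A"
  then obtain S where S: "S \<in> max_cells (cells A)" "weight A S \<noteq> 0" "x \<in> S"
    by (auto simp: support_def)
  note Sc = max_cellsD(1)[OF S(1)]
  show "x \<in> support B"
  proof (rule ccontr)
    assume "x \<notin> support B"
    then obtain e where e: "e > 0" "ball x e \<subseteq> - support B"
      using closed_support[OF B] open_contains_ball[of "- support B"] by (auto simp: open_Compl)
    obtain a where a: "a \<in> S" "dist x a < e" "a \<notin> \<Union>\<F>"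
      using convex_Int_ball_avoid[OF polyhedral_complexD(7)[OF A Sc] S(3) e(1) fin] dim[OF _ S(1)] by metis
    have "a \<in> rel_interior S"
      by (rule rel_interior_max_cell(2)[OF A Sc a(1)]) (use a(3) nonmax in blast)
    then have "weight_at A a = weight A S" by (rule weight_at_max_cell[OF A S(1,2)])
    moreover have "weight_at B a = 0" using e(2) a(2) by (intro weight_at_outside) auto
    ultimately show False using gen[OF a(3)] S(2) by simp
  qed
qed

lemma pure_dim_aff_dim:
  assumes "pure_dim d C" "S \<in> max_cells C"
  shows "aff_dim S = d + 1"
proof -
  have "tdim S = d" using assms by (simp only: pure_dim_def)
  then show ?thesis by (simp add: tdim_def)
qed

text \<open>Converse of the pointwise comparison. The supports agree because they are closed; the
  intersections of cells of the two nonzero parts then subdivide both, and such a cell gets as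
  weight the common value at one of its generic points.\<close>

lemma wcomplex_eq_generic:
  fixes A B :: "'n::finite wcomplex"
  assumes A: "polyhedral_complex (cells A)" "pure_dim d (cells A)"
    and B: "polyhedral_complex (cells B)" "pure_dim d (cells B)"
    and \<E>: "finite \<E>" "\<And>E. E \<in> \<E> \<Longrightarrow> tdim E < d"
    and eq: "\<And>a. a \<notin> \<Union>\<E> \<Longrightarrow> a \<notin> \<Union>(cells A - max_cells (cells A)) \<Longrightarrow>
        a \<notin> \<Union>(cells B - max_cells (cells B)) \<Longrightarrow> weight_at A a = weight_at B a"
  shows "A \<approx>\<^sub>w B"
proof -
  define \<F> where "\<F> = \<E> \<union> (cells A - max_cells (cells A)) \<union> (cells B - max_cells (cells B))"
  have fin: "finite \<F>"
    using \<E>(1) polyhedral_complexD(1)[OF A(1)] polyhedral_complexD(1)[OF B(1)] by (simp add: \<F>_def)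
  have dimA: "aff_dim S = d + 1" if "S \<in> max_cells (cells A)" for S
    using pure_dim_aff_dim[OF A(2) that] .
  have dimB: "aff_dim S = d + 1" if "S \<in> max_cells (cells B)" for S
    using pure_dim_aff_dim[OF B(2) that] .
  have dim: "aff_dim E < d + 1" if E: "E \<in> \<F>" for E
  proof -
    consider "E \<in> \<E>" | "E \<in> cells A - max_cells (cells A)" | "E \<in> cells B - max_cells (cells B)"
      using E by (auto simp: \<F>_def)
    then show ?thesis
    proof cases
      case 1
      then show ?thesis using \<E>(2)[of E] by (simp add: tdim_def)
    next
      case 2
      then show ?thesis using nonmax_cell_aff_dim[OF A(1) 2] dimA by metis
    next
      case 3
      then show ?thesis using nonmax_cell_aff_dim[OF B(1) 3] dimB by metis
    qed
  qed
  have gen: "weight_at A a = weight_at B a" if "a \<notin> \<Union>\<F>" for a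
    using eq[of a] that by (simp add: \<F>_def)
  have riA: "S \<in> max_cells (cells A) \<and> a \<in> rel_interior S"
    if "a \<in> S" "S \<in> cells A" "a \<notin> \<Union>\<F>" for a S
    using rel_interior_max_cell[OF A(1) that(2,1)] that(3) by (auto simp: \<F>_def)
  have riB: "S \<in> max_cells (cells B) \<and> a \<in> rel_interior S"
    if "a \<in> S" "S \<in> cells B" "a \<notin> \<Union>\<F>" for a S
    using rel_interior_max_cell[OF B(1) that(2,1)] that(3) by (auto simp: \<F>_def)
  have "support A \<subseteq> support B"
    by (rule support_subset_generic[OF A(1) B(1) fin _ _ gen]) (use dim dimA in \<open>auto simp: \<F>_def\<close>)
  moreover have "support B \<subseteq> support A"
    by (rule support_subset_generic[OF B(1) A(1) fin _ _ gen[symmetric]]) (use dim dimB in \<open>auto simp: \<F>_def\<close>)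
  ultimately have supp: "support A = support B" by blast
  define A' B' where "A' = cells (nonzero_part A)" and "B' = cells (nonzero_part B)"
  have A': "polyhedral_complex A'" "\<Union>A' = support A"
    and maxA': "max_cells A' = {S \<in> max_cells (cells A). weight A S \<noteq> 0}"
    unfolding A'_def using polyhedral_complex_nonzero_part[OF A(1)] cells_nonzero_part[OF A(1)] by auto
  have B': "polyhedral_complex B'" "\<Union>B' = support B"
    and maxB': "max_cells B' = {S \<in> max_cells (cells B). weight B S \<noteq> 0}"
    unfolding B'_def using polyhedral_complex_nonzero_part[OF B(1)] cells_nonzero_part[OF B(1)] by auto
  define R where "R = {S \<inter> T | S T. S \<in> A' \<and> T \<in> B' \<and> S \<inter> T \<noteq> {}}"
  have R: "polyhedral_complex R"
    unfolding R_def using A'(1) B'(1) by (rule polyhedral_complex_common_refinement)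
  have UR: "\<Union>R = support A"
  proof -
    have "\<Union>R = \<Union>A' \<inter> \<Union>B'" unfolding R_def by blast
    then show ?thesis using A'(2) B'(2) supp by simp
  qed
  \<comment> \<open>Two full-dimensional cells may have a small intersection, but a maximal one is
    not small: near a relative interior point the whole support, and with it a cell of
    \<open>A\<close>, is contained in \<open>T\<close>.\<close>
  have dimR: "aff_dim T = d + 1" if T: "T \<in> max_cells R" for T
  proof -
    have TR: "T \<in> R" using T by (rule max_cellsD)
    obtain x where x: "x \<in> rel_interior T"
      using polyhedral_complexD(3)[OF R TR] polyhedral_complexD(7)[OF R TR] rel_interior_eq_empty by blast
    then have "x \<in> support A" using UR TR rel_interior_subset by blast
    then obtain S where S: "S \<in> max_cells (cells A)" "weight A S \<noteq> 0" "x \<in> S"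
      by (auto simp: support_def)
    have "S \<subseteq> support A" using S by (auto simp: support_def)
    define V where "V = {U \<in> R. x \<notin> U}"
    have "closed (\<Union>V)" using polyhedral_complexD(1,8)[OF R] by (intro closed_Union) (auto simp: V_def)
    moreover have "x \<in> - \<Union>V" by (auto simp: V_def)
    ultimately obtain e where e: "e > 0" "ball x e \<subseteq> - \<Union>V"
      using openE open_Compl by metis
    have "S \<inter> ball x e \<subseteq> T"
    proof
      fix z assume z: "z \<in> S \<inter> ball x e"
      then obtain U where U: "U \<in> R" "z \<in> U" using \<open>S \<subseteq> support A\<close> UR by blast
      then have "x \<in> U" using e(2) z by (auto simp: V_def)
      then have "U = T" using max_cell_eq[OF R T U(1) x] by simp
      then show "z \<in> T" using U by simp
    qed
    then have "aff_dim (S \<inter> ball x e) \<le> aff_dim T" by (rule aff_dim_subset)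
    moreover have "S \<inter> ball x e \<noteq> {}" using S(3) e(1) by auto
    then have "aff_dim (S \<inter> ball x e) = d + 1"
      using aff_dim_convex_Int_open[OF polyhedral_complexD(7)[OF A(1) max_cellsD(1)[OF S(1)]] open_ball]
        dimA[OF S(1)] by simp
    moreover obtain S0 where "S0 \<in> A'" "T \<subseteq> S0" using TR by (auto simp: R_def)
    moreover obtain S1 where "S1 \<in> max_cells A'" "S0 \<subseteq> S1"
      using ex_max_cell[OF polyhedral_complexD(1)[OF A'(1)] \<open>S0 \<in> A'\<close>] by blast
    then have "aff_dim S1 = d + 1" using dimA maxA' by simp
    then have "aff_dim T \<le> d + 1" using aff_dim_subset[of T S1] \<open>T \<subseteq> S0\<close> \<open>S0 \<subseteq> S1\<close> by auto
    ultimately show ?thesis by simp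
  qed
  have wR: "weight_at A a = weight A S \<and> weight_at B a = weight B S'"
    if "T \<subseteq> S" "T \<subseteq> S'" "S \<in> max_cells A'" "S' \<in> max_cells B'" "a \<in> T" "a \<notin> \<Union>\<F>" for T S S' a
  proof -
    have S: "S \<in> max_cells (cells A)" "weight A S \<noteq> 0" and S': "S' \<in> max_cells (cells B)" "weight B S' \<noteq> 0"
      using that(3,4) maxA' maxB' by auto
    have "a \<in> rel_interior S" using riA[of a S] that(1,5,6) max_cellsD(1)[OF S(1)] by blast
    moreover have "a \<in> rel_interior S'" using riB[of a S'] that(2,5,6) max_cellsD(1)[OF S'(1)] by blast
    ultimately show ?thesis using weight_at_max_cell[OF A(1) S] weight_at_max_cell[OF B(1) S'] by blast
  qed
  have ex: "\<exists>a\<in>T. a \<notin> \<Union>\<F>" if T: "T \<in> max_cells R" for T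
  proof -
    have TR: "T \<in> R" using T by (rule max_cellsD)
    obtain x where "x \<in> T" using polyhedral_complexD(3)[OF R TR] by blast
    obtain a where "a \<in> T" "a \<notin> \<Union>\<F>"
      by (rule convex_Int_ball_avoid[OF polyhedral_complexD(7)[OF R TR] \<open>x \<in> T\<close> zero_less_one fin])
        (use dim dimR[OF T] in simp_all)
    then show ?thesis by blast
  qed
  \<comment> \<open>The choice of the generic point is immaterial: by \<open>wR\<close> each of them
    yields the weights of the cells above \<open>T\<close>.\<close>
  define W where "W T = weight_at A (SOME a. a \<in> T \<and> a \<notin> \<Union>\<F>)" for T
  have W: "W T = weight A S \<and> W T = weight B S'"
    if "T \<in> max_cells R" "T \<subseteq> S" "T \<subseteq> S'" "S \<in> max_cells A'" "S' \<in> max_cells B'" for T S S'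
  proof -
    define a where "a = (SOME a. a \<in> T \<and> a \<notin> \<Union>\<F>)"
    have "a \<in> T \<and> a \<notin> \<Union>\<F>" unfolding a_def by (rule someI_ex) (use ex[OF that(1)] in blast)
    then show ?thesis
      using wR[OF that(2-5), of a] gen[of a] unfolding W_def a_def[symmetric] by simp
  qed
  have upA: "\<exists>S\<in>max_cells A'. T \<subseteq> S" and upB: "\<exists>S\<in>max_cells B'. T \<subseteq> S" if T: "T \<in> max_cells R" for T
  proof -
    obtain S S' where S: "T \<subseteq> S" "T \<subseteq> S'" "S \<in> A'" "S' \<in> B'"
      using max_cellsD(1)[OF T] by (auto simp: R_def)
    show "\<exists>S\<in>max_cells A'. T \<subseteq> S"
      using ex_max_cell[OF polyhedral_complexD(1)[OF A'(1)] S(3)] S(1) by (meson subset_trans)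
    show "\<exists>S\<in>max_cells B'. T \<subseteq> S"
      using ex_max_cell[OF polyhedral_complexD(1)[OF B'(1)] S(4)] S(2) by (meson subset_trans)
  qed
  have wnz: "weight (nonzero_part A) = weight A" for A :: "'n wcomplex" by (simp add: nonzero_part_def)
  have "subdivision_of (WComplex R W) (nonzero_part A)"
    unfolding subdivision_of_def A'_def[symmetric] wcomplex.sel wnz
  proof (intro conjI ballI impI)
    show "\<Union>R = \<Union>A'" using UR A'(2) by simp
    show "\<exists>S\<in>A'. T \<subseteq> S" if "T \<in> R" for T using that by (auto simp: R_def)
    show "W T = weight A S" if "T \<in> max_cells R" "S \<in> max_cells A'" "T \<subseteq> S" for T S
      using W[OF that(1,3) _ that(2)] upB[OF that(1)] by blast
  qed (rule R)
  moreover have "subdivision_of (WComplex R W) (nonzero_part B)"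
    unfolding subdivision_of_def B'_def[symmetric] wcomplex.sel wnz
  proof (intro conjI ballI impI)
    show "\<Union>R = \<Union>B'" using UR B'(2) supp by simp
    show "\<exists>S\<in>B'. T \<subseteq> S" if "T \<in> R" for T using that by (auto simp: R_def)
    show "W T = weight B S" if "T \<in> max_cells R" "S \<in> max_cells B'" "T \<subseteq> S" for T S
      using W[OF that(1) _ that(3) _ that(2)] upA[OF that(1)] by blast
  qed (rule R)
  ultimately show ?thesis unfolding wcomplex_eq_def by blast
qed

subsection \<open>Laurent polynomials\<close>

lemma laurent_eval_superset:
  assumes "finite F" "Poly_Mapping.keys f \<subseteq> F"
  shows "laurent_eval f p = (\<Sum>m\<in>F. Poly_Mapping.lookup f m * laurent_monom p m)"
  unfolding laurent_eval_def
  by (rule sum.mono_neutral_left) (use assms in \<open>auto simp: in_keys_iff\<close>)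

lemma laurent_eval_add: "laurent_eval (f + g) p = laurent_eval f p + laurent_eval g p"
proof -
  define F where "F = Poly_Mapping.keys f \<union> Poly_Mapping.keys g"
  have "finite F" "Poly_Mapping.keys f \<subseteq> F" "Poly_Mapping.keys g \<subseteq> F" by (auto simp: F_def)
  moreover have "Poly_Mapping.keys (f + g) \<subseteq> F" unfolding F_def by (rule keys_add)
  ultimately show ?thesis
    by (simp add: laurent_eval_superset[of F] lookup_add distrib_right sum.distrib)
qed

lemma laurent_eval_zero [simp]: "laurent_eval 0 p = 0"
  by (simp add: laurent_eval_def)

lemma laurent_eval_single [simp]:
  "laurent_eval (Poly_Mapping.single m c) p = c * laurent_monom p m"
  using laurent_eval_superset[of "{m}" "Poly_Mapping.single m c" p] by simp

lemma laurent_eval_sum: "laurent_eval (\<Sum>x\<in>A. f x) p = (\<Sum>x\<in>A. laurent_eval (f x) p)"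
  by (induction A rule: infinite_finite_induct) (auto simp: laurent_eval_add)

lemma poly_mapping_sum_single:
  "(\<Sum>m\<in>Poly_Mapping.keys f. Poly_Mapping.single m (Poly_Mapping.lookup f m)) = f"
proof (rule poly_mapping_eqI)
  fix k
  have "Poly_Mapping.lookup (\<Sum>m\<in>Poly_Mapping.keys f. Poly_Mapping.single m (Poly_Mapping.lookup f m)) k
      = (\<Sum>m\<in>Poly_Mapping.keys f. if m = k then Poly_Mapping.lookup f m else 0)"
    unfolding lookup_sum by (intro sum.cong) (auto simp: lookup_single when_def)
  also have "\<dots> = Poly_Mapping.lookup f k" by (simp add: sum.delta' in_keys_iff)
  finally show "Poly_Mapping.lookup (\<Sum>m\<in>Poly_Mapping.keys f.
      Poly_Mapping.single m (Poly_Mapping.lookup f m)) k = Poly_Mapping.lookup f k" .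
qed

lemma laurent_monom_add:
  assumes "p \<in> torus"
  shows "laurent_monom p (m + n) = laurent_monom p m * laurent_monom p n"
  using assms by (simp add: laurent_monom_def torus_def power_int_add prod.distrib)

lemma laurent_monom_nonzero: "p \<in> torus \<Longrightarrow> laurent_monom p m \<noteq> 0"
  by (simp add: laurent_monom_def torus_def)

lemma laurent_monom_axis [simp]: "laurent_monom p (axis e 1) = p $ e"
proof -
  have "laurent_monom p (axis e 1) = (\<Prod>i\<in>UNIV. if i = e then p $ e else 1)"
    unfolding laurent_monom_def by (intro prod.cong) (auto simp: axis_def)
  then show ?thesis by (simp add: prod.delta)
qed

lemma laurent_eval_mult:
  fixes f g :: "('n::finite, 'a::Fields.field) laurent"
  assumes "p \<in> torus"
  shows "laurent_eval (f * g) p = laurent_eval f p * laurent_eval g p"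
proof -
  let ?s = "\<lambda>h m. Poly_Mapping.single m (Poly_Mapping.lookup h m)"
  have "laurent_eval (f * g) p =
      laurent_eval ((\<Sum>m\<in>Poly_Mapping.keys f. ?s f m) * (\<Sum>n\<in>Poly_Mapping.keys g. ?s g n)) p"
    by (simp only: poly_mapping_sum_single)
  also have "\<dots> = (\<Sum>m\<in>Poly_Mapping.keys f. \<Sum>n\<in>Poly_Mapping.keys g.
      (Poly_Mapping.lookup f m * laurent_monom p m) * (Poly_Mapping.lookup g n * laurent_monom p n))"
    unfolding sum_product laurent_eval_sum mult_single laurent_eval_single
    by (simp add: laurent_monom_add[OF assms] mult_ac)
  also have "\<dots> = laurent_eval f p * laurent_eval g p"
    unfolding laurent_eval_def sum_product ..
  finally show ?thesis .
qed

text \<open>Clearing denominators: \<open>q\<close> is the Laurent polynomial times a power of the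
  variable. Distinct indices may have the same exponent, so the coefficients are sums over fibres of
  \<open>p\<close>; this allows several variables to be treated one after the other.\<close>

lemma laurent_univariate_poly:
  fixes c :: "'x \<Rightarrow> 'k::Fields.field" and p :: "'x \<Rightarrow> int"
  assumes "finite F"
  obtains q N where "\<And>a. a \<noteq> 0 \<Longrightarrow> poly q a = a ^ N * (\<Sum>m\<in>F. c m * a powi p m)"
    and "\<And>n. n \<ge> - int N \<Longrightarrow> poly.coeff q (nat (n + int N)) = (\<Sum>m | m \<in> F \<and> p m = n. c m)"
    and "\<And>m. m \<in> F \<Longrightarrow> p m \<ge> - int N"
proof -
  \<comment> \<open>A crude bound: the sum of all absolute exponents makes every exponent
    nonnegative after the shift.\<close>
  define N where "N = nat (\<Sum>m\<in>F. \<bar>p m\<bar>)"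
  have N: "p m \<ge> - int N" if "m \<in> F" for m
  proof -
    have "\<bar>p m\<bar> \<le> (\<Sum>m\<in>F. \<bar>p m\<bar>)" using that assms by (intro member_le_sum) auto
    then show ?thesis unfolding N_def by linarith
  qed
  define q where "q = (\<Sum>m\<in>F. Polynomial.monom (c m) (nat (p m + int N)))"
  have "poly q a = a ^ N * (\<Sum>m\<in>F. c m * a powi p m)" if "a \<noteq> 0" for a
  proof -
    have "poly q a = (\<Sum>m\<in>F. c m * a ^ nat (p m + int N))"
      by (simp add: q_def poly_sum poly_monom)
    also have "\<dots> = (\<Sum>m\<in>F. a ^ N * (c m * a powi p m))"
    proof (rule sum.cong)
      fix m assume "m \<in> F"
      have "a ^ nat (p m + int N) = a powi (p m + int N)"
        using N[OF \<open>m \<in> F\<close>] by (simp add: power_int_def)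
      also have "\<dots> = a powi p m * a ^ N" using that by (simp add: power_int_add)
      finally show "c m * a ^ nat (p m + int N) = a ^ N * (c m * a powi p m)" by (simp add: mult_ac)
    qed simp
    finally show ?thesis by (simp add: sum_distrib_left)
  qed
  moreover have "poly.coeff q (nat (n + int N)) = (\<Sum>m | m \<in> F \<and> p m = n. c m)" if "n \<ge> - int N" for n
  proof -
    have "poly.coeff q (nat (n + int N)) = (\<Sum>m\<in>F. if p m = n then c m else 0)"
      unfolding q_def coeff_sum
    proof (rule sum.cong)
      fix m assume "m \<in> F"
      have "nat (p m + int N) = nat (n + int N) \<longleftrightarrow> p m = n" using N[OF \<open>m \<in> F\<close>] that by linarith
      then show "poly.coeff (Polynomial.monom (c m) (nat (p m + int N))) (nat (n + int N)) =
          (if p m = n then c m else 0)" by simp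
    qed simp
    then show ?thesis using assms by (simp add: sum.inter_filter)
  qed
  ultimately show thesis using that N by blast
qed

lemma laurent_univariate_coeffs_zero:
  fixes c :: "'x \<Rightarrow> 'k::Fields.field" and p :: "'x \<Rightarrow> int"
  assumes "finite F" "infinite (UNIV :: 'k set)" "\<And>a. a \<noteq> 0 \<Longrightarrow> (\<Sum>m\<in>F. c m * a powi p m) = 0"
  shows "(\<Sum>m | m \<in> F \<and> p m = n. c m) = 0"
proof -
  obtain q N where q: "\<And>a. a \<noteq> 0 \<Longrightarrow> poly q a = a ^ N * (\<Sum>m\<in>F. c m * a powi p m)"
    "\<And>n. n \<ge> - int N \<Longrightarrow> poly.coeff q (nat (n + int N)) = (\<Sum>m | m \<in> F \<and> p m = n. c m)"
    "\<And>m. m \<in> F \<Longrightarrow> p m \<ge> - int N"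
    by (rule laurent_univariate_poly[OF assms(1), of c p]) (rule that)
  have "q = 0"
  proof (rule ccontr)
    assume "q \<noteq> 0"
    then have "finite {a. poly q a = 0}" by (rule poly_roots_finite)
    moreover have "UNIV - {0} \<subseteq> {a. poly q a = 0}" using q(1) assms(3) by auto
    ultimately have "finite (UNIV - {0::'k})" using finite_subset by blast
    then show False using assms(2) by simp
  qed
  show ?thesis
  proof (cases "n \<ge> - int N")
    case True
    then show ?thesis using q(2)[OF True] \<open>q = 0\<close> by simp
  next
    case False
    then have "{m. m \<in> F \<and> p m = n} = {}" using q(3) by fastforce
    then show ?thesis by (simp only: sum.empty)
  qed
qed

lemma laurent_univariate_finite_zeros:
  fixes c :: "'x \<Rightarrow> 'k::Fields.field" and p :: "'x \<Rightarrow> int"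
  assumes "finite F" "a0 \<noteq> 0" "(\<Sum>m\<in>F. c m * a0 powi p m) \<noteq> 0"
  shows "finite {a. a \<noteq> 0 \<and> (\<Sum>m\<in>F. c m * a powi p m) = 0}"
proof -
  obtain q N where q: "\<And>a. a \<noteq> 0 \<Longrightarrow> poly q a = a ^ N * (\<Sum>m\<in>F. c m * a powi p m)"
    "\<And>n. n \<ge> - int N \<Longrightarrow> poly.coeff q (nat (n + int N)) = (\<Sum>m | m \<in> F \<and> p m = n. c m)"
    "\<And>m. m \<in> F \<Longrightarrow> p m \<ge> - int N"
    by (rule laurent_univariate_poly[OF assms(1), of c p]) (rule that)
  have "poly q a0 \<noteq> 0" using q(1)[OF assms(2)] assms(2,3) by simp
  then have "q \<noteq> 0" by auto
  then have "finite {a. poly q a = 0}" by (rule poly_roots_finite)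
  then show ?thesis by (rule rev_finite_subset) (auto simp: q(1))
qed

subsection \<open>Multiplicity along a unique minimal prime\<close>

lemma primeidealD:
  fixes P :: "'a::comm_ring_1 set"
  assumes "primeideal P ring_of_type_algebra"
  shows "0 \<in> P" and "x \<in> P \<Longrightarrow> y \<in> P \<Longrightarrow> x + y \<in> P" and "x \<in> P \<Longrightarrow> r * x \<in> P"
    and "1 \<notin> P" and "x * y \<in> P \<Longrightarrow> x \<in> P \<or> y \<in> P"
proof -
  interpret primeideal P "ring_of_type_algebra :: 'a ring" by (rule assms)
  show "0 \<in> P" using additive_subgroup.zero_closed[OF additive_subgroup_axioms] by (simp add: ring_of_type_algebra_def)
  show "x \<in> P \<Longrightarrow> y \<in> P \<Longrightarrow> x + y \<in> P" 
    using additive_subgroup.a_closed[OF additive_subgroup_axioms] by (simp add: ring_of_type_algebra_def)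
  show c: "r * x \<in> P" if "x \<in> P" for r x
    using I_l_closed[of x r] that by (simp add: ring_of_type_algebra_def)
  show "1 \<notin> P"
  proof
    assume "1 \<in> P"
    then have "r \<in> P" for r using c[of 1 r] by simp
    then show False using I_notcarr by (auto simp: ring_of_type_algebra_def)
  qed
  show "x * y \<in> P \<Longrightarrow> x \<in> P \<or> y \<in> P" using I_prime[of x y] by (simp add: ring_of_type_algebra_def)
qed

lemma primeideal_type_algebraI:
  fixes P :: "'a::comm_ring_1 set"
  assumes "0 \<in> P" "\<And>x y. x \<in> P \<Longrightarrow> y \<in> P \<Longrightarrow> x + y \<in> P" "\<And>x r. x \<in> P \<Longrightarrow> r * x \<in> P"
    and "1 \<notin> P" "\<And>x y. x * y \<in> P \<Longrightarrow> x \<in> P \<or> y \<in> P"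
  shows "primeideal P ring_of_type_algebra"
proof (rule primeidealI2)
  interpret R: cring "ring_of_type_algebra :: 'a ring" by (rule cring_from_type_algebra)
  show "cring (ring_of_type_algebra :: 'a ring)" by (rule cring_from_type_algebra)
  show "additive_subgroup P (ring_of_type_algebra :: 'a ring)"
  proof (rule additive_subgroupI, rule subgroup.intro)
    show "inv\<^bsub>add_monoid (ring_of_type_algebra :: 'a ring)\<^esub> x \<in> P" if "x \<in> P" for x
    proof -
      have "inv\<^bsub>add_monoid (ring_of_type_algebra :: 'a ring)\<^esub> x = - x"
        using R.minus_equality[of "- x" x] by (simp add: ring_of_type_algebra_def a_inv_def)
      then show ?thesis using assms(3)[OF that, of "- 1"] by simp
    qed
  qed (use assms in \<open>auto simp: ring_of_type_algebra_def\<close>)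
qed (use assms in \<open>auto simp: ring_of_type_algebra_def mult.commute\<close>)

lemma ideal_UNIV: "ideal UNIV (ring_of_type_algebra :: 'a::comm_ring_1 ring)"
proof -
  interpret R: cring "ring_of_type_algebra :: 'a ring" by (rule cring_from_type_algebra)
  show ?thesis using R.oneideal by (simp add: ring_of_type_algebra_def)
qed

text \<open>\<open>J\<close> is the only minimal prime, and \<open>J\<close> together with the whole
  ring forms a chain of two local ideals, so the length there is at least 1. That the multiplicity
  is nonzero is all that later arguments ask of it.\<close>

lemma ideal_mult_unique_minimal_prime:
  fixes I J :: "'a::comm_ring_1 set"
  assumes J: "primeideal J ring_of_type_algebra" "I \<subseteq> J"
    and min: "\<And>Q. primeideal Q ring_of_type_algebra \<Longrightarrow> I \<subseteq> Q \<Longrightarrow> J \<subseteq> Q"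
  shows "ideal_mult I \<noteq> 0"
proof -
  have "minimal_primes I = {J}"
    unfolding minimal_primes_def using J min by blast
  moreover have "1 \<le> local_length I J"
  proof -
    have J1: "J \<noteq> UNIV" using primeidealD(4)[OF J(1)] by auto
    have "J \<in> local_ideals I J"
      unfolding local_ideals_def using J primeidealD(5)[OF J(1)] primeideal.axioms(1) by blast
    moreover have "UNIV \<in> local_ideals I J"
      unfolding local_ideals_def using ideal_UNIV by blast
    ultimately have "{J, UNIV} \<in> {C. subset.chain (local_ideals I J) C \<and> finite C \<and> C \<noteq> {}}"
      by (auto simp: subset_chain_def)
    then have "enat (card {J, UNIV} - 1) \<le> local_length I J"
      unfolding local_length_def by (rule SUP_upper)
    then show ?thesis using J1 by (simp add: one_enat_def)
  qed
  ultimately show ?thesis unfolding ideal_mult_def by auto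
qed

subsection \<open>Valuations\<close>

lemma val_powi: "x \<noteq> 0 \<Longrightarrow> val (x powi n) = of_int n * val (x::'a::valued_field)"
proof -
  assume x: "x \<noteq> 0"
  have pow: "val (x ^ k) = of_nat k * val x" for k
    by (induction k) (use x in \<open>auto simp: val_mult algebra_simps\<close>)
  show ?thesis
  proof (cases "n \<ge> 0")
    case True
    then show ?thesis using pow[of "nat n"] by (simp add: power_int_def)
  next
    case False
    then show ?thesis using pow[of "nat (- n)"] x
      by (simp add: power_int_def val_inverse power_inverse)
  qed
qed

lemma val_prod:
  "finite A \<Longrightarrow> (\<And>i. i \<in> A \<Longrightarrow> f i \<noteq> 0) \<Longrightarrow> val (\<Prod>i\<in>A. f i) = (\<Sum>i\<in>A. val (f i :: 'a::valued_field))"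
  by (induction A rule: finite_induct) (auto simp: val_mult)

lemma val_laurent_monom:
  assumes "p \<in> torus"
  shows "val (laurent_monom (p::'a::valued_field^'n) m) = (\<Sum>i\<in>UNIV. val (p $ i) * of_int (m $ i))"
  using assms unfolding laurent_monom_def torus_def
  by (subst val_prod) (auto simp: val_powi mult.commute)

lemma val_add_dominated:
  fixes x y :: "'a::valued_field"
  assumes "x \<noteq> 0" "y = 0 \<or> val x < val y"
  shows "x + y \<noteq> 0" "val (x + y) = val x"
proof -
  show nz: "x + y \<noteq> 0"
    using assms val_uminus[of x] by (auto simp: add_eq_0_iff)
  show "val (x + y) = val x"
  proof (cases "y = 0")
    case False
    then have y: "val x < val y" using assms by simp
    have "val x \<le> val (x + y)" using val_add[OF assms(1) False nz] y by simp
    moreover have "val (x + y) \<le> val x"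
      using val_add[of "x + y" "- y"] nz False assms(1) y by simp
    ultimately show ?thesis by simp
  qed simp
qed

text \<open>Ultrametric principle: the terms other than \<open>m\<close> sum to 0 or to an element
  of strictly larger valuation, which cannot cancel \<open>c m\<close>.\<close>

lemma sum_unique_min_val:
  fixes c :: "'x \<Rightarrow> 'a::valued_field"
  assumes "finite F" "m \<in> F" "c m \<noteq> 0" "\<And>l. l \<in> F \<Longrightarrow> l \<noteq> m \<Longrightarrow> val (c m) < val (c l)"
  shows "(\<Sum>l\<in>F. c l) \<noteq> 0"
proof -
  have "s = 0 \<or> val (c m) < val s" if s: "s = (\<Sum>l\<in>G. c l)" "G \<subseteq> F - {m}" for G s
  proof -
    have "finite G" using that assms(1) finite_subset by blast
    then show ?thesis using s
    proof (induction G arbitrary: s rule: finite_induct)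
      case (insert l G)
      let ?r = "\<Sum>l\<in>G. c l"
      have IH: "?r = 0 \<or> val (c m) < val ?r" using insert by blast
      have l: "val (c m) < val (c l)" using insert assms(4) by blast
      have s: "s = c l + ?r" using insert by simp
      show ?case
      proof (cases "c l = 0 \<or> ?r = 0 \<or> s = 0")
        case True
        then show ?thesis using s IH l by auto
      next
        case False
        then have "min (val (c l)) (val ?r) \<le> val s" using val_add[of "c l" ?r] s by simp
        then show ?thesis using IH l False by auto
      qed
    qed simp
  qed
  from this[OF refl subset_refl] have "c m + (\<Sum>l\<in>F - {m}. c l) \<noteq> 0"
    using val_add_dominated(1)[OF assms(3)] by blast
  then show ?thesis using assms(1,2) by (simp add: sum.remove)
qed

text \<open>The elementary inclusion of the fundamental theorem of tropical geometry: if a single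
  term of \<open>f\<close> at \<open>p\<close> had smallest valuation, the terms could not sum to
  0.\<close>

lemma val_root_in_trop_set:
  fixes p :: "'a::valued_field^'n"
  assumes "p \<in> Y" "p \<in> torus"
  shows "(\<chi> i. val (p $ i)) \<in> trop_set (torus_ideal Y)"
  unfolding trop_set_def
proof (rule INT_I)
  fix f assume f: "f \<in> torus_ideal Y"
  let ?w = "\<chi> i. val (p $ i)"
  let ?c = "\<lambda>m. Poly_Mapping.lookup f m * laurent_monom p m"
  have vc: "val (?c m) = trop_term f ?w m" "?c m \<noteq> 0" if "m \<in> Poly_Mapping.keys f" for m
    using that laurent_monom_nonzero[OF assms(2)]
    by (simp_all add: trop_term_def val_mult val_laurent_monom[OF assms(2)] in_keys_iff)
  show "?w \<in> trop_hypersurface f"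
  proof (cases "f = 0")
    case True
    then show ?thesis by (simp add: trop_hypersurface_def)
  next
    case False
    then have ne: "Poly_Mapping.keys f \<noteq> {}" by simp
    obtain m where m: "m \<in> Poly_Mapping.keys f"
      and min: "\<forall>l\<in>Poly_Mapping.keys f. trop_term f ?w m \<le> trop_term f ?w l"
      using ex_min_if_finite[OF _ ne] finite_keys ne
        arg_min_if_finite[of "Poly_Mapping.keys f" "trop_term f ?w"] by (metis not_less)
    have "(\<Sum>m\<in>Poly_Mapping.keys f. ?c m) = 0"
      using f assms by (auto simp: torus_ideal_def laurent_eval_def)
    then obtain l where l: "l \<in> Poly_Mapping.keys f" "l \<noteq> m" "\<not> val (?c m) < val (?c l)"
      using sum_unique_min_val[of "Poly_Mapping.keys f" m ?c] vc(2)[OF m] m by auto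
    then have "trop_term f ?w l \<le> trop_term f ?w m" using vc m by simp
    then have "\<forall>k\<in>Poly_Mapping.keys f. trop_term f ?w l \<le> trop_term f ?w k"
      using min by force
    then show ?thesis using l m min unfolding trop_hypersurface_def by blast
  qed
qed

text \<open>Roots of an element of positive valuation have arbitrarily small positive valuation, and
  integer multiples of a step shorter than \<open>b - a\<close> cannot jump over the
  interval.\<close>

lemma value_group_dense:
  assumes "a < b"
  shows "\<exists>g\<in>value_group TYPE('a::{alg_closed_field, valued_field}). a < g \<and> g < b"
proof -
  obtain x0 :: 'a where x0: "x0 \<noteq> 0" "val x0 \<noteq> 0" using val_nontrivial by blast
  define x where "x = (if val x0 > 0 then x0 else inverse x0)"
  have x: "x \<noteq> 0" "val x > 0" using x0 val_inverse[of x0] by (auto simp: x_def)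
  \<comment> \<open>The degree of a root whose valuation is a step shorter than
    \<open>b - a\<close>.\<close>
  obtain n :: nat where n: "val x / (b - a) < of_nat n" using reals_Archimedean2 by blast
  have "0 < val x / (b - a)" using x assms by simp
  then have n0: "n > 0" using n by (cases n) auto
  obtain y where y: "y ^ n = x" using nth_root_exists[OF n0] by blast
  then have y0: "y \<noteq> 0" using x n0 by (auto simp: zero_power)
  have "val x = of_nat n * val y" using val_powi[OF y0, of "int n"] y by simp
  then have vy0: "val y > 0" using x n0 by (auto simp: zero_less_mult_iff)
  have "val x < of_nat n * (b - a)" using n assms by (simp add: divide_less_eq)
  then have vy: "val y > 0" "val y < b - a"
    using \<open>val x = of_nat n * val y\<close> n0 vy0 by simp_all
  \<comment> \<open>The multiple following the last one that is at most \<open>a\<close>.\<close>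
  define k where "k = \<lfloor>a / val y\<rfloor> + 1"
  have "of_int k * val y > a"
    using vy by (simp add: k_def divide_less_eq[symmetric] pos_divide_less_eq[symmetric]) 
  moreover have "of_int (k - 1) * val y \<le> a"
    using vy by (simp add: k_def pos_le_divide_eq[symmetric])
  then have "of_int k * val y < b" using vy by (simp add: algebra_simps)
  moreover have "of_int k * val y \<in> value_group TYPE('a)"
    unfolding value_group_def using val_powi[OF y0, of k] y0 by (metis (mono_tags, lifting) mem_Collect_eq power_int_not_zero)
  ultimately show ?thesis by blast
qed

subsection \<open>The residue field\<close>

lemma red_0 [simp]: "red 0 = 0"
  by transfer (simp add: residue_rel_def)

lemma red_1 [simp]: "red 1 = 1"
  by transfer (simp add: residue_rel_def)

lemma red_add: "x \<in> val_ring \<Longrightarrow> y \<in> val_ring \<Longrightarrow> red (x + y) = red x + red y"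
  by transfer (simp add: residue_rel_def val_ring_add)

lemma red_mult: "x \<in> val_ring \<Longrightarrow> y \<in> val_ring \<Longrightarrow> red (x * y) = red x * red y"
  by transfer (simp add: residue_rel_def val_ring_mult)

lemma red_eq_0_iff: "x \<in> val_ring \<Longrightarrow> red x = 0 \<longleftrightarrow> x \<in> val_max_ideal"
  by transfer (simp add: residue_rel_def)

lemma val_max_ideal_subset: "val_max_ideal \<subseteq> (val_ring :: 'a::valued_field set)"
  by (auto simp: val_max_ideal_def val_ring_def)

lemma red_uminus: "x \<in> val_ring \<Longrightarrow> red (- x) = - red (x::'a::valued_field)"
proof -
  assume "x \<in> val_ring"
  then have "red x + red (- x) = 0" using red_add[of x "- x"] val_ring_uminus[of x] by simp
  then show ?thesis by (rule minus_unique[symmetric])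
qed

lemma red_surj: "\<exists>x\<in>val_ring. red x = r"
proof transfer
  fix r :: 'a assume "residue_rel r r"
  then show "\<exists>x\<in>val_ring. residue_rel (if x \<in> val_ring then x else 0) r"
    by (intro bexI[of _ r]) (auto simp: residue_rel_def)
qed

lemma val_ring_sum: "(\<And>i. i \<in> A \<Longrightarrow> f i \<in> val_ring) \<Longrightarrow> (\<Sum>i\<in>A. f i) \<in> val_ring"
  by (induction A rule: infinite_finite_induct) (auto intro: val_ring_add)

lemma red_sum: "(\<And>i. i \<in> A \<Longrightarrow> f i \<in> val_ring) \<Longrightarrow> red (\<Sum>i\<in>A. f i) = (\<Sum>i\<in>A. red (f i))"
  by (induction A rule: infinite_finite_induct) (auto simp: red_add val_ring_sum)

lemma val_ring_prod: "(\<And>i. i \<in> A \<Longrightarrow> f i \<in> val_ring) \<Longrightarrow> (\<Prod>i\<in>A. f i) \<in> val_ring"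
  by (induction A rule: infinite_finite_induct) (auto intro: val_ring_mult)

lemma red_prod: "(\<And>i. i \<in> A \<Longrightarrow> f i \<in> val_ring) \<Longrightarrow> red (\<Prod>i\<in>A. f i) = (\<Prod>i\<in>A. red (f i))"
  by (induction A rule: infinite_finite_induct) (auto simp: red_mult val_ring_prod)

lemma red_inverse:
  assumes "x \<noteq> 0" "val x = 0"
  shows "red (inverse x) = inverse (red x)"
proof -
  have "x \<in> val_ring" "inverse x \<in> val_ring" using assms val_inverse[of x] by (auto simp: val_ring_def)
  then have "red x * red (inverse x) = 1" using red_mult[of x "inverse x"] assms(1) by simp
  then show ?thesis using inverse_unique by metis
qed

lemma val_ring_powi:
  assumes "x \<noteq> 0" "val x = 0"
  shows "x powi n \<in> val_ring" "red (x powi n) = red x powi n"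
proof -
  have xr: "x \<in> val_ring" using assms by (simp add: val_ring_def)
  have pow: "x ^ k \<in> val_ring \<and> red (x ^ k) = red x ^ k" for k
    by (induction k) (auto simp: xr val_ring_mult red_mult)
  have xp: "x ^ k \<noteq> 0" "val (x ^ k) = 0" for k using assms val_powi[of x "int k"] by simp_all
  show "x powi n \<in> val_ring" using assms val_powi[of x n] by (simp add: val_ring_def)
  show "red (x powi n) = red x powi n"
    using pow red_inverse[OF xp] by (auto simp: power_int_def power_inverse)
qed

text \<open>The argument that an algebraically closed field is infinite, lifted to the valuation
  ring: with representatives \<open>s r\<close> of finitely many residues, the product of all X -
  \<open>s r\<close>, plus 1, has a root. The root is integral, so reduction makes the product 0,
  although it equals -1.\<close>

lemma infinite_residue: "infinite (UNIV :: 'a::{alg_closed_field, valued_field} residue set)"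
proof
  assume fin: "finite (UNIV :: 'a residue set)"
  obtain s :: "'a residue \<Rightarrow> 'a" where s: "\<And>r. s r \<in> val_ring \<and> red (s r) = r"
    using red_surj by metis
  define q where "q = (\<Prod>r\<in>UNIV. [:- s r, 1:]) + 1"
  have deg: "Polynomial.degree (\<Prod>r\<in>UNIV. [:- s r, 1:]) = card (UNIV :: 'a residue set)"
    by (subst degree_prod_eq_sum_degree) auto
  have card: "card (UNIV :: 'a residue set) > 0" using fin by (simp add: card_gt_0_iff)
  then have "Polynomial.degree q > 0"
    unfolding q_def by (subst degree_add_eq_left) (simp_all add: deg)
  then obtain x where "poly q x = 0" using alg_closed_imp_poly_has_root by blast
  then have "(\<Prod>r\<in>UNIV. x - s r) + 1 = 0" by (simp add: q_def poly_prod)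
  then have x: "(\<Prod>r\<in>UNIV. x - s r) = - 1" by (simp only: eq_neg_iff_add_eq_0)
  \<comment> \<open>At a root of negative valuation every factor would have that same valuation, so
    the product could not have the valuation 0 of -1.\<close>
  have "x \<in> val_ring"
  proof (rule ccontr)
    assume "x \<notin> val_ring"
    then have x0: "x \<noteq> 0" "val x < 0" by (auto simp: val_ring_def)
    have dom: "x - s r \<noteq> 0 \<and> val (x - s r) = val x" for r
      using val_add_dominated[OF x0(1), of "- s r"] x0(2) s[of r] by (auto simp: val_ring_def)
    then have "val (\<Prod>r\<in>UNIV. x - s r) = of_nat (card (UNIV :: 'a residue set)) * val x"
      using fin by (subst val_prod) auto
    then have "of_nat (card (UNIV :: 'a residue set)) * val x = 0" by (simp add: x)
    then show False using card x0 by simp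
  qed
  then have sub: "x - s r \<in> val_ring" for r
    using val_ring_add[of x "- s r"] val_ring_uminus[of "s r"] s[of r] by simp
  have "red (x - s (red x)) = 0"
    using red_add[of x "- s (red x)"] \<open>x \<in> val_ring\<close> val_ring_uminus[of "s (red x)"]
      red_uminus[of "s (red x)"] s[of "red x"] by simp
  then have "(\<Prod>r\<in>UNIV. red (x - s r)) = 0" using fin by auto
  then have "red (- 1 :: 'a) = 0" using red_prod[of UNIV "\<lambda>r. x - s r"] sub x by simp
  then show False using red_uminus[of "1::'a"] by simp
qed

subsection \<open>Pluecker indices as edges of a tetrahedron\<close>

text \<open>Unordered pairs let the four vertices be relabelled freely; \<open>min\<close> and
  \<open>max\<close> choose the representative in the ordered index type. The value at equal
  arguments carries no meaning.\<close>

definition edge :: "4 \<Rightarrow> 4 \<Rightarrow> pidx" where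
  "edge i j = Abs_pidx (min i j, max i j)"

lemma Rep_edge: "i \<noteq> j \<Longrightarrow> Rep_pidx (edge i j) = (min i j, max i j)"
  unfolding edge_def by (rule Abs_pidx_inverse) (auto simp: min_def max_def)

lemma edge_commute: "edge i j = edge j i"
  by (simp add: edge_def min.commute max.commute)

lemma edge_eq_iff:
  assumes "i \<noteq> j" "k \<noteq> l"
  shows "edge i j = edge k l \<longleftrightarrow> (i = k \<and> j = l) \<or> (i = l \<and> j = k)"
proof -
  have "edge i j = edge k l \<longleftrightarrow> (min i j, max i j) = (min k l, max k l)"
    using Rep_edge assms by (metis Rep_pidx_inject)
  then show ?thesis using assms by (auto simp: min_def max_def split: if_splits)
qed

lemma ex_edge: "\<exists>i j. i \<noteq> j \<and> e = edge i j"
proof -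
  obtain i j where "e = Abs_pidx (i, j)" "i < j" by (cases e) auto
  then have "i \<noteq> j \<and> e = edge i j" by (auto simp: edge_def min_absorb1 max_absorb2 less_imp_le)
  then show ?thesis by blast
qed

lemma distinct_four_exhaust:
  assumes "distinct [i, j, k, l :: 4]"
  shows "x = i \<or> x = j \<or> x = k \<or> x = l"
proof -
  have "card {i, j, k, l} = CARD(4)" using assms by simp
  then have "{i, j, k, l} = UNIV" by (intro card_eq_UNIV_imp_eq_UNIV) auto
  then show ?thesis by blast
qed

lemma UNIV_pidx:
  assumes "distinct [i, j, k, l]"
  shows "UNIV = {edge i j, edge k l, edge i k, edge i l, edge j k, edge j l}"
proof -
  have "e \<in> {edge i j, edge k l, edge i k, edge i l, edge j k, edge j l}" for e
  proof -
    obtain x y where "x \<noteq> y" "e = edge x y" using ex_edge by blast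
    moreover have "x = i \<or> x = j \<or> x = k \<or> x = l" "y = i \<or> y = j \<or> y = k \<or> y = l"
      using distinct_four_exhaust[OF assms] by blast+
    ultimately show ?thesis by (auto simp: edge_commute)
  qed
  then show ?thesis by blast
qed

lemma distinct_edges:
  assumes "distinct [i, j, k, l]"
  shows "distinct [edge i j, edge k l, edge i k, edge i l, edge j k, edge j l]"
  using assms by (auto simp: edge_eq_iff)

lemma prod_pidx:
  fixes f :: "pidx \<Rightarrow> 'b::comm_monoid_mult"
  assumes "distinct [i, j, k, l]"
  shows "prod f UNIV = f (edge i j) * f (edge k l) * f (edge i k) * f (edge i l) * f (edge j k) * f (edge j l)"
  unfolding UNIV_pidx[OF assms] using distinct_edges[OF assms] by (simp add: mult.assoc)

lemma vec_pidx_eqI: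
  assumes "distinct [i, j, k, l]"
    and "x $ edge i j = y $ edge i j" "x $ edge k l = y $ edge k l" "x $ edge i k = y $ edge i k"
    "x $ edge i l = y $ edge i l" "x $ edge j k = y $ edge j k" "x $ edge j l = y $ edge j l"
  shows "x = y"
proof -
  have "x $ e = y $ e" for e
    using UNIV_I[of e] unfolding UNIV_pidx[OF assms(1)]
    by (elim insertE emptyE) (simp_all add: assms)
  then show ?thesis by (simp add: vec_eq_iff)
qed

lemma phi_edge: "i \<noteq> j \<Longrightarrow> phi a $ edge i j = a $ i + a $ j"
  by (simp add: phi_def Rep_edge min_def max_def)

lemma ex_distinct_four: "\<exists>i j k l :: 4. distinct [i, j, k, l]"
proof -
  have "(card (UNIV :: 4 set)) = 4" by simp
  then obtain xs :: "4 list" where "distinct xs" "length xs = 4"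
    by (metis distinct_card finite_distinct_list finite)
  then obtain a b c e where "xs = [a, b, c, e]" by (auto simp: numeral_eq_Suc length_Suc_conv)
  with \<open>distinct xs\<close> show ?thesis by blast
qed

lemma linear_phi: "linear phi"
  by (rule linearI) (auto simp: phi_def vec_eq_iff algebra_simps)

lemma inj_phi: "inj phi"
proof (rule linear_injective_0[OF linear_phi, THEN iffD2], intro allI impI)
  fix a assume a: "phi a = 0"
  obtain i j k l :: 4 where d: "distinct [i, j, k, l]" using ex_distinct_four by blast
  have "phi a $ edge x y = 0" for x y using a by simp
  then have s: "a $ x + a $ y = 0" if "x \<noteq> y" for x y using phi_edge[OF that, of a] by simp
  have "a $ i = 0 \<and> a $ j = 0 \<and> a $ k = 0 \<and> a $ l = 0"
    using d s[of i j] s[of i k] s[of j k] s[of i l] by auto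
  then have "a $ x = 0" for x using distinct_four_exhaust[OF d, of x] by auto
  then show "a = 0" by (simp add: vec_eq_iff)
qed

lemma phi_const: "phi (\<chi> i. c) = (\<chi> e. 2 * c)"
  by (simp add: phi_def vec_eq_iff)

subsection \<open>Lines through the unit point\<close>

definition delta :: "'a::Fields.field^4 \<Rightarrow> 'a^pidx" where
  "delta u = (\<chi> e. u $ snd_idx e - u $ fst_idx e)"

text \<open>The sign of the ordered index against the edge oriented from \<open>i\<close> to
  \<open>j\<close>; with it the relation of a triangle becomes a cyclic sum.\<close>

definition edge_sign :: "4 \<Rightarrow> 4 \<Rightarrow> 'a::Fields.field" where
  "edge_sign i j = (if i < j then 1 else - 1)"

lemma edge_sign_square [simp]: "edge_sign i j * (edge_sign i j * x) = x"
  by (simp add: edge_sign_def)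

lemma edge_sign_nonzero [simp]: "edge_sign i j \<noteq> 0"
  by (simp add: edge_sign_def)

lemma val_edge_sign [simp]: "val (edge_sign i j :: 'a::valued_field) = 0"
  by (simp add: edge_sign_def)

lemma delta_edge: "i \<noteq> j \<Longrightarrow> delta u $ edge i j = edge_sign i j * (u $ j - u $ i)"
  by (auto simp: delta_def Rep_edge min_def max_def edge_sign_def)

lemma delta_torus: "delta u \<in> torus \<longleftrightarrow> (\<forall>i j. i \<noteq> j \<longrightarrow> u $ i \<noteq> u $ j)"
proof
  assume "delta u \<in> torus"
  then show "\<forall>i j. i \<noteq> j \<longrightarrow> u $ i \<noteq> u $ j"
    using delta_edge[of _ _ u] by (auto simp: torus_def) (metis diff_self mult_zero_right)
next
  assume u: "\<forall>i j. i \<noteq> j \<longrightarrow> u $ i \<noteq> u $ j"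
  show "delta u \<in> torus"
    unfolding torus_def
  proof (intro CollectI allI)
    fix e
    obtain i j where "i \<noteq> j" "e = edge i j" using ex_edge by blast
    then show "delta u $ e \<noteq> 0" using u delta_edge[of i j u] by auto
  qed
qed

text \<open>One of the two basis vectors can be exchanged for the unit point. Minors with the unit
  point are differences, and the determinant of the exchange is absorbed by scaling the other
  vector.\<close>

lemma lines_through_unit_point_delta:
  assumes "p \<in> lines_through_unit_point"
  shows "\<exists>u. p = delta u"
proof -
  obtain x y :: "'a^4" where xy: "p = pluecker x y" "(\<chi> i. 1) \<in> vec.span {x, y}"
    using assms unfolding lines_through_unit_point_def pluecker_vectors_def by blast
  obtain a where "(\<chi> i. 1) - a *s x \<in> vec.span {y}" using xy(2) vec.span_breakdown_eq by blast
  then obtain b where "(\<chi> i. 1) - a *s x = b *s y" by (auto simp: vec.span_singleton)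
  then have ab: "1 = a * x $ i + b * y $ i" for i
    by (simp add: vec_eq_iff) (metis add.commute diff_add_cancel)
  show ?thesis
  proof (cases "a = 0")
    case False
    have "p $ e = (inverse a *s y) $ snd_idx e - (inverse a *s y) $ fst_idx e" for e
    proof -
      have "a * (x $ fst_idx e * y $ snd_idx e - x $ snd_idx e * y $ fst_idx e) =
        (a * x $ fst_idx e + b * y $ fst_idx e) * y $ snd_idx e -
        (a * x $ snd_idx e + b * y $ snd_idx e) * y $ fst_idx e" by (simp add: algebra_simps)
      then have "a * p $ e = y $ snd_idx e - y $ fst_idx e"
        unfolding ab[symmetric] by (simp add: xy(1) pluecker_def)
      then show ?thesis using False by (simp add: field_simps)
    qed
    then have "p = delta (inverse a *s y)" by (simp add: delta_def vec_eq_iff)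
    then show ?thesis by blast
  next
    case True
    then have b: "b \<noteq> 0" "b * y $ i = 1" for i using ab[of i] by auto
    have "p $ e = (- inverse b *s x) $ snd_idx e - (- inverse b *s x) $ fst_idx e" for e
    proof -
      have "b * p $ e = x $ fst_idx e * (b * y $ snd_idx e) - x $ snd_idx e * (b * y $ fst_idx e)"
        by (simp add: xy(1) pluecker_def algebra_simps)
      then have "b * p $ e = x $ fst_idx e - x $ snd_idx e" by (simp add: b)
      then show ?thesis using b(1) by (simp add: field_simps)
    qed
    then have "p = delta (- inverse b *s x)" by (simp add: delta_def vec_eq_iff)
    then show ?thesis by blast
  qed
qed

lemma delta_in_lines_through_unit_point:
  assumes "delta u \<in> torus"
  shows "delta u \<in> lines_through_unit_point"
proof -
  let ?o = "(\<chi> i. 1) :: 'a^4"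
  obtain i j k l :: 4 where d: "distinct [i, j, k, l]" using ex_distinct_four by blast
  have "u $ i \<noteq> u $ j" using assms d unfolding delta_torus by simp
  then have "u \<notin> vec.span {?o}" by (auto simp: vec.span_singleton vec_eq_iff)
  moreover have "?o \<noteq> 0" by (simp add: vec_eq_iff)
  moreover have "u \<noteq> ?o" using \<open>u $ i \<noteq> u $ j\<close> by auto
  ultimately have ind: "vec.independent {u, ?o}"
    by (simp add: vec.independent_insert vec.dependent_single)
  have "vec.dim (vec.span {?o, u}) = 2"
    using vec.dim_eq_card_independent[OF ind] \<open>u \<noteq> ?o\<close> by (simp add: insert_commute)
  then have "vec.span {?o, u} \<in> {L \<in> lines. ?o \<in> L}"
    by (auto simp: lines_def vec.subspace_span intro: vec.span_base)
  moreover have "delta u = pluecker ?o u" by (simp add: delta_def pluecker_def vec_eq_iff)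
  then have "delta u \<in> pluecker_vectors (vec.span {?o, u})" unfolding pluecker_vectors_def by blast
  ultimately show ?thesis unfolding lines_through_unit_point_def by blast
qed

text \<open>The differences of \<open>u\<close> around a triangle sum to 0. The scalar
  \<open>c\<close> later normalizes the relation before its initial form is taken.\<close>

definition triangle_poly :: "'a::Fields.field \<Rightarrow> 4 \<Rightarrow> 4 \<Rightarrow> 4 \<Rightarrow> (pidx, 'a) laurent" where
  "triangle_poly c x y z = Poly_Mapping.single (axis (edge x y) 1) (c * edge_sign x y)
     + Poly_Mapping.single (axis (edge y z) 1) (c * edge_sign y z)
     + Poly_Mapping.single (axis (edge z x) 1) (c * edge_sign z x)"

lemma axis_int_inject: "axis e (1::int) = axis e' 1 \<longleftrightarrow> e = e'"
  by (simp add: axis_eq_axis)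

lemma triangle_poly_lookup:
  assumes "distinct [x, y, z]"
  shows "Poly_Mapping.lookup (triangle_poly c x y z) m =
     (if m = axis (edge x y) 1 then c * edge_sign x y
      else if m = axis (edge y z) 1 then c * edge_sign y z
      else if m = axis (edge z x) 1 then c * edge_sign z x else 0)"
proof -
  have "edge x y \<noteq> edge y z" "edge y z \<noteq> edge z x" "edge z x \<noteq> edge x y"
    using assms by (auto simp: edge_eq_iff)
  then show ?thesis
    by (auto simp: triangle_poly_def lookup_add lookup_single when_def axis_int_inject)
qed

lemma triangle_poly_in_ideal:
  assumes "distinct [x, y, z]"
  shows "triangle_poly c x y z \<in> torus_ideal lines_through_unit_point"
  unfolding torus_ideal_def
proof (intro CollectI ballI)
  fix p :: "'a^pidx" assume "p \<in> lines_through_unit_point \<inter> torus"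
  then obtain u where "p = delta u" using lines_through_unit_point_delta by blast
  moreover have "x \<noteq> y" "y \<noteq> z" "z \<noteq> x" using assms by auto
  ultimately show "laurent_eval (triangle_poly c x y z) p = 0"
    by (simp add: triangle_poly_def laurent_eval_add delta_edge mult.assoc)
      (simp add: algebra_simps)
qed

definition two_min :: "real \<Rightarrow> real \<Rightarrow> real \<Rightarrow> bool" where
  "two_min a b c \<longleftrightarrow> (a = b \<and> a \<le> c) \<or> (a = c \<and> a \<le> b) \<or> (b = c \<and> b \<le> a)"

lemma trop_term_axis:
  fixes f :: "('n::finite, 'a::valued_field) laurent"
  shows "trop_term f w (axis e 1) = val (Poly_Mapping.lookup f (axis e 1)) + w $ e"
proof -
  have "(\<Sum>i\<in>UNIV. w $ i * of_int ((axis e 1 :: int^'n) $ i)) = (\<Sum>i\<in>UNIV. if i = e then w $ e else 0)"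
    by (intro sum.cong) (auto simp: axis_def)
  then show ?thesis by (simp add: trop_term_def sum.delta)
qed

lemma trop_lines_two_min:
  fixes w :: "real^pidx"
  assumes "w \<in> trop_set (torus_ideal (lines_through_unit_point :: ('k::valued_field^pidx) set))"
    and d: "distinct [x, y, z]"
  shows "two_min (w $ edge x y) (w $ edge y z) (w $ edge z x)"
proof -
  let ?f = "triangle_poly 1 x y z :: (pidx, 'k) laurent"
  have ne: "edge x y \<noteq> edge y z" "edge y z \<noteq> edge z x" "edge z x \<noteq> edge x y"
    using d by (auto simp: edge_eq_iff)
  note lk = triangle_poly_lookup[OF d, of "1::'k"]
  have keys: "Poly_Mapping.keys ?f = {axis (edge x y) 1, axis (edge y z) 1, axis (edge z x) 1}"
    unfolding keys.rep_eq using lk by (auto split: if_splits)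
  have nz: "?f \<noteq> 0" using keys by auto
  have "w \<in> trop_hypersurface ?f"
    using assms(1) triangle_poly_in_ideal[OF d] unfolding trop_set_def by blast
  then obtain m m' where m: "m \<in> Poly_Mapping.keys ?f" "m' \<in> Poly_Mapping.keys ?f" "m \<noteq> m'"
    "\<forall>l\<in>Poly_Mapping.keys ?f. trop_term ?f w m \<le> trop_term ?f w l"
    "\<forall>l\<in>Poly_Mapping.keys ?f. trop_term ?f w m' \<le> trop_term ?f w l"
    using nz unfolding trop_hypersurface_def by blast
  have tt: "trop_term ?f w (axis (edge x y) 1) = w $ edge x y"
    "trop_term ?f w (axis (edge y z) 1) = w $ edge y z"
    "trop_term ?f w (axis (edge z x) 1) = w $ edge z x"
    unfolding trop_term_axis lk using ne by (simp_all add: axis_int_inject)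
  have le: "trop_term ?f w m \<le> w $ edge x y" "trop_term ?f w m \<le> w $ edge y z" "trop_term ?f w m \<le> w $ edge z x"
    using m(4) unfolding keys by (simp_all add: tt)
  have le': "trop_term ?f w m' \<le> w $ edge x y" "trop_term ?f w m' \<le> w $ edge y z" "trop_term ?f w m' \<le> w $ edge z x"
    using m(5) unfolding keys by (simp_all add: tt)
  have "(m = axis (edge x y) 1 \<or> m = axis (edge y z) 1 \<or> m = axis (edge z x) 1) \<and>
      (m' = axis (edge x y) 1 \<or> m' = axis (edge y z) 1 \<or> m' = axis (edge z x) 1)"
    using m(1,2) unfolding keys by simp
  then show ?thesis
    using m(3) le le' unfolding two_min_def
    by (elim conjE disjE) (simp_all add: tt)
qed

subsection \<open>Cones spanned by two opposite edges\<close>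

text \<open>Serves twice: with real entries, \<open>c\<close> being smaller than \<open>a\<close>
  and \<open>b\<close>, it is a point of the cone of two opposite edges; with nonzero field entries
  it is a point of the 3-dimensional subtorus on which the four remaining coordinates agree.\<close>

definition pair_pt :: "4 \<Rightarrow> 4 \<Rightarrow> 4 \<Rightarrow> 4 \<Rightarrow> 'a \<Rightarrow> 'a \<Rightarrow> 'a \<Rightarrow> 'a^pidx" where
  "pair_pt i j k l a b c = (\<chi> e. if e = edge i j then a else if e = edge k l then b else c)"

lemma pair_pt_edge:
  assumes "distinct [i, j, k, l]"
  shows "pair_pt i j k l a b c $ edge i j = a" "pair_pt i j k l a b c $ edge k l = b"
    "pair_pt i j k l a b c $ edge i k = c" "pair_pt i j k l a b c $ edge i l = c"
    "pair_pt i j k l a b c $ edge j k = c" "pair_pt i j k l a b c $ edge j l = c"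
  using distinct_edges[OF assms] by (auto simp: pair_pt_def)

text \<open>Chosen so that u_j - u_i = \<open>A\<close>, u_l - u_k = \<open>B\<close> and u_k - u_i
  = \<open>C\<close>. When \<open>C\<close> has the smallest valuation, it dictates the valuation of
  all four differences across the two pairs.\<close>

definition pair_vec :: "4 \<Rightarrow> 4 \<Rightarrow> 4 \<Rightarrow> 'a::Fields.field \<Rightarrow> 'a \<Rightarrow> 'a \<Rightarrow> 'a^4" where
  "pair_vec j k l A B C = (\<chi> x. if x = j then A else if x = k then C else if x = l then C + B else 0)"

lemma pair_vec_nth:
  assumes "distinct [i, j, k, l]"
  shows "pair_vec j k l A B C $ i = 0" "pair_vec j k l A B C $ j = A"
    "pair_vec j k l A B C $ k = C" "pair_vec j k l A B C $ l = C + B"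
  using assms by (auto simp: pair_vec_def)

lemma vec_distinct_four:
  assumes "distinct [i, j, k, l :: 4]" "u $ i \<noteq> u $ j" "u $ i \<noteq> u $ k" "u $ i \<noteq> u $ l"
    "u $ j \<noteq> u $ k" "u $ j \<noteq> u $ l" "u $ k \<noteq> u $ l" "x \<noteq> y"
  shows "u $ x \<noteq> u $ y"
  using distinct_four_exhaust[OF assms(1), of x] distinct_four_exhaust[OF assms(1), of y] assms(8)
  by (elim disjE) (simp_all add: assms(2-7) assms(2-7)[symmetric])

lemma pair_vec_differences:
  fixes A B C :: "'k::valued_field"
  assumes "A \<noteq> 0" "B \<noteq> 0" "C \<noteq> 0" "val C < val A" "val C < val B"
  shows "C + B \<noteq> 0" "val (C + B) = val C" "C - A \<noteq> 0" "val (C - A) = val C"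
    "C + B - A \<noteq> 0" "val (C + B - A) = val C"
proof -
  show CB: "C + B \<noteq> 0" "val (C + B) = val C"
    using val_add_dominated[OF assms(3), of B] assms by auto
  show "C - A \<noteq> 0" "val (C - A) = val C"
    using val_add_dominated[OF assms(3), of "- A"] assms by auto
  show "C + B - A \<noteq> 0" "val (C + B - A) = val C"
    using val_add_dominated[OF CB(1), of "- A"] assms CB by auto
qed

lemma delta_pair_vec:
  fixes A B C :: "'k::valued_field"
  assumes d: "distinct [i, j, k, l]"
    and ABC: "A \<noteq> 0" "B \<noteq> 0" "C \<noteq> 0" "val C < val A" "val C < val B"
  shows "delta (pair_vec j k l A B C) \<in> torus"
    and "(\<chi> e. val (delta (pair_vec j k l A B C) $ e)) = pair_pt i j k l (val A) (val B) (val C)"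
proof -
  note diffs = pair_vec_differences[OF ABC]
  have ne: "C \<noteq> A" "C + B \<noteq> A" using diffs by auto
  show "delta (pair_vec j k l A B C) \<in> torus"
    unfolding delta_torus
    by (intro allI impI, rule vec_distinct_four[OF d])
      (use ABC diffs ne in \<open>auto simp: pair_vec_nth[OF d]\<close>)
  show "(\<chi> e. val (delta (pair_vec j k l A B C) $ e)) = pair_pt i j k l (val A) (val B) (val C)"
    by (rule vec_pidx_eqI[OF d])
      (use d ABC diffs ne in \<open>auto simp: pair_pt_edge[OF d] delta_edge pair_vec_nth[OF d] val_mult\<close>)
qed

lemma pair_pt_in_trop_lines:
  assumes d: "distinct [i, j, k, l]" and "a \<in> value_group TYPE('k::valued_field)"
    "b \<in> value_group TYPE('k)" "c \<in> value_group TYPE('k)" "c < a" "c < b"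
  obtains A B C :: "'k::valued_field" where "A \<noteq> 0" "B \<noteq> 0" "C \<noteq> 0" "val C < val A" "val C < val B"
    "a = val A" "b = val B" "c = val C"
    "pair_pt i j k l a b c \<in> trop_set (torus_ideal (lines_through_unit_point :: ('k^pidx) set))"
proof -
  obtain A B C :: 'k where ABC: "A \<noteq> 0" "B \<noteq> 0" "C \<noteq> 0" "a = val A" "b = val B" "c = val C"
    using assms(2-4) by (auto simp: value_group_def)
  have v: "val C < val A" "val C < val B" using ABC assms by auto
  note del = delta_pair_vec[OF d ABC(1-3) v]
  have "(\<chi> e. val (delta (pair_vec j k l A B C) $ e))
      \<in> trop_set (torus_ideal (lines_through_unit_point :: ('k^pidx) set))"
    by (rule val_root_in_trop_set[OF delta_in_lines_through_unit_point]) (rule del)+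
  then have "pair_pt i j k l a b c \<in> trop_set (torus_ideal (lines_through_unit_point :: ('k^pidx) set))"
    unfolding del(2) using ABC by simp
  with ABC v that show thesis by blast
qed


subsection \<open>The multiplicity of the cones spanned by two opposite edges\<close>

lemma laurent_twist_lookup:
  "Poly_Mapping.lookup (laurent_twist t f) m = Poly_Mapping.lookup f m * laurent_monom t m"
  by (simp add: laurent_twist_def mapp.rep_eq when_def in_keys_iff)

text \<open>Evaluating \<open>f\<close> at the product of \<open>t\<close> and \<open>q\<close> is
  evaluating the twisted polynomial at \<open>q\<close>. Its coefficients are integral and
  \<open>q\<close> consists of units, so reduction commutes with every operation.\<close>

lemma red_laurent_eval:
  fixes f :: "('n::finite, 'a::valued_field) laurent"
  assumes t: "t \<in> torus" and q: "\<And>e. q $ e \<noteq> 0" "\<And>e. val (q $ e) = 0"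
    and p: "\<And>e. p $ e = t $ e * q $ e"
    and f: "\<And>m. Poly_Mapping.lookup (laurent_twist t f) m \<in> val_ring"
  shows "red (laurent_eval f p) =
    laurent_eval (Poly_Mapping.map red (laurent_twist t f)) (\<chi> e. red (q $ e))"
proof -
  let ?g = "laurent_twist t f"
  have q': "laurent_monom q m \<in> val_ring" "red (laurent_monom q m) = laurent_monom (\<chi> e. red (q $ e)) m" for m
    unfolding laurent_monom_def using val_ring_powi[OF q(1) q(2)]
    by (simp_all add: val_ring_prod red_prod)
  have pm: "laurent_monom p m = laurent_monom t m * laurent_monom q m" for m
    unfolding laurent_monom_def by (simp add: p power_int_mult_distrib prod.distrib)
  have keys: "Poly_Mapping.keys (Poly_Mapping.map red ?g) \<subseteq> Poly_Mapping.keys f"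
    by (auto simp: in_keys_iff map.rep_eq laurent_twist_lookup when_def split: if_splits)
  have lk: "Poly_Mapping.lookup (Poly_Mapping.map red ?g) m = red (Poly_Mapping.lookup ?g m)" for m
    by (simp add: map.rep_eq when_def)
  have "laurent_eval f p = (\<Sum>m\<in>Poly_Mapping.keys f. Poly_Mapping.lookup ?g m * laurent_monom q m)"
    unfolding laurent_eval_def laurent_twist_lookup pm by (simp add: mult.assoc)
  then have "red (laurent_eval f p) =
      (\<Sum>m\<in>Poly_Mapping.keys f. red (Poly_Mapping.lookup ?g m) * laurent_monom (\<chi> e. red (q $ e)) m)"
    using f q' by (simp add: red_sum red_mult val_ring_mult)
  then show ?thesis unfolding laurent_eval_superset[OF finite_keys keys] lk .
qed

lemma laurent_monom_pair_pt:
  fixes a b c :: "'k::Fields.field"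
  assumes d: "distinct [i, j, k, l]" and "c \<noteq> 0"
  shows "laurent_monom (pair_pt i j k l a b c) m = a powi (m $ edge i j) * b powi (m $ edge k l) *
    c powi (m $ edge i k + m $ edge i l + m $ edge j k + m $ edge j l)"
  unfolding laurent_monom_def prod_pidx[OF d] pair_pt_edge[OF d]
  using assms(2) by (simp add: power_int_add mult.assoc)

text \<open>Monomials are units, so a difference of two variables in \<open>Q\<close> yields a
  monomial congruent to 1, and the exponents of such monomials form a group.\<close>

lemma primeideal_binomials:
  fixes Q :: "('n::finite, 'k::Fields.field) laurent set"
  assumes Q: "primeideal Q ring_of_type_algebra"
  shows "Poly_Mapping.single (axis e 1) 1 - Poly_Mapping.single (axis e' 1) 1 \<in> Q \<Longrightarrow>
      Poly_Mapping.single (n *s (axis e 1 - axis e' 1)) 1 - 1 \<in> Q"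
    and "Poly_Mapping.single m 1 - 1 \<in> Q \<Longrightarrow> Poly_Mapping.single m' 1 - 1 \<in> Q \<Longrightarrow>
      Poly_Mapping.single (m + m') 1 - 1 \<in> Q"
proof -
  note QD = primeidealD[OF Q]
  let ?s = "\<lambda>m. Poly_Mapping.single m (1::'k)"
  show add: "?s (m + m') - 1 \<in> Q" if "?s m - 1 \<in> Q" "?s m' - 1 \<in> Q" for m m'
  proof -
    have "?s (m + m') = ?s m * ?s m'" by (simp add: mult_single)
    then have e: "?s (m + m') - 1 = ?s m * (?s m' - 1) + (?s m - 1)" by (simp add: algebra_simps)
    show ?thesis unfolding e by (intro QD(2) QD(3) that)
  qed
  have neg: "?s (- m) - 1 \<in> Q" if "?s m - 1 \<in> Q" for m
  proof -
    have "?s (- m) * ?s m = 1" by (simp add: mult_single)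
    then have e: "?s (- m) - 1 = (- ?s (- m)) * (?s m - 1)" by (simp add: algebra_simps)
    show ?thesis unfolding e by (intro QD(3) that)
  qed
  show "?s (n *s (axis e 1 - axis e' 1)) - 1 \<in> Q" if "?s (axis e 1) - ?s (axis e' 1) \<in> Q"
  proof -
    let ?v = "axis e 1 - axis e' 1 :: int^'n"
    have "?s (- axis e' 1) * (?s (axis e 1) - ?s (axis e' 1)) = ?s ?v - 1"
      by (simp add: right_diff_distrib mult_single)
    then have v: "?s ?v - 1 \<in> Q" using QD(3)[OF that] by metis
    have pos: "?s (int n *s ?v) - 1 \<in> Q" for n
    proof (induction n)
      case 0
      have "int 0 *s ?v = 0" by (simp add: vec_eq_iff)
      then show ?case using QD(1) by simp
    next
      case (Suc n)
      have e: "int (Suc n) *s ?v = int n *s ?v + ?v" by (simp add: vec_eq_iff algebra_simps)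
      show ?case unfolding e by (rule add[OF Suc v])
    qed
    show ?thesis
    proof (cases "n \<ge> 0")
      case True
      then show ?thesis using pos[of "nat n"] by simp
    next
      case False
      then have e: "n *s ?v = - (int (nat (- n)) *s ?v)" by (simp add: vec_eq_iff)
      show ?thesis unfolding e by (rule neg[OF pos])
    qed
  qed
qed

text \<open>The vanishing ideal of the subtorus parametrized by \<open>pair_pt\<close>; it is to be
  the unique minimal prime over the initial ideal on the cone.\<close>

definition pair_prime :: "4 \<Rightarrow> 4 \<Rightarrow> 4 \<Rightarrow> 4 \<Rightarrow> (pidx, 'k::Fields.field) laurent set" where
  "pair_prime i j k l = {g. \<forall>a b c. a \<noteq> 0 \<longrightarrow> b \<noteq> 0 \<longrightarrow> c \<noteq> 0 \<longrightarrow> laurent_eval g (pair_pt i j k l a b c) = 0}"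

lemma laurent_eval_pair_pt:
  assumes "distinct [i, j, k, l]" "c \<noteq> 0"
  shows "laurent_eval g (pair_pt i j k l a b c) = (\<Sum>m\<in>Poly_Mapping.keys g. Poly_Mapping.lookup g m *
    a powi (m $ edge i j) * b powi (m $ edge k l) *
    c powi (m $ edge i k + m $ edge i l + m $ edge j k + m $ edge j l))"
  unfolding laurent_eval_def laurent_monom_pair_pt[OF assms] by (simp add: mult.assoc)

lemma pair_pt_torus: "a \<noteq> 0 \<Longrightarrow> b \<noteq> 0 \<Longrightarrow> c \<noteq> 0 \<Longrightarrow> pair_pt i j k l a b c \<in> torus"
  by (simp add: torus_def pair_pt_def)

text \<open>Two Laurent polynomials that are each nonzero somewhere on the subtorus are nonzero at a
  common point: the parameters are replaced one at a time, each time avoiding finitely many zeros of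
  two one-variable polynomials in an infinite field.\<close>

lemma primeideal_pair_prime:
  assumes d: "distinct [i, j, k, l]" and inf: "infinite (UNIV :: 'k::Fields.field set)"
  shows "primeideal (pair_prime i j k l :: (pidx, 'k) laurent set) ring_of_type_algebra"
proof (rule primeideal_type_algebraI)
  let ?J = "pair_prime i j k l :: (pidx, 'k) laurent set"
  let ?p = "pair_pt i j k l"
  show "0 \<in> ?J" by (simp add: pair_prime_def)
  show "x + y \<in> ?J" if "x \<in> ?J" "y \<in> ?J" for x y
    using that by (simp add: pair_prime_def laurent_eval_add)
  show "r * x \<in> ?J" if "x \<in> ?J" for x r
    using that by (simp add: pair_prime_def laurent_eval_mult pair_pt_torus)
  have "laurent_eval 1 (?p 1 1 (1::'k)) = 1"
    using laurent_eval_single[of 0 "1::'k" "?p 1 1 1"] by (simp add: laurent_monom_def)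
  then have ne: "laurent_eval 1 (?p 1 1 (1::'k)) \<noteq> 0" by simp
  show "1 \<notin> ?J"
  proof
    assume h: "1 \<in> ?J"
    have "laurent_eval 1 (?p 1 1 (1::'k)) = 0"
      by (rule h[unfolded pair_prime_def mem_Collect_eq, rule_format]) simp_all
    with ne show False ..
  qed
  show "f \<in> ?J \<or> g \<in> ?J" if fg: "f * g \<in> ?J" for f g
  proof (rule ccontr)
    assume "\<not> (f \<in> ?J \<or> g \<in> ?J)"
    then obtain a1 b1 c1 a2 b2 c2 where
      nz: "a1 \<noteq> 0" "b1 \<noteq> 0" "c1 \<noteq> 0" "a2 \<noteq> 0" "b2 \<noteq> 0" "c2 \<noteq> 0" and
      f: "laurent_eval f (?p a1 b1 c1) \<noteq> 0" and g: "laurent_eval g (?p a2 b2 c2) \<noteq> 0"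
      unfolding pair_prime_def by (simp only: mem_Collect_eq not_all not_imp de_Morgan_disj) (elim exE conjE, rule that)
    have finA: "finite {a. a \<noteq> 0 \<and> laurent_eval h (?p a b c) = 0}"
      if "laurent_eval h (?p a0 b c) \<noteq> 0" "a0 \<noteq> 0" "c \<noteq> 0" for h :: "(pidx, 'k) laurent" and a0 b c
    proof -
      let ?c = "\<lambda>m. Poly_Mapping.lookup h m * b powi (m $ edge k l) *
        c powi (m $ edge i k + m $ edge i l + m $ edge j k + m $ edge j l)"
      have "laurent_eval h (?p a b c) = (\<Sum>m\<in>Poly_Mapping.keys h. ?c m * a powi (m $ edge i j))" for a
        unfolding laurent_eval_pair_pt[OF d that(3)] by (intro sum.cong) (simp_all add: mult_ac)
      then show ?thesis using laurent_univariate_finite_zeros[OF finite_keys that(2), of ?c "\<lambda>m. m $ edge i j" h] that(1)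
        by simp
    qed
    have finB: "finite {b. b \<noteq> 0 \<and> laurent_eval h (?p a b c) = 0}"
      if "laurent_eval h (?p a b0 c) \<noteq> 0" "b0 \<noteq> 0" "c \<noteq> 0" for h :: "(pidx, 'k) laurent" and a b0 c
    proof -
      let ?c = "\<lambda>m. Poly_Mapping.lookup h m * a powi (m $ edge i j) *
        c powi (m $ edge i k + m $ edge i l + m $ edge j k + m $ edge j l)"
      have "laurent_eval h (?p a b c) = (\<Sum>m\<in>Poly_Mapping.keys h. ?c m * b powi (m $ edge k l))" for b
        unfolding laurent_eval_pair_pt[OF d that(3)] by (intro sum.cong) (simp_all add: mult_ac)
      then show ?thesis using laurent_univariate_finite_zeros[OF finite_keys that(2), of ?c "\<lambda>m. m $ edge k l" h] that(1)
        by simp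
    qed
    have finC: "finite {c. c \<noteq> 0 \<and> laurent_eval h (?p a b c) = 0}"
      if "laurent_eval h (?p a b c0) \<noteq> 0" "c0 \<noteq> 0" for h :: "(pidx, 'k) laurent" and a b c0
    proof -
      let ?c = "\<lambda>m. Poly_Mapping.lookup h m * a powi (m $ edge i j) * b powi (m $ edge k l)"
      let ?e = "\<lambda>m. m $ edge i k + m $ edge i l + m $ edge j k + m $ edge j l"
      have "laurent_eval h (?p a b c) = (\<Sum>m\<in>Poly_Mapping.keys h. ?c m * c powi (?e m))" if "c \<noteq> 0" for c
        unfolding laurent_eval_pair_pt[OF d that] by (intro sum.cong) (simp_all add: mult_ac)
      then have e: "laurent_eval h (?p a b c0) = (\<Sum>m\<in>Poly_Mapping.keys h. ?c m * c0 powi (?e m))"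
        "{c. c \<noteq> 0 \<and> laurent_eval h (?p a b c) = 0} =
          {c. c \<noteq> 0 \<and> (\<Sum>m\<in>Poly_Mapping.keys h. ?c m * c powi (?e m)) = 0}"
        using that(2) by auto
      show ?thesis
        unfolding e(2) by (rule laurent_univariate_finite_zeros[OF finite_keys that(2)])
          (use that(1) e(1) in simp)
    qed
    have "finite ({0} \<union> {a. a \<noteq> 0 \<and> laurent_eval f (?p a b1 c1) = 0} \<union>
        {a. a \<noteq> 0 \<and> laurent_eval g (?p a b2 c2) = 0})"
      using finA[OF f nz(1,3)] finA[OF g nz(4,6)] by simp
    from ex_new_if_finite[OF inf this] obtain a where "a \<notin> {0} \<union> {a. a \<noteq> 0 \<and> laurent_eval f (?p a b1 c1) = 0} \<union>
        {a. a \<noteq> 0 \<and> laurent_eval g (?p a b2 c2) = 0}" by (rule exE)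
    then have a: "a \<noteq> 0" "laurent_eval f (?p a b1 c1) \<noteq> 0" "laurent_eval g (?p a b2 c2) \<noteq> 0" by auto
    have "finite ({0} \<union> {b. b \<noteq> 0 \<and> laurent_eval f (?p a b c1) = 0} \<union>
        {b. b \<noteq> 0 \<and> laurent_eval g (?p a b c2) = 0})"
      using finB[OF a(2) nz(2,3)] finB[OF a(3) nz(5,6)] by simp
    from ex_new_if_finite[OF inf this] obtain b where "b \<notin> {0} \<union> {b. b \<noteq> 0 \<and> laurent_eval f (?p a b c1) = 0} \<union>
        {b. b \<noteq> 0 \<and> laurent_eval g (?p a b c2) = 0}" by (rule exE)
    then have b: "b \<noteq> 0" "laurent_eval f (?p a b c1) \<noteq> 0" "laurent_eval g (?p a b c2) \<noteq> 0" by auto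
    have "finite ({0} \<union> {c. c \<noteq> 0 \<and> laurent_eval f (?p a b c) = 0} \<union>
        {c. c \<noteq> 0 \<and> laurent_eval g (?p a b c) = 0})"
      using finC[OF b(2) nz(3)] finC[OF b(3) nz(6)] by simp
    from ex_new_if_finite[OF inf this] obtain c where "c \<notin> {0} \<union> {c. c \<noteq> 0 \<and> laurent_eval f (?p a b c) = 0} \<union>
        {c. c \<noteq> 0 \<and> laurent_eval g (?p a b c) = 0}" by (rule exE)
    then have c: "c \<noteq> 0" "laurent_eval f (?p a b c) \<noteq> 0" "laurent_eval g (?p a b c) \<noteq> 0" by auto
    have "laurent_eval (f * g) (?p a b c) = 0" using fg a(1) b(1) c(1) by (simp add: pair_prime_def)
    then show False using c a(1) b(1) by (simp add: laurent_eval_mult pair_pt_torus)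
  qed
qed

text \<open>On the subtorus a monomial depends on three combined exponents only. Comparing
  coefficients in the three parameters in turn shows that the coefficients of monomials with equal
  restriction sum to 0.\<close>

lemma pair_prime_fibre_sum:
  fixes g :: "(pidx, 'k::Fields.field) laurent"
  assumes d: "distinct [i, j, k, l]" and inf: "infinite (UNIV :: 'k set)" and g: "g \<in> pair_prime i j k l"
  shows "(\<Sum>m | m \<in> Poly_Mapping.keys g \<and> m $ edge i j = n1 \<and> m $ edge k l = n2 \<and>
    m $ edge i k + m $ edge i l + m $ edge j k + m $ edge j l = n3. Poly_Mapping.lookup g m) = 0"
proof -
  let ?e = "\<lambda>m. m $ edge i k + m $ edge i l + m $ edge j k + m $ edge j l"
  let ?F = "Poly_Mapping.keys g"
  let ?F1 = "{m \<in> ?F. m $ edge i j = n1}"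
  let ?F2 = "{m \<in> ?F1. m $ edge k l = n2}"
  have 1: "(\<Sum>m\<in>?F1. Poly_Mapping.lookup g m * b powi (m $ edge k l) * c powi (?e m)) = 0"
    if "b \<noteq> 0" "c \<noteq> 0" for b c
  proof (rule laurent_univariate_coeffs_zero[OF finite_keys inf, where p = "\<lambda>m. m $ edge i j"])
    fix a :: 'k assume "a \<noteq> 0"
    then have "laurent_eval g (pair_pt i j k l a b c) = 0" using g that by (simp add: pair_prime_def)
    then show "(\<Sum>m\<in>?F. Poly_Mapping.lookup g m * b powi (m $ edge k l) * c powi (?e m) * a powi (m $ edge i j)) = 0"
      unfolding laurent_eval_pair_pt[OF d that(2)] by (simp add: mult_ac)
  qed
  have 2: "(\<Sum>m\<in>?F2. Poly_Mapping.lookup g m * c powi (?e m)) = 0" if "c \<noteq> 0" for c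
  proof (rule laurent_univariate_coeffs_zero[OF _ inf, where p = "\<lambda>m. m $ edge k l"])
    fix b :: 'k assume "b \<noteq> 0"
    then show "(\<Sum>m\<in>?F1. Poly_Mapping.lookup g m * c powi (?e m) * b powi (m $ edge k l)) = 0"
      using 1[OF \<open>b \<noteq> 0\<close> that] by (simp add: mult_ac)
  qed simp
  have "(\<Sum>m | m \<in> ?F2 \<and> ?e m = n3. Poly_Mapping.lookup g m) = 0"
    by (rule laurent_univariate_coeffs_zero[OF _ inf]) (use 2 in auto)
  moreover have "{m. m \<in> ?F2 \<and> ?e m = n3} = {m. m \<in> ?F \<and> m $ edge i j = n1 \<and> m $ edge k l = n2 \<and> ?e m = n3}"
    by auto
  ultimately show ?thesis by simp
qed

text \<open>Modulo \<open>Q\<close> every monomial may be replaced by \<open>r m\<close>, where the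
  exponents of the four remaining edges are collected at ik. The replaced terms of \<open>g\<close>
  cancel by the fibre sums, so \<open>g\<close> is a combination of differences that lie in
  \<open>Q\<close>.\<close>

lemma pair_prime_subset_prime:
  fixes Q :: "(pidx, 'k::Fields.field) laurent set"
  assumes d: "distinct [i, j, k, l]" and inf: "infinite (UNIV :: 'k set)"
    and Q: "primeideal Q ring_of_type_algebra"
    and bin: "\<And>e. e \<in> {edge i l, edge j k, edge j l} \<Longrightarrow>
      Poly_Mapping.single (axis e 1) 1 - Poly_Mapping.single (axis (edge i k) 1) 1 \<in> Q"
  shows "pair_prime i j k l \<subseteq> Q"
proof
  fix g :: "(pidx, 'k) laurent" assume g: "g \<in> pair_prime i j k l"
  note QD = primeidealD[OF Q]
  let ?s = "\<lambda>m. Poly_Mapping.single m (1::'k)"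
  let ?e = "\<lambda>m::int^pidx. m $ edge i k + m $ edge i l + m $ edge j k + m $ edge j l"
  define r :: "int^pidx \<Rightarrow> int^pidx" where
    "r m = (\<chi> x. if x = edge i j then m $ edge i j else if x = edge k l then m $ edge k l
      else if x = edge i k then ?e m else 0)" for m
  have ne: "distinct [edge i j, edge k l, edge i k, edge i l, edge j k, edge j l]" by (rule distinct_edges[OF d])
  have rn: "r m $ edge i j = m $ edge i j" "r m $ edge k l = m $ edge k l" "r m $ edge i k = ?e m" for m
    using ne by (auto simp: r_def)
  have r_eq: "r m = r m' \<longleftrightarrow> m $ edge i j = m' $ edge i j \<and> m $ edge k l = m' $ edge k l \<and> ?e m = ?e m'" for m m'
  proof
    assume "r m = r m'"
    then show "m $ edge i j = m' $ edge i j \<and> m $ edge k l = m' $ edge k l \<and> ?e m = ?e m'"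
      using rn[of m] rn[of m'] by simp
  qed (auto simp: r_def vec_eq_iff)
  let ?v = "\<lambda>e. axis e 1 - axis (edge i k) 1 :: int^pidx"
  have dec: "m = r m + (m $ edge i l *s ?v (edge i l) + m $ edge j k *s ?v (edge j k) + m $ edge j l *s ?v (edge j l))" for m
    by (rule vec_pidx_eqI[OF d]) (use ne in \<open>auto simp: r_def axis_def\<close>)
  have mono: "?s m - ?s (r m) \<in> Q" for m
  proof -
    let ?w = "m $ edge i l *s ?v (edge i l) + m $ edge j k *s ?v (edge j k) + m $ edge j l *s ?v (edge j l)"
    have "?s ?w - 1 \<in> Q"
      by (intro primeideal_binomials[OF Q] bin) auto
    moreover have "?s m = ?s (r m) * ?s ?w" using dec[of m] mult_single[of "r m" 1 ?w "1::'k"] by simp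
    then have "?s m - ?s (r m) = ?s (r m) * (?s ?w - 1)" by (simp only: right_diff_distrib mult_1_right)
    ultimately show ?thesis using QD(3) by metis
  qed
  have zero: "(\<Sum>m\<in>Poly_Mapping.keys g. Poly_Mapping.single (r m) (Poly_Mapping.lookup g m)) = 0"
  proof (rule poly_mapping_eqI)
    fix n
    have "Poly_Mapping.lookup (\<Sum>m\<in>Poly_Mapping.keys g. Poly_Mapping.single (r m) (Poly_Mapping.lookup g m)) n
        = (\<Sum>m\<in>Poly_Mapping.keys g. if r m = n then Poly_Mapping.lookup g m else 0)"
      unfolding lookup_sum by (intro sum.cong) (auto simp: lookup_single when_def)
    also have "\<dots> = (\<Sum>m | m \<in> Poly_Mapping.keys g \<and> r m = n. Poly_Mapping.lookup g m)"
      by (simp add: sum.inter_filter)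
    also have "\<dots> = 0"
    proof (cases "\<exists>m0. r m0 = n")
      case True
      then obtain m0 where "n = r m0" by blast
      show ?thesis unfolding \<open>n = r m0\<close> r_eq by (rule pair_prime_fibre_sum[OF d inf g])
    next
      case False
      then have "{m. m \<in> Poly_Mapping.keys g \<and> r m = n} = {}" by blast
      then show ?thesis by (simp only: sum.empty)
    qed
    finally show "Poly_Mapping.lookup (\<Sum>m\<in>Poly_Mapping.keys g.
        Poly_Mapping.single (r m) (Poly_Mapping.lookup g m)) n = Poly_Mapping.lookup 0 n" by simp
  qed
  have "g = (\<Sum>m\<in>Poly_Mapping.keys g. Poly_Mapping.single m (Poly_Mapping.lookup g m)) -
      (\<Sum>m\<in>Poly_Mapping.keys g. Poly_Mapping.single (r m) (Poly_Mapping.lookup g m))"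
    unfolding zero poly_mapping_sum_single by simp
  also have "\<dots> = (\<Sum>m\<in>Poly_Mapping.keys g. Poly_Mapping.single 0 (Poly_Mapping.lookup g m) * (?s m - ?s (r m)))"
    by (simp add: sum_subtractf right_diff_distrib mult_single)
  finally have eq: "g = (\<Sum>m\<in>Poly_Mapping.keys g. Poly_Mapping.single 0 (Poly_Mapping.lookup g m) * (?s m - ?s (r m)))" .
  have mem: "(\<Sum>m\<in>M. Poly_Mapping.single 0 (Poly_Mapping.lookup g m) * (?s m - ?s (r m))) \<in> Q" if "finite M" for M
    using that by (induction M rule: finite_induct) (use QD(1-3) mono in auto)
  show "g \<in> Q" by (subst eq) (rule mem[OF finite_keys])
qed

lemma red_unit:
  assumes "(r :: 'a::valued_field residue) \<noteq> 0"
  shows "\<exists>x. x \<noteq> 0 \<and> val x = 0 \<and> red x = r"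
proof -
  obtain x :: 'a where x: "x \<in> val_ring" "red x = r" using red_surj by blast
  then have "x \<notin> val_max_ideal" using assms red_eq_0_iff by metis
  then have "x \<noteq> 0" "val x = 0" using x(1) by (auto simp: val_ring_def val_max_ideal_def)
  with x show ?thesis by blast
qed

text \<open>\<open>C\<close> sets the scale: replacing \<open>x\<close> by \<open>z * y\<close>
  makes an error that is small relative to \<open>C\<close>, and \<open>y\<close> has the size of
  \<open>C\<close>.\<close>

lemma red_quotient:
  fixes x y z C :: "'a::valued_field"
  assumes "y \<noteq> 0" "C \<noteq> 0" "val y = val C" "z \<in> val_ring" "(x - z * y) / C \<in> val_max_ideal"
  shows "red (x / y) = red z"
proof -
  have "val (C / y) = 0"
    using val_mult[of C "inverse y"] val_inverse[of y] assms by (simp add: divide_inverse)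
  then have "C / y \<in> val_ring" by (simp add: val_ring_def)
  then have e: "(x - z * y) / C * (C / y) \<in> val_max_ideal" by (rule val_max_ideal_mult[OF assms(5)])
  then have r: "(x - z * y) / C * (C / y) \<in> val_ring" using val_max_ideal_subset by blast
  have "x / y = z + (x - z * y) / C * (C / y)" using assms(1,2) by (simp add: field_simps)
  then have "red (x / y) = red z + red ((x - z * y) / C * (C / y))"
    using red_add[OF assms(4) r] by simp
  also have "red ((x - z * y) / C * (C / y)) = 0" using red_eq_0_iff[OF r] e by simp
  finally show ?thesis by simp
qed

text \<open>Dividing the relation of a triangle by \<open>D\<close> and twisting turns its
  coefficients into differences of \<open>u\<close> over \<open>D\<close>. For a \<open>D\<close> of
  the size of the largest difference, the initial form is then obtained by plain reduction.\<close>

lemma init_ideal_triangle: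
  fixes u :: "'k::valued_field^4"
  assumes d: "distinct [x, y, z]" and r: "(u $ y - u $ x) / D \<in> val_ring"
    "(u $ z - u $ y) / D \<in> val_ring" "(u $ x - u $ z) / D \<in> val_ring"
  shows "Poly_Mapping.single (axis (edge x y) 1) (red ((u $ y - u $ x) / D))
      + Poly_Mapping.single (axis (edge y z) 1) (red ((u $ z - u $ y) / D))
      + Poly_Mapping.single (axis (edge z x) 1) (red ((u $ x - u $ z) / D))
    \<in> init_ideal (delta u) (torus_ideal lines_through_unit_point)"
proof -
  let ?f = "triangle_poly (1 / D) x y z"
  have ne: "edge x y \<noteq> edge y z" "edge y z \<noteq> edge z x" "edge z x \<noteq> edge x y" "x \<noteq> y" "y \<noteq> z" "z \<noteq> x"
    using d by (auto simp: edge_eq_iff)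
  have lk: "Poly_Mapping.lookup (laurent_twist (delta u) ?f) m =
     (if m = axis (edge x y) 1 then (u $ y - u $ x) / D
      else if m = axis (edge y z) 1 then (u $ z - u $ y) / D
      else if m = axis (edge z x) 1 then (u $ x - u $ z) / D else 0)" for m
    using ne by (auto simp: laurent_twist_lookup triangle_poly_lookup[OF d] axis_int_inject delta_edge mult.assoc)
  have "Poly_Mapping.map red (laurent_twist (delta u) ?f) =
      Poly_Mapping.single (axis (edge x y) 1) (red ((u $ y - u $ x) / D))
      + Poly_Mapping.single (axis (edge y z) 1) (red ((u $ z - u $ y) / D))
      + Poly_Mapping.single (axis (edge z x) 1) (red ((u $ x - u $ z) / D))"
    using ne by (intro poly_mapping_eqI)
      (auto simp: map.rep_eq lk lookup_add lookup_single when_def axis_int_inject)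
  moreover have "\<forall>m. Poly_Mapping.lookup (laurent_twist (delta u) ?f) m \<in> val_ring"
    unfolding lk using r by auto
  ultimately show ?thesis
    unfolding init_ideal_def using triangle_poly_in_ideal[OF d]
    by (intro CollectI exI[of _ ?f] conjI) simp_all
qed

text \<open>Every point of the subtorus over the residue field lifts to a line through the unit
  point, so initial forms vanish on the subtorus. Conversely the relations of three triangles reduce
  to the binomials that identify the four remaining coordinates.\<close>

lemma pair_cone_multiplicity:
  fixes A B C :: "'k::{alg_closed_field, valued_field}"
  assumes d: "distinct [i, j, k, l]"
    and ABC: "A \<noteq> 0" "B \<noteq> 0" "C \<noteq> 0" "val C < val A" "val C < val B"
  shows "ideal_mult (init_ideal (delta (pair_vec j k l A B C)) (torus_ideal lines_through_unit_point)) \<noteq> 0"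
proof (rule ideal_mult_unique_minimal_prime)
  let ?u = "pair_vec j k l A B C"
  let ?I = "torus_ideal lines_through_unit_point :: (pidx, 'k) laurent set"
  note diffs = pair_vec_differences[OF ABC]
  note del = delta_pair_vec[OF d ABC]
  have small: "A / C \<in> val_max_ideal" "B / C \<in> val_max_ideal"
    using ABC by (auto simp: val_max_ideal_def divide_inverse val_mult val_inverse)
  show "primeideal (pair_prime i j k l :: (pidx, 'k residue) laurent set) ring_of_type_algebra"
    by (rule primeideal_pair_prime[OF d infinite_residue])
  show "init_ideal (delta ?u) ?I \<subseteq> pair_prime i j k l"
  proof
    fix g assume "g \<in> init_ideal (delta ?u) ?I"
    then obtain f where g: "g = Poly_Mapping.map red (laurent_twist (delta ?u) f)" and f: "f \<in> ?I"
      and fr: "\<And>m. Poly_Mapping.lookup (laurent_twist (delta ?u) f) m \<in> val_ring"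
      unfolding init_ideal_def by blast
    show "g \<in> pair_prime i j k l"
      unfolding pair_prime_def
    proof (intro CollectI allI impI)
      fix a b c :: "'k residue" assume "a \<noteq> 0" "b \<noteq> 0" "c \<noteq> 0"
      then obtain a' b' c' where a': "a' \<noteq> 0" "val a' = 0" "red a' = a"
        and b': "b' \<noteq> 0" "val b' = 0" "red b' = b" and c': "c' \<noteq> 0" "val c' = 0" "red c' = c"
        using red_unit by metis
      \<comment> \<open>Multiplying \<open>A\<close>, \<open>B\<close>, \<open>C\<close> by units
        keeps all valuations; the coordinatewise quotient of the two Pluecker vectors reduces to the
        prescribed point of the subtorus.\<close>
      let ?v = "pair_vec j k l (A * a') (B * b') (C * c')"
      have ABC': "A * a' \<noteq> 0" "B * b' \<noteq> 0" "C * c' \<noteq> 0" "val (C * c') < val (A * a')" "val (C * c') < val (B * b')"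
        and v: "val (A * a') = val A" "val (B * b') = val B" "val (C * c') = val C"
        using ABC a' b' c' by (auto simp: val_mult)
      note del' = delta_pair_vec[OF d ABC']
      have nz: "delta ?u $ e \<noteq> 0" "delta ?v $ e \<noteq> 0" for e using del(1) del'(1) by (auto simp: torus_def)
      have "(\<chi> e. val (delta ?v $ e)) = (\<chi> e. val (delta ?u $ e))" unfolding del(2) del'(2) v ..
      then have veq: "val (delta ?v $ e) = val (delta ?u $ e)" for e by (simp add: vec_eq_iff)
      define q where "q = (\<chi> e. delta ?v $ e / delta ?u $ e)"
      have q: "q $ e \<noteq> 0" "val (q $ e) = 0" "delta ?v $ e = delta ?u $ e * q $ e" for e
        using nz[of e] veq[of e] by (auto simp: q_def divide_inverse val_mult val_inverse)
      have ring: "a' \<in> val_ring" "b' \<in> val_ring" "c' \<in> val_ring"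
        using a' b' c' by (auto simp: val_ring_def)
      have ring': "b' - c' \<in> val_ring" "a' - c' \<in> val_ring"
        using val_ring_add[OF ring(2) val_ring_uminus[OF ring(3)]]
          val_ring_add[OF ring(1) val_ring_uminus[OF ring(3)]] by auto
      have eb: "B / C * (b' - c') \<in> val_max_ideal" and ea: "A / C * (a' - c') \<in> val_max_ideal"
        using val_max_ideal_mult small ring' by blast+
      have eab: "B / C * (b' - c') + - (A / C * (a' - c')) \<in> val_max_ideal"
        by (intro val_max_ideal_add val_max_ideal_uminus eb ea)
      have qd: "q $ edge x y = (?v $ y - ?v $ x) / (?u $ y - ?u $ x)" if "x \<noteq> y" for x y
        using that by (simp add: q_def delta_edge)
      have "(\<chi> e. red (q $ e)) = pair_pt i j k l a b c"
      proof (rule vec_pidx_eqI[OF d]; unfold pair_pt_edge[OF d] vec_lambda_beta)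
        have ne: "i \<noteq> j" "i \<noteq> k" "i \<noteq> l" "j \<noteq> k" "j \<noteq> l" "k \<noteq> l" using d by auto
        show "red (q $ edge i j) = a" using qd[OF ne(1)] ABC a' by (simp add: pair_vec_nth[OF d])
        show "red (q $ edge k l) = b" using qd[OF ne(6)] ABC b' by (simp add: pair_vec_nth[OF d])
        show "red (q $ edge i k) = c" using qd[OF ne(2)] ABC c' by (simp add: pair_vec_nth[OF d])
        have "red ((C * c' + B * b') / (C + B)) = red c'"
        proof (rule red_quotient[OF diffs(1) ABC(3) diffs(2) ring(3)])
          have e: "(C * c' + B * b' - c' * (C + B)) / C = B / C * (b' - c')" using ABC by (simp add: field_simps)
          show "(C * c' + B * b' - c' * (C + B)) / C \<in> val_max_ideal" unfolding e by (rule eb)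
        qed
        then show "red (q $ edge i l) = c" using qd[OF ne(3)] c' by (simp add: pair_vec_nth[OF d])
        have "red ((C * c' - A * a') / (C - A)) = red c'"
        proof (rule red_quotient[OF diffs(3) ABC(3) diffs(4) ring(3)])
          have e: "(C * c' - A * a' - c' * (C - A)) / C = - (A / C * (a' - c'))" using ABC by (simp add: field_simps)
          show "(C * c' - A * a' - c' * (C - A)) / C \<in> val_max_ideal" unfolding e by (rule val_max_ideal_uminus[OF ea])
        qed
        then show "red (q $ edge j k) = c" using qd[OF ne(4)] c' by (simp add: pair_vec_nth[OF d])
        have "red ((C * c' + B * b' - A * a') / (C + B - A)) = red c'"
        proof (rule red_quotient[OF diffs(5) ABC(3) diffs(6) ring(3)])
          have e: "(C * c' + B * b' - A * a' - c' * (C + B - A)) / C = B / C * (b' - c') + - (A / C * (a' - c'))" using ABC by (simp add: field_simps)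
          show "(C * c' + B * b' - A * a' - c' * (C + B - A)) / C \<in> val_max_ideal" unfolding e by (rule eab)
        qed
        then show "red (q $ edge j l) = c" using qd[OF ne(5)] c' by (simp add: pair_vec_nth[OF d])
      qed
      then have "laurent_eval g (pair_pt i j k l a b c) = red (laurent_eval f (delta ?v))"
        unfolding g using red_laurent_eval[OF del(1) q(1,2) q(3) fr] by simp
      moreover have "laurent_eval f (delta ?v) = 0"
        using f delta_in_lines_through_unit_point[OF del'(1)] del'(1) by (auto simp: torus_ideal_def)
      ultimately show "laurent_eval g (pair_pt i j k l a b c) = 0" by simp
    qed
  qed
  show "pair_prime i j k l \<subseteq> Q" if Q: "primeideal Q ring_of_type_algebra" and sub: "init_ideal (delta ?u) ?I \<subseteq> Q"
    for Q :: "(pidx, 'k residue) laurent set"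
  proof (rule pair_prime_subset_prime[OF d infinite_residue Q])
    note QD = primeidealD[OF Q]
    let ?X = "\<lambda>e. Poly_Mapping.single (axis e (1::int)) (1 :: 'k residue)"
    have small': "A / C \<in> val_ring" "B / C \<in> val_ring" using small val_max_ideal_subset by blast+
    have redAB: "red (A / C) = 0" "red (B / C) = 0" "red (- A / C) = 0" "red (- B / C) = 0"
      using red_eq_0_iff small' small red_uminus[of "A / C"] red_uminus[of "B / C"] by auto
    have one: "red (- 1 :: 'k) = - 1" using red_uminus[of "1::'k"] by simp
    have CB: "(C + B) / C = 1 + B / C" "(C - A) / C = 1 + - (A / C)" "(A - C) / C = - 1 + A / C"
      "(- C - B) / C = - 1 + - (B / C)" "(A - (C + B)) / C = - 1 + (A / C + - (B / C))"
      using ABC by (auto simp: field_simps)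
    have rr: "1 \<in> (val_ring :: 'k set)" "- 1 \<in> (val_ring :: 'k set)" "- (A / C) \<in> val_ring" "- (B / C) \<in> val_ring"
      using small' val_ring_uminus[of "1::'k"] val_ring_uminus by auto
    have rs: "A / C + - (B / C) \<in> val_ring" using val_ring_add[OF small'(1) rr(4)] .
    have ring: "(C + B) / C \<in> val_ring" "(C - A) / C \<in> val_ring" "(A - C) / C \<in> val_ring"
      "(- C - B) / C \<in> val_ring" "(A - (C + B)) / C \<in> val_ring"
      unfolding CB by (intro val_ring_add rr small' rs)+
    have red: "red ((C - A) / C) = 1" "red ((- C - B) / C) = - 1" "red ((A - (C + B)) / C) = - 1"
      unfolding CB
      using red_add[OF rr(1) rr(3)] red_add[OF rr(2) rr(4)] red_add[OF rr(2) rs] red_add[OF small'(1) rr(4)]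
        redAB one by simp_all
    have ne: "distinct [i, k, l]" "distinct [j, k, l]" "distinct [i, j, k]" using d by auto
    have z: "(0::'k) - C = - C" "(- C - B) = 0 - (C + B)" by simp_all
    \<comment> \<open>After division by \<open>C\<close> the coefficient of the edge kl is in the
      maximal ideal, so the relation of the triangle ikl reduces to two terms. The same happens for
      jkl, and for ijk because of the edge ij.\<close>
    have b1: "?X (edge i k) - ?X (edge i l) \<in> Q"
    proof -
      have "Poly_Mapping.single (axis (edge i k) 1) (red ((?u $ k - ?u $ i) / C))
      + Poly_Mapping.single (axis (edge k l) 1) (red ((?u $ l - ?u $ k) / C))
      + Poly_Mapping.single (axis (edge l i) 1) (red ((?u $ i - ?u $ l) / C)) \<in> Q"
        by (rule subsetD[OF sub init_ideal_triangle[OF ne(1)]])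
          (use ring rr small' ABC in \<open>auto simp: pair_vec_nth[OF d]\<close>)
      then show ?thesis
        using redAB red ABC by (simp add: pair_vec_nth[OF d] edge_commute[of l i] single_uminus)
    qed
    have b2: "?X (edge j k) - ?X (edge j l) \<in> Q"
    proof -
      have "Poly_Mapping.single (axis (edge j k) 1) (red ((?u $ k - ?u $ j) / C))
      + Poly_Mapping.single (axis (edge k l) 1) (red ((?u $ l - ?u $ k) / C))
      + Poly_Mapping.single (axis (edge l j) 1) (red ((?u $ j - ?u $ l) / C)) \<in> Q"
        by (rule subsetD[OF sub init_ideal_triangle[OF ne(2)]])
          (use ring rr small' ABC in \<open>auto simp: pair_vec_nth[OF d]\<close>)
      then show ?thesis
        using redAB red ABC by (simp add: pair_vec_nth[OF d] edge_commute[of l j] single_uminus)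
    qed
    have b3: "?X (edge j k) - ?X (edge i k) \<in> Q"
    proof -
      have "Poly_Mapping.single (axis (edge i j) 1) (red ((?u $ j - ?u $ i) / C))
      + Poly_Mapping.single (axis (edge j k) 1) (red ((?u $ k - ?u $ j) / C))
      + Poly_Mapping.single (axis (edge k i) 1) (red ((?u $ i - ?u $ k) / C)) \<in> Q"
        by (rule subsetD[OF sub init_ideal_triangle[OF ne(3)]])
          (use ring rr small' ABC in \<open>auto simp: pair_vec_nth[OF d]\<close>)
      then show ?thesis
        using redAB red ABC one by (simp add: pair_vec_nth[OF d] edge_commute[of k i] single_uminus)
    qed
    have neg: "- x \<in> Q" if "x \<in> Q" for x using QD(3)[OF that, of "- 1"] by simp
    fix e assume "e \<in> {edge i l, edge j k, edge j l}"
    then consider "e = edge i l" | "e = edge j k" | "e = edge j l" by blast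
    then show "?X e - ?X (edge i k) \<in> Q"
    proof cases
      case 1
      then show ?thesis using neg[OF b1] by simp
    next
      case 2
      then show ?thesis using b3 by simp
    next
      case 3
      have "?X (edge j l) - ?X (edge i k) = - (?X (edge j k) - ?X (edge j l)) + (?X (edge j k) - ?X (edge i k))" by simp
      then show ?thesis using 3 QD(2)[OF neg[OF b2] b3] by simp
    qed
  qed
qed

subsection \<open>The tropicalization as the space of four-leaf trees\<close>

lemma linear_pair_pt: "linear (\<lambda>(a, b, c). pair_pt i j k l (a::real) b c)"
  by (rule linearI) (auto simp: pair_pt_def vec_eq_iff)

text \<open>Points of the linear span of the cone of a caterpillar tree: \<open>i\<close> and
  \<open>j\<close> are closest, \<open>k\<close> is attached to them, and \<open>l\<close> to all
  three.\<close>

definition star_pt :: "4 \<Rightarrow> 4 \<Rightarrow> 4 \<Rightarrow> 4 \<Rightarrow> real \<Rightarrow> real \<Rightarrow> real \<Rightarrow> real^pidx" where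
  "star_pt i j k l a b c = (\<chi> e. if e = edge i j then a else if e = edge i k \<or> e = edge j k then b else c)"

lemma linear_star_pt: "linear (\<lambda>(a, b, c). star_pt i j k l a b c)"
  by (rule linearI) (auto simp: star_pt_def vec_eq_iff)

text \<open>The three balanced and the twelve caterpillar rooted trees with four leaves. Only the
  equalities of their cones are kept, since the cones enter through their linear spans.\<close>

lemma four_trees:
  assumes "two_min ij jk ik" "two_min ij jl il" "two_min ik kl il" "two_min jk kl jl"
  shows "(ik = il \<and> ik = jk \<and> ik = jl) \<or> (ij = il \<and> ij = jk \<and> ij = kl) \<or> (ij = ik \<and> ij = jl \<and> ij = kl)
    \<or> (il = jl \<and> il = kl \<and> (ik = jk \<or> ij = ik \<or> ij = jk))
    \<or> (ik = jk \<and> ik = kl \<and> (il = jl \<or> ij = il \<or> ij = jl))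
    \<or> (ij = jk \<and> ij = jl \<and> (ik = il \<or> ik = kl \<or> il = kl))
    \<or> (ij = ik \<and> ij = il \<and> (jk = jl \<or> jk = kl \<or> jl = kl))"
  using assms unfolding two_min_def by (smt (verit))

definition pair_space :: "4 \<Rightarrow> 4 \<Rightarrow> 4 \<Rightarrow> 4 \<Rightarrow> (real^pidx) set" where
  "pair_space i j k l = range (\<lambda>(a, b, c). pair_pt i j k l a b c)"

definition tree_spaces :: "(real^pidx) set set" where
  "tree_spaces = (\<lambda>(i, j, k, l). pair_space i j k l) ` UNIV \<union>
     (\<lambda>(i, j, k, l). range (\<lambda>(a, b, c). star_pt i j k l a b c)) ` UNIV"

lemma finite_tree_spaces: "finite tree_spaces"
  unfolding tree_spaces_def by (intro finite_UnI finite_imageI finite)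

lemma linear_range_real3:
  fixes f :: "real \<times> real \<times> real \<Rightarrow> 'a::euclidean_space"
  assumes "linear f"
  shows "subspace (range f)" "dim (range f) \<le> 3"
proof -
  show "subspace (range f)" using assms subspace_UNIV by (rule linear_subspace_image)
  show "dim (range f) \<le> 3" using dim_image_le[OF assms, of UNIV] by simp
qed

lemma tree_spaces_subspace:
  assumes "L \<in> tree_spaces"
  shows "subspace L" "dim L \<le> 3"
  using assms linear_range_real3[OF linear_pair_pt] linear_range_real3[OF linear_star_pt]
  by (auto simp: tree_spaces_def pair_space_def)

lemma pair_mem:
  assumes d: "distinct [i, j, k, l]"
    and "x $ edge i k = x $ edge i l" "x $ edge i k = x $ edge j k" "x $ edge i k = x $ edge j l"
  shows "x \<in> \<Union>tree_spaces"
proof -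
  have "x = pair_pt i j k l (x $ edge i j) (x $ edge k l) (x $ edge i k)"
    by (rule vec_pidx_eqI[OF d]) (use assms in \<open>auto simp: pair_pt_edge[OF d]\<close>)
  then have "x \<in> pair_space i j k l"
    unfolding pair_space_def by (intro image_eqI[of _ _ "(x $ edge i j, x $ edge k l, x $ edge i k)"]) simp_all
  moreover have "pair_space i j k l \<in> tree_spaces" by (auto simp: tree_spaces_def)
  ultimately show ?thesis by blast
qed

lemma star_mem:
  assumes d: "distinct [i, j, k, l]"
    and "x $ edge i k = x $ edge j k" "x $ edge i l = x $ edge j l" "x $ edge i l = x $ edge k l"
  shows "x \<in> \<Union>tree_spaces"
proof -
  let ?f = "\<lambda>(a, b, c). star_pt i j k l a b c"
  have "x = star_pt i j k l (x $ edge i j) (x $ edge i k) (x $ edge i l)"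
    by (rule vec_pidx_eqI[OF d]) (use assms distinct_edges[OF d] in \<open>auto simp: star_pt_def\<close>)
  then have "x \<in> range ?f"
    by (intro image_eqI[of _ _ "(x $ edge i j, x $ edge i k, x $ edge i l)"]) simp_all
  moreover have "range ?f \<in> tree_spaces"
    unfolding tree_spaces_def by (intro UnI2 image_eqI[of _ _ "(i, j, k, l)"]) auto
  ultimately show ?thesis by blast
qed

lemma two_min_tree_spaces:
  assumes "\<And>i j k. distinct [i, j, k] \<Longrightarrow> two_min (x $ edge i j) (x $ edge j k) (x $ edge k i)"
  shows "x \<in> \<Union>tree_spaces"
proof -
  obtain i j k l :: 4 where d: "distinct [i, j, k, l]" using ex_distinct_four by blast
  note comm = edge_commute[of j i] edge_commute[of k i] edge_commute[of l i]
    edge_commute[of k j] edge_commute[of l j] edge_commute[of l k]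
  have tm: "two_min (x $ edge i j) (x $ edge j k) (x $ edge i k)"
    "two_min (x $ edge i j) (x $ edge j l) (x $ edge i l)"
    "two_min (x $ edge i k) (x $ edge k l) (x $ edge i l)"
    "two_min (x $ edge j k) (x $ edge k l) (x $ edge j l)"
    using assms[of i j k] assms[of i j l] assms[of i k l] assms[of j k l] d by (auto simp: comm)
  show ?thesis
    using four_trees[OF tm]
    apply (elim disjE conjE)
    subgoal using d by (intro pair_mem[of i j k l]) (auto simp: comm)
    subgoal using d by (intro pair_mem[of i k j l]) (auto simp: comm)
    subgoal using d by (intro pair_mem[of i l j k]) (auto simp: comm)
    subgoal using d by (intro star_mem[of i j k l]) (auto simp: comm)
    subgoal using d by (intro star_mem[of j k i l]) (auto simp: comm)
    subgoal using d by (intro star_mem[of i k j l]) (auto simp: comm)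
    subgoal using d by (intro star_mem[of i j l k]) (auto simp: comm)
    subgoal using d by (intro star_mem[of j l i k]) (auto simp: comm)
    subgoal using d by (intro star_mem[of i l j k]) (auto simp: comm)
    subgoal using d by (intro star_mem[of k l i j]) (auto simp: comm)
    subgoal using d by (intro star_mem[of i l k j]) (auto simp: comm)
    subgoal using d by (intro star_mem[of i k l j]) (auto simp: comm)
    subgoal using d by (intro star_mem[of k l j i]) (auto simp: comm)
    subgoal using d by (intro star_mem[of j l k i]) (auto simp: comm)
    subgoal using d by (intro star_mem[of j k l i]) (auto simp: comm)
    done
qed

lemma linear_pair_pt_inj:
  assumes "distinct [i, j, k, l]"
  shows "inj (\<lambda>(a, b, c). pair_pt i j k l a b (c::real))"
  by (rule injI) (auto dest!: arg_cong[where f = "\<lambda>v. (v $ edge i j, v $ edge k l, v $ edge i k)"]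
      simp: pair_pt_edge[OF assms])

lemma dim_pair_space:
  assumes "distinct [i, j, k, l]"
  shows "dim (pair_space i j k l) = 3"
proof -
  have "dim (pair_space i j k l) = dim (UNIV :: (real \<times> real \<times> real) set)"
    unfolding pair_space_def
    by (rule dim_image_eq[OF linear_pair_pt]) (use linear_pair_pt_inj[OF assms] in simp)
  then show ?thesis by simp
qed

lemma pair_pt_diff: "pair_pt i j k l a b c - pair_pt i j k l a' b' c' = pair_pt i j k l (a - a') (b - b') (c - (c'::real))"
  by (auto simp: pair_pt_def vec_eq_iff)

lemma pair_pt_scale: "s *\<^sub>R pair_pt i j k l a b c = pair_pt i j k l (s * a) (s * b) (s * (c::real))"
  by (auto simp: pair_pt_def vec_eq_iff)

lemma norm_pair_pt:
  fixes a b c :: real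
  assumes "\<bar>a\<bar> \<le> M" "\<bar>b\<bar> \<le> M" "\<bar>c\<bar> \<le> M"
  shows "norm (pair_pt i j k l a b c) \<le> real CARD(pidx) * M"
proof -
  have "norm (pair_pt i j k l a b c) \<le> (\<Sum>e\<in>UNIV. \<bar>pair_pt i j k l a b c $ e\<bar>)" by (rule norm_le_l1_cart)
  also have "\<dots> \<le> (\<Sum>e\<in>(UNIV::pidx set). M)" by (intro sum_mono) (use assms in \<open>auto simp: pair_pt_def\<close>)
  finally show ?thesis by simp
qed

lemma ball_pair_pt:
  fixes a b c :: real
  assumes "e > 0"
  obtains h where "h > 0" "\<And>a' b' c'. \<bar>a' - a\<bar> \<le> h \<Longrightarrow> \<bar>b' - b\<bar> \<le> h \<Longrightarrow> \<bar>c' - c\<bar> \<le> h \<Longrightarrow>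
    pair_pt i j k l a' b' c' \<in> ball (pair_pt i j k l a b c) e"
proof
  define h where "h = e / (2 * (real CARD(pidx) + 1))"
  show "h > 0" unfolding h_def using assms by (intro divide_pos_pos) auto
  have "real CARD(pidx) * h \<le> (real CARD(pidx) + 1) * h" using \<open>h > 0\<close> by simp
  also have "\<dots> = e / 2" by (simp add: h_def field_simps)
  finally have h: "real CARD(pidx) * h < e" using assms by simp
  show "pair_pt i j k l a' b' c' \<in> ball (pair_pt i j k l a b c) e"
    if "\<bar>a' - a\<bar> \<le> h" "\<bar>b' - b\<bar> \<le> h" "\<bar>c' - c\<bar> \<le> h" for a' b' c'
  proof -
    have "dist (pair_pt i j k l a' b' c') (pair_pt i j k l a b c) < e"
      unfolding dist_norm pair_pt_diff using norm_pair_pt[OF that, of i j k l] h by simp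
    then show ?thesis by (simp add: dist_commute)
  qed
qed

section \<open>Cells and weights of the tropicalization\<close>

locale trop_lines =
  fixes G :: "pidx wcomplex" and K :: "'k::{alg_closed_field, valued_field} itself"
  assumes trop: "tropicalization (lines_through_unit_point :: ('k^pidx) set) G"
begin

lemma complex_G: "polyhedral_complex (cells G)"
  and Union_G: "\<Union>(cells G) = trop_set (torus_ideal (lines_through_unit_point :: ('k^pidx) set))"
  and pure_G: "\<exists>d. pure_dim d (cells G)"
  and weight_G: "S \<in> max_cells (cells G) \<Longrightarrow> t \<in> torus \<Longrightarrow> (\<chi> i. val (t $ i)) \<in> rel_interior S \<Longrightarrow>
    \<exists>k. ideal_mult (init_ideal t (torus_ideal (lines_through_unit_point :: ('k^pidx) set))) = enat k \<and> weight G S = int k"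
  using trop by (simp_all only: tropicalization_def)

lemma closed_G: "closed (\<Union>(cells G))"
  using polyhedral_complexD(1,8)[OF complex_G] by (intro closed_Union) auto

lemma two_min_G:
  assumes "x \<in> \<Union>(cells G)" "distinct [i, j, k]"
  shows "two_min (x $ edge i j) (x $ edge j k) (x $ edge k i)"
  using assms unfolding Union_G by (rule trop_lines_two_min)

text \<open>Points with coordinates in the value group lift to lines; density of the value group and
  closedness of the complex give the others. The approximation moves \<open>a\<close> and
  \<open>b\<close> up and \<open>c\<close> down, so the inequalities survive.\<close>

lemma pair_pt_in_G:
  assumes d: "distinct [i, j, k, l]" and "c < a" "c < b"
  shows "pair_pt i j k l a b c \<in> \<Union>(cells G)"
proof (rule ccontr)
  assume "pair_pt i j k l a b c \<notin> \<Union>(cells G)"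
  then have "pair_pt i j k l a b c \<in> - \<Union>(cells G)" by simp
  then obtain e where e: "e > 0" "ball (pair_pt i j k l a b c) e \<subseteq> - \<Union>(cells G)"
    using openE[OF open_Compl[OF closed_G]] by metis
  obtain h where h: "h > 0" "\<And>a' b' c'. \<bar>a' - a\<bar> \<le> h \<Longrightarrow> \<bar>b' - b\<bar> \<le> h \<Longrightarrow> \<bar>c' - c\<bar> \<le> h \<Longrightarrow>
    pair_pt i j k l a' b' c' \<in> ball (pair_pt i j k l a b c) e"
    using ball_pair_pt[OF e(1)] by metis
  obtain a' where a': "a' \<in> value_group TYPE('k)" "a < a'" "a' < a + h"
    using value_group_dense[of a "a + h"] h(1) by auto
  obtain b' where b': "b' \<in> value_group TYPE('k)" "b < b'" "b' < b + h"
    using value_group_dense[of b "b + h"] h(1) by auto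
  obtain c' where c': "c' \<in> value_group TYPE('k)" "c - h < c'" "c' < c"
    using value_group_dense[of "c - h" c] h(1) by auto
  have "pair_pt i j k l a' b' c' \<in> \<Union>(cells G)"
    unfolding Union_G
    by (rule pair_pt_in_trop_lines[OF d a'(1) b'(1) c'(1)]) (use assms a' b' c' in auto)
  moreover have "pair_pt i j k l a' b' c' \<in> ball (pair_pt i j k l a b c) e"
    by (rule h(2)) (use a' b' c' in auto)
  ultimately show False using e(2) by blast
qed

text \<open>A convex cell covered by finitely many subspaces lies in one of them. This bounds its
  dimension without any knowledge of the chosen polyhedral structure.\<close>

lemma cells_G_tree_space:
  assumes "S \<in> cells G"
  shows "\<exists>L\<in>tree_spaces. S \<subseteq> L"
proof (rule convex_subset_Union_affine[OF finite_tree_spaces])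
  show "convex S" "S \<noteq> {}" using polyhedral_complexD(3,7)[OF complex_G assms] by auto
  show "affine L" if "L \<in> tree_spaces" for L
    using tree_spaces_subspace(1)[OF that] by (rule subspace_imp_affine)
  show "S \<subseteq> \<Union>tree_spaces"
  proof
    fix x assume "x \<in> S"
    then have "x \<in> \<Union>(cells G)" using assms by blast
    then show "x \<in> \<Union>tree_spaces" using two_min_tree_spaces[OF two_min_G] by blast
  qed
qed

lemma aff_dim_G:
  assumes "S \<in> cells G"
  shows "aff_dim S \<le> 3"
proof -
  obtain L where L: "L \<in> tree_spaces" "S \<subseteq> L" using cells_G_tree_space[OF assms] by blast
  have "aff_dim S \<le> aff_dim L" using L(2) by (rule aff_dim_subset)
  also have "\<dots> = int (dim L)" using tree_spaces_subspace(1)[OF L(1)] by (rule aff_dim_subspace)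
  also have "\<dots> \<le> 3" using tree_spaces_subspace(2)[OF L(1)] by simp
  finally show ?thesis .
qed

text \<open>Around a generic point of the cone every nearby \<open>pair_pt\<close> lies in the same
  cell, which forces its linear space. Nearby points with coordinates in the value group are
  valuations of an explicit Pluecker vector at which the multiplicity is nonzero.\<close>

lemma pair_cell:
  assumes d: "distinct [i, j, k, l]" and abc: "c < a" "c < b"
    and gen: "\<And>N. N \<in> cells G - max_cells (cells G) \<Longrightarrow> pair_pt i j k l a b c \<notin> N"
    and T: "T \<in> cells G" "pair_pt i j k l a b c \<in> T"
  shows "T \<in> max_cells (cells G)" "pair_pt i j k l a b c \<in> rel_interior T"
    "lin_space T = pair_space i j k l" "weight G T \<noteq> 0"
proof -
  let ?y = "pair_pt i j k l a b c"
  have T': "T \<in> max_cells (cells G)" "?y \<in> rel_interior T"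
    using rel_interior_max_cell[OF complex_G T gen] by auto
  show "T \<in> max_cells (cells G)" "?y \<in> rel_interior T" by (rule T')+
  define V where "V = {U \<in> cells G. ?y \<notin> U}"
  have "closed (\<Union>V)" using polyhedral_complexD(1,8)[OF complex_G] by (intro closed_Union) (auto simp: V_def)
  moreover have "?y \<in> - \<Union>V" by (auto simp: V_def)
  ultimately obtain e where e: "e > 0" "ball ?y e \<subseteq> - \<Union>V" using openE open_Compl by metis
  obtain h0 where h0: "h0 > 0" "\<And>a' b' c'. \<bar>a' - a\<bar> \<le> h0 \<Longrightarrow> \<bar>b' - b\<bar> \<le> h0 \<Longrightarrow> \<bar>c' - c\<bar> \<le> h0 \<Longrightarrow>
    pair_pt i j k l a' b' c' \<in> ball ?y e"
    using ball_pair_pt[OF e(1)] by metis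
  \<comment> \<open>A third of each gap, so that \<open>c\<close> stays below \<open>a\<close> and
    \<open>b\<close> when the entries move by at most \<open>h\<close>.\<close>
  define h where "h = min h0 (min ((a - c) / 3) ((b - c) / 3))"
  have h: "h > 0" using h0 abc by (simp add: h_def)
  have near: "pair_pt i j k l a' b' c' \<in> T" if "\<bar>a' - a\<bar> \<le> h" "\<bar>b' - b\<bar> \<le> h" "\<bar>c' - c\<bar> \<le> h" for a' b' c'
  proof -
    have bd: "h \<le> h0" "h \<le> (a - c) / 3" "h \<le> (b - c) / 3" 
      unfolding h_def by (rule min.cobounded1, rule order_trans[OF min.cobounded2 min.cobounded1],
        rule order_trans[OF min.cobounded2 min.cobounded2])
    have "c' < a'" "c' < b'" using that bd h abc by (auto simp: abs_le_iff)
    then obtain U where U: "U \<in> cells G" "pair_pt i j k l a' b' c' \<in> U" using pair_pt_in_G[OF d] by blast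
    have "pair_pt i j k l a' b' c' \<in> ball ?y e" by (rule h0(2)) (use that bd in auto)
    then have "?y \<in> U" using e(2) U by (auto simp: V_def)
    then have "U = T" using max_cell_eq[OF complex_G T'(1) U(1) T'(2)] by simp
    then show ?thesis using U(2) by simp
  qed
  have "pair_space i j k l \<subseteq> lin_space T"
  proof
    fix v assume "v \<in> pair_space i j k l"
    then obtain r s t where v: "v = pair_pt i j k l r s t" by (auto simp: pair_space_def)
    define m where "m = h / (\<bar>r\<bar> + \<bar>s\<bar> + \<bar>t\<bar> + 1)"
    have m: "m > 0" using h by (simp add: m_def)
    have mb: "\<bar>m * u\<bar> \<le> h" if "\<bar>u\<bar> \<le> \<bar>r\<bar> + \<bar>s\<bar> + \<bar>t\<bar> + 1" for u
    proof -
      have "\<bar>m * u\<bar> = m * \<bar>u\<bar>" using m by (simp add: abs_mult)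
      also have "\<dots> \<le> m * (\<bar>r\<bar> + \<bar>s\<bar> + \<bar>t\<bar> + 1)" using m that by (intro mult_left_mono) auto
      also have "\<dots> = h" by (simp add: m_def)
      finally show ?thesis .
    qed
    have "pair_pt i j k l (a + m * r) (b + m * s) (c + m * t) \<in> T"
      by (rule near) (use mb in auto)
    then have "pair_pt i j k l (a + m * r) (b + m * s) (c + m * t) - ?y \<in> lin_space T"
      using T(2) by (rule diff_in_lin_space)
    then have "m *\<^sub>R v \<in> lin_space T" by (simp add: pair_pt_diff v pair_pt_scale)
    then have "(1 / m) *\<^sub>R (m *\<^sub>R v) \<in> lin_space T" by (rule subspace_mul[OF subspace_lin_space])
    then show "v \<in> lin_space T" using m by simp
  qed
  moreover have "dim (lin_space T) \<le> dim (pair_space i j k l)"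
    using aff_dim_G[OF T(1)] aff_dim_lin_space[of T] T(2) dim_pair_space[OF d] by force
  ultimately show "lin_space T = pair_space i j k l"
    using subspace_dim_equal[OF _ subspace_lin_space] linear_range_real3(1)[OF linear_pair_pt]
    unfolding pair_space_def by blast
  obtain e1 where e1: "e1 > 0" "ball ?y e1 \<inter> affine hull T \<subseteq> T"
    using T'(2) mem_rel_interior_ball[of ?y T] by blast
  obtain h1 where h1: "h1 > 0" "\<And>a' b' c'. \<bar>a' - a\<bar> \<le> h1 \<Longrightarrow> \<bar>b' - b\<bar> \<le> h1 \<Longrightarrow> \<bar>c' - c\<bar> \<le> h1 \<Longrightarrow>
    pair_pt i j k l a' b' c' \<in> ball ?y e1"
    using ball_pair_pt[OF e1(1)] by metis
  \<comment> \<open>The weight is prescribed only at points of the relative interior with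
    coordinates in the value group; \<open>?y\<close> need not be one of them and is perturbed
    inside \<open>T\<close>.\<close>
  define h2 where "h2 = min h h1"
  have h2: "h2 > 0" "h2 \<le> h" "h2 \<le> h1" using h h1 by (auto simp: h2_def)
  obtain a' where a': "a' \<in> value_group TYPE('k)" "a < a'" "a' < a + h2"
    using value_group_dense[of a "a + h2"] h2(1) by auto
  obtain b' where b': "b' \<in> value_group TYPE('k)" "b < b'" "b' < b + h2"
    using value_group_dense[of b "b + h2"] h2(1) by auto
  obtain c' where c': "c' \<in> value_group TYPE('k)" "c - h2 < c'" "c' < c"
    using value_group_dense[of "c - h2" c] h2(1) by auto
  let ?y' = "pair_pt i j k l a' b' c'"
  have y'T: "?y' \<in> T" by (rule near) (use a' b' c' h2 in auto)
  have y'b: "?y' \<in> ball ?y e1" by (rule h1(2)) (use a' b' c' h2 in auto)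
  have "?y' \<in> rel_interior T"
  proof -
    have "openin (top_of_set (affine hull T)) (ball ?y e1 \<inter> affine hull T)"
      by (metis Int_commute open_ball openin_open_Int)
    moreover have "?y' \<in> ball ?y e1 \<inter> affine hull T" using y'b y'T hull_inc[of ?y' T affine] by blast
    ultimately show ?thesis using e1(2) unfolding rel_interior_def by blast
  qed
  moreover obtain A B C :: 'k where ABC: "A \<noteq> 0" "B \<noteq> 0" "C \<noteq> 0" "val C < val A" "val C < val B"
    "a' = val A" "b' = val B" "c' = val C"
    by (rule pair_pt_in_trop_lines[OF d a'(1) b'(1) c'(1)]) (use abc a' b' c' in auto)
  ultimately obtain m where "ideal_mult (init_ideal (delta (pair_vec j k l A B C))
      (torus_ideal (lines_through_unit_point :: ('k^pidx) set))) = enat m" "weight G T = int m"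
    using weight_G[OF T'(1) delta_pair_vec(1)[OF d ABC(1-5)]] delta_pair_vec(2)[OF d ABC(1-5)] by metis
  moreover have "ideal_mult (init_ideal (delta (pair_vec j k l A B C))
      (torus_ideal (lines_through_unit_point :: ('k^pidx) set))) \<noteq> 0"
    by (rule pair_cone_multiplicity[OF d ABC(1-5)])
  ultimately show "weight G T \<noteq> 0" by (auto simp: zero_enat_def)
qed

lemma nonmax_G:
  assumes "N \<in> cells G - max_cells (cells G)"
  shows "aff_dim N \<le> 2"
proof -
  obtain T where "T \<in> max_cells (cells G)" "aff_dim N < aff_dim T"
    using nonmax_cell_aff_dim[OF complex_G assms] by blast
  then show ?thesis using aff_dim_G[OF max_cellsD(1)] by fastforce
qed

text \<open>One generic point in the cone of two opposite edges exhibits a maximal cell of dimension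
  3, and purity carries the dimension over to all maximal cells.\<close>

lemma max_cells_G:
  shows "T \<in> max_cells (cells G) \<Longrightarrow> aff_dim T = 3" and "complex_dim (cells G) = 2"
proof -
  obtain i j k l :: 4 where d: "distinct [i, j, k, l]" using ex_distinct_four by blast
  let ?f = "\<lambda>(a, b, c). pair_pt i j k l a b (c::real)"
  \<comment> \<open>Any box on which \<open>c\<close> stays below \<open>a\<close> and
    \<open>b\<close> would do.\<close>
  let ?U = "{2<..<3} \<times> {2<..<3} \<times> {0<..<1} :: (real \<times> real \<times> real) set"
  have U: "convex ?U" "open ?U" "?U \<noteq> {}"
    by (auto intro!: convex_Times open_Times simp: convex_real_interval)
  have "aff_dim (?f ` ?U) = aff_dim ?U"
    by (rule aff_dim_injective_linear_image[OF linear_pair_pt linear_pair_pt_inj[OF d]])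
  also have "\<dots> = 3" using aff_dim_open[OF U(2,3)] by simp
  finally have dimU: "aff_dim (?f ` ?U) = 3" .
  have "\<exists>x\<in>?f ` ?U. \<forall>L\<in>(hull) affine ` (cells G - max_cells (cells G)). x \<notin> L"
  proof (rule convex_avoid_affine)
    show "finite ((hull) affine ` (cells G - max_cells (cells G)))"
      using polyhedral_complexD(1)[OF complex_G] by simp
    show "convex (?f ` ?U)" using linear_pair_pt U(1) by (rule convex_linear_image)
    show "\<not> ?f ` ?U \<subseteq> L" if L: "L \<in> (hull) affine ` (cells G - max_cells (cells G))" for L
    proof
      assume "?f ` ?U \<subseteq> L"
      then have "3 \<le> aff_dim L" using aff_dim_subset[of "?f ` ?U" L] dimU by simp
      moreover obtain N where "N \<in> cells G - max_cells (cells G)" "L = affine hull N" using L by blast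
      then have "aff_dim L \<le> 2" using nonmax_G by simp
      ultimately show False by simp
    qed
  qed (use U in auto)
  then obtain x where x: "x \<in> ?f ` ?U"
    "\<forall>L\<in>(hull) affine ` (cells G - max_cells (cells G)). x \<notin> L" by (rule bexE)
  from x(1) obtain q where q: "x = ?f q" "q \<in> ?U" by (rule imageE)
  obtain a b c where "q = (a, b, c)" by (cases q)
  then have abc: "(a, b, c) \<in> ?U"
    and gen: "\<forall>L\<in>(hull) affine ` (cells G - max_cells (cells G)). pair_pt i j k l a b c \<notin> L"
    using q x(2) by simp_all
  have cab: "c < a" "c < b" using abc by auto
  then obtain T where T: "T \<in> cells G" "pair_pt i j k l a b c \<in> T" using pair_pt_in_G[OF d] by blast
  have gen': "pair_pt i j k l a b c \<notin> N" if "N \<in> cells G - max_cells (cells G)" for N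
    using bspec[OF gen imageI[OF that]] hull_inc[of "pair_pt i j k l a b c" N affine] by blast
  note pc = pair_cell[OF d cab gen' T]
  have "aff_dim T = 3"
    using aff_dim_lin_space[of T] T(2) pc(3) dim_pair_space[OF d] by auto
  moreover obtain r where r: "pure_dim r (cells G)" using pure_G by blast
  ultimately have "r = 2" using pure_dim_aff_dim[OF r pc(1)] by simp
  then show "aff_dim T = 3" if "T \<in> max_cells (cells G)" for T using pure_dim_aff_dim[OF r that] by simp
  show "complex_dim (cells G) = 2"
    unfolding complex_dim_def
  proof (rule Max_eqI)
    show "finite (tdim ` cells G)" using polyhedral_complexD(1)[OF complex_G] by simp
    show "y \<le> 2" if "y \<in> tdim ` cells G" for y using that aff_dim_G by (auto simp: tdim_def)
    show "2 \<in> tdim ` cells G" using T(1) \<open>aff_dim T = 3\<close> by (auto simp: tdim_def image_iff intro!: bexI[of _ T])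
  qed
qed

end

subsection \<open>Cells of a fan curve\<close>

definition line_one :: "(real^'n) set" where
  "line_one = range (\<lambda>c. \<chi> i. c)"

lemma span_one: "span {\<chi> i. 1} = (line_one :: (real^'n) set)"
  unfolding span_singleton line_one_def by (intro arg_cong[where f = range] ext) (simp add: vec_eq_iff)

lemma subspace_line_one: "subspace (line_one :: (real^'n) set)"
  unfolding span_one[symmetric] by (rule subspace_span)

lemma const_in_line_one: "(\<chi> i. c) \<in> line_one"
  by (simp add: line_one_def)

lemma dim_line_one: "dim (line_one :: (real^'n) set) = 1"
proof -
  have "(\<chi> i. 1) \<noteq> (0 :: real^'n)" by (simp add: vec_eq_iff)
  then have "dim (span {\<chi> i. 1} :: (real^'n) set) = 1" by (subst dim_span) (simp add: dim_singleton)
  then show ?thesis by (simp only: span_one)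
qed

lemma plane_eq_span:
  fixes P :: "(real^4) set"
  assumes P: "subspace P" "dim P = 2" "(\<chi> i. 1) \<in> P" and g: "g \<in> P" "g \<notin> line_one"
  shows "P = span {g, \<chi> i. 1}"
proof -
  let ?o = "(\<chi> i. 1) :: real^4"
  have "?o \<noteq> 0" by (simp add: vec_eq_iff)
  then have "independent {?o}" by simp
  then have ind: "independent {g, ?o}" using g(2) by (simp add: independent_insert span_one)
  have "g \<noteq> ?o" using g(2) const_in_line_one by metis
  then have "dim (span {g, ?o}) = 2" using dim_eq_card_independent[OF ind] by (simp add: dim_span)
  moreover have "span {g, ?o} \<subseteq> P" using P(1,3) g(1) by (intro span_minimal) auto
  then have "dim P \<le> dim (span {g, ?o}) \<Longrightarrow> span {g, ?o} = P"
    by (rule subspace_dim_equal[OF subspace_span P(1)])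
  ultimately show ?thesis using P(2) by simp
qed

lemma cell_lin_space_const:
  assumes "polyhedral_complex C" "S \<in> C"
  shows "(\<chi> i. c) \<in> lin_space S"
proof -
  obtain x where x: "x \<in> S" using polyhedral_complexD(3)[OF assms] by blast
  then have "x + (\<chi> i. c) \<in> S" by (rule polyhedral_complexD(4)[OF assms])
  then show ?thesis using diff_in_lin_space[OF _ x] by fastforce
qed

text \<open>Cells other than \<open>S\<close> keep a positive distance from \<open>x\<close>, and
  small scalings of \<open>x\<close> stay in the support; so they stay in \<open>S\<close>.\<close>

lemma cone_max_cell_scale:
  assumes A: "polyhedral_complex (cells A)" and cone: "\<And>x c. x \<in> support A \<Longrightarrow> 0 \<le> c \<Longrightarrow> c *\<^sub>R x \<in> support A"
    and S: "S \<in> max_cells (cells A)" "weight A S \<noteq> 0" and x: "x \<in> rel_interior S"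
  obtains e where "e > 0" "e < 1" "\<And>s. \<bar>s - 1\<bar> < e \<Longrightarrow> s *\<^sub>R x \<in> rel_interior S"
proof -
  define V where "V = {U \<in> cells A. x \<notin> U}"
  have "closed (\<Union>V)" using polyhedral_complexD(1,8)[OF A] by (intro closed_Union) (auto simp: V_def)
  moreover have "x \<in> - \<Union>V" by (auto simp: V_def)
  ultimately obtain e where e: "e > 0" "ball x e \<subseteq> - \<Union>V" using openE open_Compl by metis
  obtain e1 where e1: "e1 > 0" "ball x e1 \<inter> affine hull S \<subseteq> S"
    using x mem_rel_interior_ball[of x S] by blast
  have xs: "x \<in> support A" using x rel_interior_subset S by (auto simp: support_def)
  define h where "h = min 1 (min e e1) / (norm x + 1)"
  have h: "h > 0" using e e1 by (auto simp: h_def intro!: divide_pos_pos add_nonneg_pos)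
  have sm: "s *\<^sub>R x \<in> rel_interior S" if s: "\<bar>s - 1\<bar> < min h (1/2)" for s
  proof -
    have "dist x (s *\<^sub>R x) = \<bar>s - 1\<bar> * norm x"
      using norm_scaleR[of "s - 1" x] by (simp add: dist_norm norm_minus_commute scaleR_diff_left)
    also have "\<dots> \<le> h * norm x" using s by (intro mult_right_mono) auto
    also have "\<dots> < h * (norm x + 1)" using h by simp
    also have "\<dots> = min 1 (min e e1)" unfolding h_def by (simp add: add_nonneg_eq_0_iff)
    finally have d: "dist x (s *\<^sub>R x) < e" "dist x (s *\<^sub>R x) < e1" by auto
    have "0 \<le> s" using s by linarith
    then have "s *\<^sub>R x \<in> support A" using cone[OF xs] by simp
    then obtain U where U: "U \<in> cells A" "s *\<^sub>R x \<in> U" using max_cellsD(1) by (auto simp: support_def)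
    then have "x \<in> U" using e(2) d(1) by (auto simp: V_def)
    then have "U = S" using max_cell_eq[OF A S(1) U(1) x] by simp
    then have inS: "s *\<^sub>R x \<in> S" using U by simp
    have "openin (top_of_set (affine hull S)) (ball x e1 \<inter> affine hull S)"
      by (metis Int_commute open_ball openin_open_Int)
    moreover have "s *\<^sub>R x \<in> ball x e1 \<inter> affine hull S" using d(2) inS hull_inc[of "s *\<^sub>R x" S affine] by simp
    ultimately show ?thesis using e1(2) unfolding rel_interior_def by blast
  qed
  show thesis by (rule that[of "min h (1/2)"]) (use h sm in auto)
qed

locale fan_curve =
  fixes A :: "4 wcomplex" and \<Gamma> :: "real set"
  assumes curve: "tropical_curve \<Gamma> A" and fan: "is_fan_set (support A)"
begin

lemma complex_A: "polyhedral_complex (cells A)" and rational_A: "S \<in> cells A \<Longrightarrow> rational_polyhedron \<Gamma> S"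
  and pure_A: "pure_dim 1 (cells A)"
  using curve by (simp_all only: tropical_variety_def)

lemma aff_dim_max_A: "S \<in> max_cells (cells A) \<Longrightarrow> aff_dim S = 2"
  using pure_dim_aff_dim[OF pure_A] by simp

lemma aff_dim_A: "S \<in> cells A \<Longrightarrow> aff_dim S \<le> 2"
  using ex_max_cell[OF polyhedral_complexD(1)[OF complex_A]] aff_dim_subset aff_dim_max_A by metis

lemma nonmax_A: "N \<in> cells A - max_cells (cells A) \<Longrightarrow> aff_dim N \<le> 1"
  using nonmax_cell_aff_dim[OF complex_A] aff_dim_max_A by (metis zle_add1_eq_le one_add_one)

lemma cone_A:
  assumes "x \<in> support A" "0 \<le> c"
  shows "c *\<^sub>R x \<in> support A"
proof -
  obtain F where F: "\<forall>S\<in>F. cone S" "support A = \<Union>F"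
    using fan by (auto simp: is_fan_set_def fan_def)
  then obtain S where "S \<in> F" "x \<in> S" using assms(1) by blast
  then have "c *\<^sub>R x \<in> S" using F(1) assms(2) by (simp add: cone_def)
  then show ?thesis using F(2) \<open>S \<in> F\<close> by blast
qed

text \<open>Here the fan condition acts: \<open>S\<close> contains a point together with a nearby
  multiple, so the point itself is a direction of \<open>S\<close>. With (1,1,1,1) any point of
  \<open>S\<close> off \<open>line_one\<close> therefore spans the linear space, whatever the
  subdivision.\<close>

lemma lin_space_A:
  assumes S: "S \<in> max_cells (cells A)" "weight A S \<noteq> 0"
  shows "dim (lin_space S) = 2" and "S \<subseteq> lin_space S"
    and "a \<in> S \<Longrightarrow> a \<notin> line_one \<Longrightarrow> lin_space S = span {a, \<chi> i. 1}"
proof -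
  have Sc: "S \<in> cells A" by (rule max_cellsD[OF S(1)])
  have ne: "S \<noteq> {}" by (rule polyhedral_complexD(3)[OF complex_A Sc])
  show dim: "dim (lin_space S) = 2" using aff_dim_lin_space[OF ne] aff_dim_max_A[OF S(1)] by simp
  obtain x where x: "x \<in> rel_interior S"
    using ne polyhedral_complexD(7)[OF complex_A Sc] rel_interior_eq_empty by blast
  obtain e where e: "e > 0" "e < 1" "\<And>s. \<bar>s - 1\<bar> < e \<Longrightarrow> s *\<^sub>R x \<in> rel_interior S"
    using cone_max_cell_scale[OF complex_A cone_A S x] by metis
  have "(1 + e / 2) *\<^sub>R x \<in> S" "x \<in> S" using e(3)[of "1 + e / 2"] e(1,2) x rel_interior_subset by auto
  then have "(1 + e / 2) *\<^sub>R x - x \<in> lin_space S" by (rule diff_in_lin_space)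
  then have "(e / 2) *\<^sub>R x \<in> lin_space S" by (simp add: scaleR_add_left)
  then have "(2 / e) *\<^sub>R ((e / 2) *\<^sub>R x) \<in> lin_space S" by (rule subspace_mul[OF subspace_lin_space])
  then have xl: "x \<in> lin_space S" using e(1) by simp
  show sub: "S \<subseteq> lin_space S"
  proof
    fix a assume "a \<in> S"
    then have "x + (a - x) \<in> lin_space S"
      using diff_in_lin_space[OF _ \<open>x \<in> S\<close>] xl subspace_add[OF subspace_lin_space] by blast
    then show "a \<in> lin_space S" by simp
  qed
  show "lin_space S = span {a, \<chi> i. 1}" if "a \<in> S" "a \<notin> line_one"
    by (rule plane_eq_span[OF subspace_lin_space dim cell_lin_space_const[OF complex_A Sc]]) (use that sub in auto)
qed

text \<open>The scale \<open>s\<close> is one of the free parameters of a test point; this brings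
  the result back to \<open>a\<close>. Small scalings stay in one relative interior or stay outside
  the support.\<close>

lemma weight_at_scale:
  assumes "a \<notin> \<Union>(cells A - max_cells (cells A))"
  obtains e where "e > 0" "\<And>s. \<bar>s - 1\<bar> < e \<Longrightarrow> weight_at A (s *\<^sub>R a) = weight_at A a"
proof (cases "a \<in> support A")
  case True
  then obtain S where S: "S \<in> max_cells (cells A)" "weight A S \<noteq> 0" "a \<in> S" by (auto simp: support_def)
  have ri: "a \<in> rel_interior S"
    by (rule rel_interior_max_cell(2)[OF complex_A max_cellsD(1)[OF S(1)] S(3)]) (use assms in blast)
  obtain e where e: "e > 0" "e < 1" "\<And>s. \<bar>s - 1\<bar> < e \<Longrightarrow> s *\<^sub>R a \<in> rel_interior S"
    using cone_max_cell_scale[OF complex_A cone_A S(1,2) ri] by metis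
  show thesis
    by (rule that[OF e(1)]) (simp add: weight_at_max_cell[OF complex_A S(1,2)] e(3) ri)
next
  case False
  have ns: "s *\<^sub>R a \<notin> support A" if "\<bar>s - 1\<bar> < 1" for s
  proof
    assume "s *\<^sub>R a \<in> support A"
    have "s > 0" using that by linarith
    have "(1 / s) *\<^sub>R (s *\<^sub>R a) \<in> support A" 
      by (rule cone_A[OF \<open>s *\<^sub>R a \<in> support A\<close>]) (use \<open>s > 0\<close> in simp)
    moreover have "(1 / s) *\<^sub>R (s *\<^sub>R a) = a" using \<open>s > 0\<close> by simp
    ultimately show False using False by simp
  qed
  show thesis by (rule that[of 1]) (simp_all add: weight_at_outside ns False)
qed

end

lemma weight_at_shift:
  assumes A: "polyhedral_complex (cells A)"
  shows "weight_at A (a + (\<chi> i. c)) = weight_at A a"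
proof -
  have "a + (\<chi> i. c) \<in> S \<longleftrightarrow> a \<in> S" if "S \<in> max_cells (cells A)" for S
  proof
    assume "a + (\<chi> i. c) \<in> S"
    then have "a + (\<chi> i. c) + (\<chi> i. - c) \<in> S" by (rule polyhedral_complexD(4)[OF A max_cellsD(1)[OF that]])
    moreover have "a + (\<chi> i. c) + (\<chi> i. - c) = a" by (simp add: vec_eq_iff)
    ultimately show "a \<in> S" by simp
  qed (rule polyhedral_complexD(4)[OF A max_cellsD(1)[OF that]])
  then have "{S. S \<in> max_cells (cells A) \<and> weight A S \<noteq> 0 \<and> a + (\<chi> i. c) \<in> S} =
      {S. S \<in> max_cells (cells A) \<and> weight A S \<noteq> 0 \<and> a \<in> S}" by blast
  then show ?thesis by (simp only: weight_at_def)
qed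

subsection \<open>Minkowski weights of a curve and the space of trees\<close>

lemma max_cells_push: "max_cells (cells (push_wcomplex phi A)) = (`) phi ` max_cells (cells A)"
proof -
  have mem: "phi ` R \<in> (`) phi ` cells A \<longleftrightarrow> R \<in> cells A" for R
    by (auto simp: image_iff inj_image_eq_iff[OF inj_phi])
  have iff: "phi ` R \<in> max_cells ((`) phi ` cells A) \<longleftrightarrow> R \<in> max_cells (cells A)" for R
    unfolding max_cells_def mem_Collect_eq mem ball_simps
    by (simp add: inj_image_subset_iff[OF inj_phi] inj_image_eq_iff[OF inj_phi])
  have "S \<in> (`) phi ` max_cells (cells A)" if S: "S \<in> max_cells ((`) phi ` cells A)" for S
  proof -
    obtain R where "S = phi ` R" using max_cellsD(1)[OF S] by blast
    then show ?thesis using S iff by blast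
  qed
  then show ?thesis using iff by (auto simp: push_wcomplex_def)
qed

lemma weight_push: "weight (push_wcomplex phi A) (phi ` S) = weight A S"
  by (simp add: push_wcomplex_def inj_vimage_image_eq[OF inj_phi])

lemma tdim_phi: "tdim (phi ` S) = tdim S"
  by (simp add: tdim_def aff_dim_injective_linear_image[OF linear_phi inj_phi])

lemma (in fan_curve) complex_dim_push:
  assumes "S \<in> max_cells (cells A)"
  shows "complex_dim (cells (push_wcomplex phi A)) = 1"
  unfolding complex_dim_def
proof (rule Max_eqI)
  have e: "tdim ` cells (push_wcomplex phi A) = tdim ` cells A"
    by (simp add: push_wcomplex_def image_image tdim_phi)
  show "finite (tdim ` cells (push_wcomplex phi A))"
    unfolding e using polyhedral_complexD(1)[OF complex_A] by simp
  show "y \<le> 1" if "y \<in> tdim ` cells (push_wcomplex phi A)" for y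
    using that aff_dim_A unfolding e by (auto simp: tdim_def)
  show "1 \<in> tdim ` cells (push_wcomplex phi A)"
    unfolding e using aff_dim_max_A[OF assms] max_cellsD(1)[OF assms] by (auto simp: tdim_def image_iff intro!: bexI[of _ S])
qed

text \<open>The factor by which a maximal cell \<open>T\<close> of the space of trees contributes to the Minkowski weight
  of its sum with a cell of a curve; it only depends on the linear space \<open>V\<close> of that cell.\<close>

definition mink_coeff :: "pidx wcomplex \<Rightarrow> (real^4) set \<Rightarrow> (real^pidx) set \<Rightarrow> int" where
  "mink_coeff G V T = (if dim (phi ` V + lin_space T) \<noteq> 4 then 0
     else weight G T * int (lattice_index ((phi ` V + lin_space T) \<inter> {x. \<forall>i. x $ i \<in> \<int>})
       (phi ` V \<inter> {x. \<forall>i. x $ i \<in> \<int>} + lat T)))"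

section \<open>Contributions of single curve points to the Minkowski weight\<close>

locale fan_curve_sum = fan_curve A \<Gamma> + trop_lines G K
  for A :: "4 wcomplex" and \<Gamma> :: "real set" and G :: "pidx wcomplex"
    and K :: "'k::{alg_closed_field, valued_field} itself"
begin

text \<open>The weight of the curve splits off, and the rest is common to all curves with the same
  plane. The required dimension 1 + 2 in the quotient is 4 in the preimage.\<close>

lemma minkowski_weight_coeff:
  assumes S: "S \<in> max_cells (cells A)" and T: "T \<in> max_cells (cells G)"
  shows "minkowski_weight (push_wcomplex phi A) G (phi ` S) T = weight A S * mink_coeff G (lin_space S) T"
proof -
  have ne: "phi ` S \<noteq> {}" "T \<noteq> {}"
    using polyhedral_complexD(3)[OF complex_A max_cellsD(1)[OF S]]
      polyhedral_complexD(3)[OF complex_G max_cellsD(1)[OF T]] by auto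
  have lin: "lin_space (phi ` S + T) = phi ` lin_space S + lin_space T"
    using lin_space_plus[OF ne] lin_space_linear_image[OF linear_phi] by simp
  have "phi ` S + T \<noteq> {}" using ne by (auto simp: set_plus_def)
  then have "tdim (phi ` S + T) = int (dim (phi ` lin_space S + lin_space T)) - 1"
    by (simp add: tdim_def aff_dim_lin_space lin)
  then show ?thesis
    unfolding minkowski_weight_def mink_coeff_def
    by (simp add: complex_dim_push[OF S] max_cells_G(2) weight_push lat_def lin lin_space_linear_image[OF linear_phi] mult.assoc)
qed

lemma mink_local_push:
  "mink_local (push_wcomplex phi A) G x =
    (\<Sum>S | S \<in> max_cells (cells A) \<and> weight A S \<noteq> 0. \<Sum>T\<in>max_cells (cells G).
      if x \<in> phi ` S + T then weight A S * mink_coeff G (lin_space S) T else 0)"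
proof -
  let ?M = "max_cells (cells A)" and ?N = "max_cells (cells G)"
  have fin: "finite ?M" "finite ?N"
    using polyhedral_complexD(1)[OF complex_A] polyhedral_complexD(1)[OF complex_G] by (auto simp: max_cells_def)
  have inj: "inj_on (\<lambda>(S, T). (phi ` S, T)) (?M \<times> ?N)"
    by (auto simp: inj_on_def inj_image_eq_iff[OF inj_phi])
  have eq: "{(S, T). S \<in> max_cells (cells (push_wcomplex phi A)) \<and> T \<in> ?N \<and> x \<in> S + T}
      = (\<lambda>(S, T). (phi ` S, T)) ` {(S, T) \<in> ?M \<times> ?N. x \<in> phi ` S + T}"
    unfolding max_cells_push by (auto simp: image_iff)
  have "inj_on (\<lambda>(S, T). (phi ` S, T)) {(S, T) \<in> ?M \<times> ?N. x \<in> phi ` S + T}"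
    by (rule inj_on_subset[OF inj]) auto
  then have "mink_local (push_wcomplex phi A) G x =
      (\<Sum>(S, T)\<in>{(S, T) \<in> ?M \<times> ?N. x \<in> phi ` S + T}. minkowski_weight (push_wcomplex phi A) G (phi ` S) T)"
    unfolding mink_local_def eq by (subst sum.reindex) (auto intro!: sum.cong)
  also have "\<dots> = (\<Sum>(S, T)\<in>?M \<times> ?N. if x \<in> phi ` S + T
      then minkowski_weight (push_wcomplex phi A) G (phi ` S) T else 0)"
    using fin by (intro sum.mono_neutral_cong_left) (auto split: if_splits)
  also have "\<dots> = (\<Sum>S\<in>?M. \<Sum>T\<in>?N. if x \<in> phi ` S + T then weight A S * mink_coeff G (lin_space S) T else 0)"
    unfolding sum.cartesian_product[symmetric]
    by (intro sum.cong refl) (auto simp: minkowski_weight_coeff)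
  also have "\<dots> = (\<Sum>S | S \<in> ?M \<and> weight A S \<noteq> 0. \<Sum>T\<in>?N. if x \<in> phi ` S + T then weight A S * mink_coeff G (lin_space S) T else 0)"
    using fin by (intro sum.mono_neutral_right) (auto intro!: sum.neutral split: if_splits)
  finally show ?thesis .
qed

text \<open>Both spaces contain the line of (1,1,1,1), as \<open>phi\<close> merely doubles
  constants; so the sum always loses at least one dimension.\<close>

lemma dim_sum_le:
  assumes "(\<chi> i. 1) \<in> V" "subspace V" "T \<in> cells G"
  shows "dim (phi ` V + lin_space T) + dim (phi ` V \<inter> lin_space T) = dim V + dim (lin_space T)"
    and "line_one \<subseteq> phi ` V \<inter> lin_space T"
proof -
  have sub: "subspace (phi ` V)" using linear_phi assms(2) by (rule linear_subspace_image)
  have "phi ` V + lin_space T = {x + y |x y. x \<in> phi ` V \<and> y \<in> lin_space T}" by (auto simp: set_plus_def)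
  moreover have "dim (phi ` V) = dim V"
    by (rule dim_image_eq[OF linear_phi]) (use inj_phi in \<open>auto intro: inj_on_subset\<close>)
  ultimately show "dim (phi ` V + lin_space T) + dim (phi ` V \<inter> lin_space T) = dim V + dim (lin_space T)"
    using dim_sums_Int[OF sub subspace_lin_space[of T]] by simp
  show "line_one \<subseteq> phi ` V \<inter> lin_space T"
  proof
    fix z :: "real^pidx" assume "z \<in> line_one"
    then obtain c where z: "z = (\<chi> e. c)" by (auto simp: line_one_def)
    have "(c / 2) *\<^sub>R (\<chi> i. 1) \<in> V" using assms(1,2) by (simp add: subspace_mul)
    moreover have "phi ((c / 2) *\<^sub>R (\<chi> i. 1)) = z"
      unfolding z linear_cmul[OF linear_phi] phi_const by (simp add: vec_eq_iff)
    ultimately have "z \<in> phi ` V" by blast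
    then show "z \<in> phi ` V \<inter> lin_space T" using cell_lin_space_const[OF complex_G assms(3), of c] z by simp
  qed
qed

text \<open>A nonzero coefficient means dimension 4 = 2 + 3 - 1, so the two linear spaces meet only
  in the line of (1,1,1,1); fixing coordinate 0 removes that line.\<close>

lemma decomposition_unique:
  assumes S: "S \<in> max_cells (cells A)" "weight A S \<noteq> 0" and T: "T \<in> max_cells (cells G)"
    and c: "mink_coeff G (lin_space S) T \<noteq> 0"
    and a: "a \<in> S" "x - phi a \<in> T" "a $ 0 = 0" and b: "b \<in> S" "x - phi b \<in> T" "b $ 0 = 0"
  shows "a = b"
proof -
  have Tc: "T \<in> cells G" by (rule max_cellsD[OF T])
  have Tne: "T \<noteq> {}" by (rule polyhedral_complexD(3)[OF complex_G Tc])
  let ?V = "lin_space S"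
  have "dim (phi ` ?V + lin_space T) = 4" using c by (auto simp: mink_coeff_def split: if_splits)
  moreover have "dim (lin_space T) = 3" using aff_dim_lin_space[OF Tne] max_cells_G(1)[OF T] by simp
  moreover note ds = dim_sum_le[OF cell_lin_space_const[OF complex_A max_cellsD(1)[OF S(1)]] subspace_lin_space Tc]
  ultimately have "dim (phi ` ?V \<inter> lin_space T) = 1" using lin_space_A(1)[OF S] by simp
  moreover have "subspace (phi ` ?V \<inter> lin_space T)"
    using linear_subspace_image[OF linear_phi subspace_lin_space] subspace_lin_space by (rule subspace_inter)
  ultimately have eq: "line_one = phi ` ?V \<inter> lin_space T"
    using subspace_dim_equal[OF subspace_line_one _ ds(2)] by (simp add: dim_line_one)
  have "phi (a - b) \<in> phi ` ?V" using diff_in_lin_space[OF a(1) b(1)] by blast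
  moreover have "phi (a - b) \<in> lin_space T"
    using diff_in_lin_space[OF b(2) a(2)] by (simp add: linear_diff[OF linear_phi])
  ultimately have "phi (a - b) \<in> line_one" using eq by blast
  then obtain r where "phi (a - b) = (\<chi> e. r)" by (auto simp: line_one_def)
  then have "phi (a - b) = phi (\<chi> i. r / 2)" unfolding phi_const by simp
  then have ab: "a - b = (\<chi> i. r / 2)" using inj_phi by (simp add: inj_eq)
  have "(a - b) $ 0 = ((\<chi> i. r / 2) :: real^4) $ 0" by (simp only: ab)
  then have "r = 0" using a(3) b(3) by simp
  then have "a - b = 0" unfolding ab by (simp add: vec_eq_iff)
  then show ?thesis by simp
qed

lemma decomposition_ex:
  assumes S: "S \<in> max_cells (cells A)" and T: "T \<in> max_cells (cells G)"
  shows "x \<in> phi ` S + T \<longleftrightarrow> (\<exists>a\<in>S. x - phi a \<in> T \<and> a $ 0 = 0)"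
proof
  assume "x \<in> phi ` S + T"
  then obtain a y where a: "a \<in> S" "y \<in> T" "x = phi a + y" by (auto simp: set_plus_def)
  have aS: "a + (\<chi> i. - a $ 0) \<in> S" by (rule polyhedral_complexD(4)[OF complex_A max_cellsD(1)[OF S] a(1)])
  \<comment> \<open>Twice the shift of the curve point, because \<open>phi\<close> doubles
    constants.\<close>
  have "y + (\<chi> i. 2 * a $ 0) \<in> T" by (rule polyhedral_complexD(4)[OF complex_G max_cellsD(1)[OF T] a(2)])
  moreover have "x - phi (a + (\<chi> i. - a $ 0)) = y + (\<chi> i. 2 * a $ 0)"
    unfolding linear_add[OF linear_phi] phi_const a(3) by (simp add: vec_eq_iff)
  ultimately have "x - phi (a + (\<chi> i. - a $ 0)) \<in> T" by simp
  moreover have "(a + (\<chi> i. - a $ 0)) $ 0 = 0" by simp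
  ultimately show "\<exists>a\<in>S. x - phi a \<in> T \<and> a $ 0 = 0" using aS by blast
next
  assume "\<exists>a\<in>S. x - phi a \<in> T \<and> a $ 0 = 0"
  then obtain a where "a \<in> S" "x - phi a \<in> T" by blast
  then have "phi a + (x - phi a) \<in> phi ` S + T" by (intro set_plus_intro) auto
  then show "x \<in> phi ` S + T" by simp
qed

text \<open>All points of the curve that can contribute at \<open>x\<close>, including the one under
  investigation. The condition \<open>a $ 0 = 0\<close> picks one representative of each point of
  the quotient.\<close>

definition noise :: "real^pidx \<Rightarrow> (real^4) set" where
  "noise x = {a. a $ 0 = 0 \<and> (\<exists>S\<in>max_cells (cells A). \<exists>T\<in>max_cells (cells G).
     weight A S \<noteq> 0 \<and> a \<in> S \<and> x - phi a \<in> T \<and> mink_coeff G (lin_space S) T \<noteq> 0)}"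

lemma finite_noise: "finite (noise x)"
proof -
  let ?I = "{(S, T) \<in> max_cells (cells A) \<times> max_cells (cells G). weight A S \<noteq> 0 \<and> mink_coeff G (lin_space S) T \<noteq> 0}"
  have "finite (max_cells (cells A) \<times> max_cells (cells G))"
    using polyhedral_complexD(1)[OF complex_A] polyhedral_complexD(1)[OF complex_G] by (auto simp: max_cells_def)
  then have "finite ?I" by (rule rev_finite_subset) auto
  moreover have "finite {a. a $ 0 = 0 \<and> a \<in> fst p \<and> x - phi a \<in> snd p}" if p: "p \<in> ?I" for p
  proof (cases "\<exists>a. a $ 0 = 0 \<and> a \<in> fst p \<and> x - phi a \<in> snd p")
    case True
    then obtain a where a: "a $ 0 = 0" "a \<in> fst p" "x - phi a \<in> snd p" by blast
    have "{a. a $ 0 = 0 \<and> a \<in> fst p \<and> x - phi a \<in> snd p} \<subseteq> {a}"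
    proof
      fix b assume b: "b \<in> {a. a $ 0 = 0 \<and> a \<in> fst p \<and> x - phi a \<in> snd p}"
      have p': "fst p \<in> max_cells (cells A)" "weight A (fst p) \<noteq> 0" "snd p \<in> max_cells (cells G)"
        "mink_coeff G (lin_space (fst p)) (snd p) \<noteq> 0" using p by (simp_all add: case_prod_beta mem_Times_iff)
      have "b = a" by (rule decomposition_unique[OF p']) (use a b in simp_all)
      then show "b \<in> {a}" by simp
    qed
    then show ?thesis by (rule finite_subset) simp
  next
    case False
    then have none: "{a. a $ 0 = 0 \<and> a \<in> fst p \<and> x - phi a \<in> snd p} = {}" by blast
    show ?thesis by (simp only: none finite.emptyI)
  qed
  ultimately have "finite (\<Union>p\<in>?I. {a. a $ 0 = 0 \<and> a \<in> fst p \<and> x - phi a \<in> snd p})" by blast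
  moreover have "noise x \<subseteq> (\<Union>p\<in>?I. {a. a $ 0 = 0 \<and> a \<in> fst p \<and> x - phi a \<in> snd p})"
  proof
    fix a assume "a \<in> noise x"
    then obtain S T where ST: "S \<in> max_cells (cells A)" "T \<in> max_cells (cells G)" "weight A S \<noteq> 0"
      "mink_coeff G (lin_space S) T \<noteq> 0" and a: "a $ 0 = 0" "a \<in> S" "x - phi a \<in> T"
      unfolding noise_def by auto
    show "a \<in> (\<Union>p\<in>?I. {a. a $ 0 = 0 \<and> a \<in> fst p \<and> x - phi a \<in> snd p})"
      by (rule UN_I[of "(S, T)"]) (use ST a in simp_all)
  qed
  ultimately show ?thesis by (rule rev_finite_subset)
qed

text \<open>Turns a sum over pairs of cells into one over points: with a nonzero coefficient, a pair
  whose sum contains \<open>x\<close> has exactly one normalized decomposition, and the linear space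
  of \<open>S\<close> is determined by the point. \<open>W\<close> may exceed
  \<open>noise x\<close>, so that two curves can share it.\<close>

lemma mink_local_noise:
  assumes W: "finite W" "noise x \<subseteq> W" and line: "\<And>a. a \<in> W \<Longrightarrow> a \<notin> line_one" and zero: "\<And>a. a \<in> W \<Longrightarrow> a $ 0 = 0"
  shows "mink_local (push_wcomplex phi A) G x =
    (\<Sum>a\<in>W. weight_at A a * (\<Sum>T\<in>max_cells (cells G). if x - phi a \<in> T then mink_coeff G (span {a, \<chi> i. 1}) T else 0))"
proof -
  let ?M = "{S. S \<in> max_cells (cells A) \<and> weight A S \<noteq> 0}" and ?N = "max_cells (cells G)"
  let ?c = "\<lambda>a T. mink_coeff G (span {a, \<chi> i. 1}) T"
  have fin: "finite ?M" "finite ?N"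
    using polyhedral_complexD(1)[OF complex_A] polyhedral_complexD(1)[OF complex_G] by (auto simp: max_cells_def)
  have inner: "(if x \<in> phi ` S + T then weight A S * mink_coeff G (lin_space S) T else 0) =
      (\<Sum>a\<in>W. if a \<in> S \<and> x - phi a \<in> T then weight A S * ?c a T else 0)"
    if S: "S \<in> ?M" and T: "T \<in> ?N" for S T
  proof -
    have S': "S \<in> max_cells (cells A)" "weight A S \<noteq> 0" using S by auto
    have lin: "lin_space S = span {a, \<chi> i. 1}" if "a \<in> W" "a \<in> S" for a
      using lin_space_A(3)[OF S' that(2) line[OF that(1)]] .
    have "(\<Sum>a\<in>W. if a \<in> S \<and> x - phi a \<in> T then weight A S * ?c a T else 0) =
        (\<Sum>a\<in>W. if a \<in> S \<and> x - phi a \<in> T then weight A S * mink_coeff G (lin_space S) T else 0)"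
      by (intro sum.cong refl) (auto simp: lin)
    also have "\<dots> = (\<Sum>a | a \<in> W \<and> a \<in> S \<and> x - phi a \<in> T. weight A S * mink_coeff G (lin_space S) T)"
      by (rule sum.inter_filter[OF W(1), symmetric])
    also have "\<dots> = (if x \<in> phi ` S + T then weight A S * mink_coeff G (lin_space S) T else 0)"
    proof (cases "mink_coeff G (lin_space S) T = 0")
      case False
      show ?thesis
      proof (cases "x \<in> phi ` S + T")
        case True
        then obtain a where a: "a \<in> S" "x - phi a \<in> T" "a $ 0 = 0" using decomposition_ex[OF S'(1) T] by blast
        then have "a \<in> noise x" unfolding noise_def using S' T False by blast
        then have "a \<in> W" using W(2) by blast
        have "{a. a \<in> W \<and> a \<in> S \<and> x - phi a \<in> T} = {a}"
          using a \<open>a \<in> W\<close> zero decomposition_unique[OF S' T False] by auto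
        then show ?thesis using True by (simp only: sum.insert[OF finite.emptyI] sum.empty) simp
      next
        case False
        then have none: "{a. a \<in> W \<and> a \<in> S \<and> x - phi a \<in> T} = {}"
          using zero decomposition_ex[OF S'(1) T] by blast
        show ?thesis unfolding none using False by simp
      qed
    qed simp
    finally show ?thesis by simp
  qed
  have "mink_local (push_wcomplex phi A) G x =
      (\<Sum>S\<in>?M. \<Sum>T\<in>?N. \<Sum>a\<in>W. if a \<in> S \<and> x - phi a \<in> T then weight A S * ?c a T else 0)"
    unfolding mink_local_push using inner by (intro sum.cong refl) auto
  also have "\<dots> = (\<Sum>a\<in>W. \<Sum>S\<in>?M. \<Sum>T\<in>?N. if a \<in> S \<and> x - phi a \<in> T then weight A S * ?c a T else 0)"
  proof -
    have "(\<Sum>S\<in>?M. \<Sum>T\<in>?N. \<Sum>a\<in>W. if a \<in> S \<and> x - phi a \<in> T then weight A S * ?c a T else 0) =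
        (\<Sum>S\<in>?M. \<Sum>a\<in>W. \<Sum>T\<in>?N. if a \<in> S \<and> x - phi a \<in> T then weight A S * ?c a T else 0)"
      by (intro sum.cong refl sum.swap)
    then show ?thesis by (simp only: sum.swap[of _ W ?M])
  qed
  also have "\<dots> = (\<Sum>a\<in>W. weight_at A a * (\<Sum>T\<in>?N. if x - phi a \<in> T then ?c a T else 0))"
  proof (rule sum.cong[OF refl])
    fix a
    have w: "weight_at A a = (\<Sum>S\<in>?M. if a \<in> S then weight A S else 0)"
      unfolding weight_at_def using fin(1) by (simp add: sum.inter_filter[symmetric] conj_assoc)
    show "(\<Sum>S\<in>?M. \<Sum>T\<in>?N. if a \<in> S \<and> x - phi a \<in> T then weight A S * ?c a T else 0) =
        weight_at A a * (\<Sum>T\<in>?N. if x - phi a \<in> T then ?c a T else 0)"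
      unfolding w sum_product by (intro sum.cong refl) auto
  qed
  finally show ?thesis .
qed

text \<open>The condition on \<open>a\<close> is transversality: \<open>phi v\<close> lies in
  \<open>pair_space\<close> only if v_i = v_j and v_k = v_l, which leaves just the constants. The
  index is positive because both spaces have integral spanning vectors, that of the curve cell by
  rationality.\<close>

lemma mink_coeff_pair_nonzero:
  assumes d: "distinct [i, j, k, l]" and S: "S \<in> max_cells (cells A)" "weight A S \<noteq> 0"
    and a: "a \<in> S" "\<not> (a $ i = a $ j \<and> a $ k = a $ l)"
    and T: "T \<in> max_cells (cells G)" "lin_space T = pair_space i j k l" "weight G T \<noteq> 0"
  shows "mink_coeff G (lin_space S) T \<noteq> 0"
proof -
  have Sc: "S \<in> cells A" and Tc: "T \<in> cells G" using S(1) T(1) max_cellsD(1) by blast+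
  let ?V = "lin_space S"
  have one: "(\<chi> i. 1) \<in> ?V" by (rule cell_lin_space_const[OF complex_A Sc])
  note ds = dim_sum_le[OF one subspace_lin_space Tc]
  have anl: "a \<notin> line_one" using a(2) by (auto simp: line_one_def)
  have "phi ` ?V \<inter> lin_space T \<subseteq> line_one"
  proof
    fix z assume z: "z \<in> phi ` ?V \<inter> lin_space T"
    then obtain v where v: "v \<in> span {a, \<chi> i. 1}" "z = phi v" unfolding lin_space_A(3)[OF S a(1) anl] by blast
    then obtain r where "v - r *\<^sub>R a \<in> span {\<chi> i. 1}" using span_breakdown_eq by blast
    then obtain c where "v - r *\<^sub>R a = (\<chi> i. c)" unfolding span_one by (auto simp: line_one_def)
    then have vr: "v $ x = r * a $ x + c" for x by (simp add: vec_eq_iff) (metis add.commute diff_add_cancel)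
    obtain p q s where "z = pair_pt i j k l p q s" using z T(2) by (auto simp: pair_space_def)
    then have ps: "phi v = pair_pt i j k l p q s" using v by simp
    have "v $ i + v $ k = s" "v $ i + v $ l = s" "v $ j + v $ k = s" "v $ j + v $ l = s"
      using pair_pt_edge[OF d, of p q s] d phi_edge[of _ _ v] unfolding ps[symmetric] by auto
    then have "v $ k = v $ l" "v $ i = v $ j" by auto
    then have "r * (a $ k - a $ l) = 0" "r * (a $ i - a $ j) = 0" by (simp_all add: vr algebra_simps)
    then have "r = 0" using a(2) by auto
    then have "v = (\<chi> i. c)" using vr by (simp add: vec_eq_iff)
    then show "z \<in> line_one" unfolding v(2) phi_const by (metis const_in_line_one phi_const)
  qed
  then have "dim (phi ` ?V \<inter> lin_space T) = 1" using ds(2) dim_line_one by (metis subset_antisym)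
  then have d4: "dim (phi ` ?V + lin_space T) = 4"
    using ds(1) lin_space_A(1)[OF S] T(2) dim_pair_space[OF d] by simp
  obtain B where B: "finite B" "\<forall>b\<in>B. \<forall>i. b $ i \<in> \<int>" "?V = span B"
    using rational_polyhedron_lin_space[OF rational_A[OF Sc] polyhedral_complexD(3)[OF complex_A Sc]] by blast
  let ?Z = "{x::real^pidx. \<forall>i. x $ i \<in> \<int>}"
  let ?P = "{pair_pt i j k l 1 0 0, pair_pt i j k l 0 1 0, pair_pt i j k l 0 0 (1::real)}"
  have intB: "phi b $ e \<in> \<int>" if "b \<in> B" for b e using B(2) that by (simp add: phi_def)
  have intP: "p $ e \<in> \<int>" if "p \<in> ?P" for p e using that by (auto simp: pair_pt_def)
  have P: "?P \<subseteq> lin_space T" unfolding T(2) pair_space_def by (auto simp: image_iff)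
  have zero: "0 \<in> phi ` ?V" "0 \<in> lin_space T"
    using subspace_0[OF linear_subspace_image[OF linear_phi subspace_lin_space]] subspace_0[OF subspace_lin_space] by auto
  have "lattice_index ((phi ` ?V + lin_space T) \<inter> ?Z) (phi ` ?V \<inter> ?Z + lat T) > 0"
  proof (rule lattice_index_pos)
    show "finite (phi ` B \<union> ?P)" using B(1) by simp
    show "b $ e \<in> \<int>" if "b \<in> phi ` B \<union> ?P" for b e using that intB intP by blast
    have "phi b \<in> phi ` ?V \<inter> ?Z + lat T" if "b \<in> B" for b
    proof -
      have "phi b \<in> phi ` ?V \<inter> ?Z" using that intB B(3) by (auto intro: span_base)
      moreover have "0 \<in> lat T" using zero by (simp add: lat_def)
      ultimately have "phi b + 0 \<in> phi ` ?V \<inter> ?Z + lat T" by (rule set_plus_intro)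
      then show ?thesis by simp
    qed
    moreover have "p \<in> phi ` ?V \<inter> ?Z + lat T" if "p \<in> ?P" for p
    proof -
      have "p \<in> lat T" using that P intP by (auto simp: lat_def)
      moreover have "0 \<in> phi ` ?V \<inter> ?Z" using zero by simp
      ultimately have "0 + p \<in> phi ` ?V \<inter> ?Z + lat T" by (intro set_plus_intro)
      then show ?thesis by simp
    qed
    ultimately show "phi ` B \<union> ?P \<subseteq> phi ` ?V \<inter> ?Z + lat T" by blast
    have "phi ` ?V \<subseteq> span (phi ` B \<union> ?P)"
      unfolding B(3) linear_span_image[OF linear_phi, symmetric] by (intro span_mono) auto
    moreover have "lin_space T \<subseteq> span (phi ` B \<union> ?P)"
    proof
      fix y assume "y \<in> lin_space T"
      then obtain p q s where "y = pair_pt i j k l p q s" using T(2) by (auto simp: pair_space_def)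
      then have "y = p *\<^sub>R pair_pt i j k l 1 0 0 + q *\<^sub>R pair_pt i j k l 0 1 0 + s *\<^sub>R pair_pt i j k l 0 0 1"
        using distinct_edges[OF d] by (auto simp: pair_pt_def vec_eq_iff)
      then show "y \<in> span (phi ` B \<union> ?P)" by (auto intro!: span_add span_scale intro: span_base)
    qed
    ultimately show "(phi ` ?V + lin_space T) \<inter> ?Z \<subseteq> span (phi ` B \<union> ?P)"
      by (auto simp: set_plus_def intro!: span_add)
    have "0 + 0 \<in> phi ` ?V + lin_space T" using zero by (rule set_plus_intro)
    then show "(phi ` ?V + lin_space T) \<inter> ?Z \<noteq> {}" by (intro ex_in_conv[THEN iffD1] exI[of _ 0]) simp
    have lat0: "0 \<in> lat T" using zero by (simp add: lat_def)
    have "0 + 0 \<in> phi ` ?V \<inter> ?Z + lat T" using zero lat0 by (intro set_plus_intro) auto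
    then show "0 \<in> phi ` ?V \<inter> ?Z + lat T" by simp
    have subV: "subspace (phi ` ?V)" by (rule linear_subspace_image[OF linear_phi subspace_lin_space])
    show "u + v \<in> phi ` ?V \<inter> ?Z + lat T" if uv': "u \<in> phi ` ?V \<inter> ?Z + lat T" "v \<in> phi ` ?V \<inter> ?Z + lat T" for u v
    proof -
      obtain u1 u2 where u: "u = u1 + u2" "u1 \<in> phi ` ?V \<inter> ?Z" "u2 \<in> lat T"
        using uv'(1) by (rule set_plus_elim)
      obtain v1 v2 where v: "v = v1 + v2" "v1 \<in> phi ` ?V \<inter> ?Z" "v2 \<in> lat T"
        using uv'(2) by (rule set_plus_elim)
      note uv = u(1) v(1) u(2) v(2) u(3) v(3)
      have "u1 + v1 \<in> phi ` ?V \<inter> ?Z" using uv subspace_add[OF subV] by (auto intro: Ints_add)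
      moreover have "u2 + v2 \<in> lat T" using uv subspace_add[OF subspace_lin_space[of T]] by (auto simp: lat_def intro: Ints_add)
      ultimately have "(u1 + v1) + (u2 + v2) \<in> phi ` ?V \<inter> ?Z + lat T" by (rule set_plus_intro)
      then show ?thesis by (simp add: uv(1,2) add_ac)
    qed
    show "- u \<in> phi ` ?V \<inter> ?Z + lat T" if u: "u \<in> phi ` ?V \<inter> ?Z + lat T" for u
    proof -
      obtain u1 u2 where uv: "u = u1 + u2" "u1 \<in> phi ` ?V \<inter> ?Z" "u2 \<in> lat T"
        using u by (rule set_plus_elim)
      have "- u1 \<in> phi ` ?V \<inter> ?Z" using uv subspace_neg[OF subV] by auto
      moreover have "- u2 \<in> lat T" using uv subspace_neg[OF subspace_lin_space[of T]] by (auto simp: lat_def)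
      ultimately have "- u1 + - u2 \<in> phi ` ?V \<inter> ?Z + lat T" by (rule set_plus_intro)
      then show ?thesis by (simp add: uv(1))
    qed
  qed blast
  then show ?thesis using T(3) d4 by (simp add: mink_coeff_def)
qed

end

subsection \<open>Test points\<close>

lemma affine_linear_vimage:
  assumes "linear f" "affine L"
  shows "affine (f -` L)"
  using assms(2) unfolding affine_def by (simp add: linear_add[OF assms(1)] linear_scale[OF assms(1)])

lemma subspace_linear_preimage:
  assumes "linear f" "subspace L"
  shows "affine (f -` L)"
  using assms affine_linear_vimage subspace_imp_affine by blast

lemma vec4_decompose:
  fixes x :: "real^4"
  assumes d: "distinct [i, j, k, l]"
  shows "x = x $ i *\<^sub>R axis i 1 + x $ j *\<^sub>R axis j 1 + x $ k *\<^sub>R axis k 1 + x $ l *\<^sub>R axis l 1"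
    (is "x = ?r")
proof -
  have "x $ m = ?r $ m" for m
    using distinct_four_exhaust[OF d, of m] d by (elim disjE) (auto simp: axis_def)
  then show ?thesis by (rule vec_eq_iff[THEN iffD2, OF allI])
qed

lemma vec4_eqI:
  fixes x y :: "real^4"
  assumes d: "distinct [i, j, k, l]" and "x $ i = y $ i" "x $ j = y $ j" "x $ k = y $ k" "x $ l = y $ l"
  shows "x = y"
proof -
  have "x $ m = y $ m" for m
    using distinct_four_exhaust[OF d, of m] assms(2-) by auto
  then show ?thesis by (simp add: vec_eq_iff)
qed

text \<open>The span would contain e_i + e_j, its complement e_k + e_l and one unit vector, hence
  both unit vectors of one pair; the unequal coordinates of \<open>a\<close> then split the other
  pair. This yields the whole space, although the span has dimension at most 3.\<close>

lemma plane_avoids: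
  fixes P :: "(real^4) set"
  assumes d: "distinct [i, j, k, l]" and P: "subspace P" "dim P = 2" "(\<chi> i. 1) \<in> P"
    and a: "a $ i \<noteq> a $ j" "a $ k \<noteq> a $ l"
  shows "\<not> (a \<in> span (insert (axis m 1) P) \<and> axis i 1 + axis j 1 \<in> span (insert (axis m 1) P))"
proof
  let ?W = "span (insert (axis m 1) P)" and ?f = "axis i 1 + axis j 1 :: real^4"
  assume "a \<in> ?W \<and> ?f \<in> ?W"
  then have W: "a \<in> ?W" "?f \<in> ?W" "axis m 1 \<in> ?W" "(\<chi> i. 1) \<in> ?W"
    using P(3) by (auto intro: span_base)
  have g: "axis k 1 + axis l 1 \<in> ?W"
  proof -
    have "axis k 1 + axis l 1 = (\<chi> i. 1) - ?f"
      using d by (intro vec4_eqI[OF d]) (auto simp: axis_def)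
    then show ?thesis using W by (simp add: span_diff)
  qed
  have ij: "axis j 1 \<in> ?W \<and> axis i 1 \<in> ?W" if "axis k 1 \<in> ?W \<and> axis l 1 \<in> ?W"
  proof -
    have "(a $ j - a $ i) *\<^sub>R axis j 1 = a - a $ k *\<^sub>R axis k 1 - a $ l *\<^sub>R axis l 1 - a $ i *\<^sub>R ?f"
      using d by (intro vec4_eqI[OF d]) (auto simp: axis_def)
    then have "(a $ j - a $ i) *\<^sub>R axis j 1 \<in> ?W"
      using W that by (simp only:) (intro span_diff span_scale; simp)
    then have "(1 / (a $ j - a $ i)) *\<^sub>R ((a $ j - a $ i) *\<^sub>R axis j 1) \<in> ?W" by (rule span_scale)
    then have j: "axis j 1 \<in> ?W" using a(1) by simp
    have "axis i 1 = ?f - axis j 1" by simp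
    then show ?thesis using j W(2) by (metis span_diff)
  qed
  have kl: "axis k 1 \<in> ?W \<and> axis l 1 \<in> ?W" if "axis i 1 \<in> ?W \<and> axis j 1 \<in> ?W"
  proof -
    have "(a $ l - a $ k) *\<^sub>R axis l 1 = a - a $ i *\<^sub>R axis i 1 - a $ j *\<^sub>R axis j 1 - a $ k *\<^sub>R (axis k 1 + axis l 1)"
      using d by (intro vec4_eqI[OF d]) (auto simp: axis_def)
    then have "(a $ l - a $ k) *\<^sub>R axis l 1 \<in> ?W"
      using W that g by (simp only:) (intro span_diff span_scale; simp)
    then have "(1 / (a $ l - a $ k)) *\<^sub>R ((a $ l - a $ k) *\<^sub>R axis l 1) \<in> ?W" by (rule span_scale)
    then have l: "axis l 1 \<in> ?W" using a(2) by simp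
    have "axis k 1 = (axis k 1 + axis l 1) - (axis l 1 :: real^4)" by simp
    then show ?thesis using l g by (metis span_diff)
  qed
  have pair: "axis x 1 \<in> ?W \<and> axis y 1 \<in> ?W"
    if "axis x 1 + axis y 1 \<in> ?W" "m = x \<or> m = y" for x y :: 4
    using span_diff[OF that(1) W(3)] W(3) that(2) by auto
  have all: "axis i 1 \<in> ?W" "axis j 1 \<in> ?W" "axis k 1 \<in> ?W" "axis l 1 \<in> ?W"
    using distinct_four_exhaust[OF d, of m] pair[OF W(2)] pair[OF g] ij kl by blast+
  have "x \<in> ?W" for x
    by (subst vec4_decompose[OF d]) (intro span_add span_scale all)
  then have "?W = UNIV" by blast
  then have "dim ?W = dim (UNIV :: (real^4) set)" by simp
  then have "dim (insert (axis m 1) P) = 4" by simp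
  then show False using P(2) by (auto simp: dim_insert split: if_splits)
qed

text \<open>Solves the conditions of the four triangles. In the first alternative \<open>z\<close>
  is a multiple of e_i + e_j up to a constant, and the shifted point stays over the same two edges.
  In the others one pair of coordinates is torn apart, and the position of the pairs relative to
  each other is fixed by \<open>p - r\<close> or \<open>q - r\<close>.\<close>

lemma (in trop_lines) noise_cases:
  assumes d: "distinct [i, j, k, l]" and "r < p" "r < q" and z: "pair_pt i j k l p q r - phi z \<in> \<Union>(cells G)"
  shows "(z $ i = z $ j \<and> z $ k = z $ l \<and> r - q \<le> z $ i - z $ k \<and> z $ i - z $ k \<le> p - r) \<or>
    (z $ k = z $ l \<and> min (z $ i) (z $ j) = z $ k + (p - r) \<and> z $ i \<noteq> z $ j) \<or>
    (z $ i = z $ j \<and> min (z $ k) (z $ l) = z $ i + (q - r) \<and> z $ k \<noteq> z $ l)"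
proof -
  let ?y = "pair_pt i j k l p q r - phi z"
  have ne: "i \<noteq> j" "i \<noteq> k" "i \<noteq> l" "j \<noteq> k" "j \<noteq> l" "k \<noteq> l" using d by auto
  have y: "?y $ edge i j = p - (z $ i + z $ j)" "?y $ edge k l = q - (z $ k + z $ l)"
    "?y $ edge i k = r - (z $ i + z $ k)" "?y $ edge i l = r - (z $ i + z $ l)"
    "?y $ edge j k = r - (z $ j + z $ k)" "?y $ edge j l = r - (z $ j + z $ l)"
    using ne by (simp_all add: pair_pt_edge[OF d] phi_edge)
  note comm = edge_commute[of k i] edge_commute[of l i] edge_commute[of l j]
  have "two_min (p - (z $ i + z $ j)) (r - (z $ j + z $ k)) (r - (z $ i + z $ k))"
    using two_min_G[OF z, of i j k] ne unfolding comm y by simp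
  moreover have "two_min (p - (z $ i + z $ j)) (r - (z $ j + z $ l)) (r - (z $ i + z $ l))"
    using two_min_G[OF z, of i j l] ne unfolding comm y by simp
  moreover have "two_min (r - (z $ i + z $ k)) (q - (z $ k + z $ l)) (r - (z $ i + z $ l))"
    using two_min_G[OF z, of i k l] ne unfolding comm y by simp
  moreover have "two_min (r - (z $ j + z $ k)) (q - (z $ k + z $ l)) (r - (z $ j + z $ l))"
    using two_min_G[OF z, of j k l] ne unfolding comm y by simp
  ultimately show ?thesis using assms(2,3) unfolding two_min_def min_def by (smt (verit))
qed

section \<open>Dimension bounds for the sum\<close>

context fan_curve_sum
begin

lemma aff_dim_phi_plus:
  assumes N: "N \<noteq> {}" "(\<chi> i. 1) \<in> lin_space N" and T: "T \<in> cells G"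
  shows "aff_dim (phi ` N + T) \<le> aff_dim N + aff_dim T - 1"
proof -
  have Tne: "T \<noteq> {}" by (rule polyhedral_complexD(3)[OF complex_G T])
  have ne: "phi ` N \<noteq> {}" using N(1) by simp
  have ne': "phi ` N + T \<noteq> {}" using ne Tne by (auto simp: set_plus_def)
  have lin: "lin_space (phi ` N + T) = phi ` lin_space N + lin_space T"
    using lin_space_plus[OF ne Tne] lin_space_linear_image[OF linear_phi] by simp
  note ds = dim_sum_le[OF N(2) subspace_lin_space T]
  have "dim (phi ` lin_space N \<inter> lin_space T) \<ge> 1" using dim_subset[OF ds(2)] by (simp add: dim_line_one)
  then have "dim (lin_space (phi ` N + T)) + 1 \<le> dim (lin_space N) + dim (lin_space T)"
    using ds(1) unfolding lin by simp
  then show ?thesis using aff_dim_lin_space[OF N(1)] aff_dim_lin_space[OF Tne] aff_dim_lin_space[OF ne'] by simp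
qed

text \<open>A cell of the sum need not lie in a single \<open>S + T\<close>, but being convex it
  lies in the affine hull of one; the summands of dimensions 2 and 3 share a line.\<close>

lemma aff_dim_sum_cell:
  assumes Z: "minkowski_sum (push_wcomplex phi A) G Z" and N: "N \<in> cells Z"
  shows "aff_dim N \<le> 4"
proof -
  define \<A> where "\<A> = (\<lambda>(S, T). affine hull (phi ` S + T)) ` (cells A \<times> cells G)"
  note pc = minkowski_sumD(1)[OF Z]
  have "\<exists>L\<in>\<A>. N \<subseteq> L"
  proof (rule convex_subset_Union_affine)
    show "finite \<A>"
      unfolding \<A>_def using polyhedral_complexD(1)[OF complex_A] polyhedral_complexD(1)[OF complex_G] by simp
    show "affine L" if "L \<in> \<A>" for L using that by (auto simp: \<A>_def)
    show "convex N" "N \<noteq> {}" using polyhedral_complexD(3,7)[OF pc N] by auto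
    show "N \<subseteq> \<Union>\<A>"
    proof
      fix x assume "x \<in> N"
      then have "x \<in> \<Union>(cells Z)" using N by blast
      then obtain u v where uv: "x = u + v" "u \<in> \<Union>(cells (push_wcomplex phi A))" "v \<in> \<Union>(cells G)"
        unfolding minkowski_sumD(2)[OF Z] by blast
      then obtain S T where ST: "S \<in> cells A" "u \<in> phi ` S" "T \<in> cells G" "v \<in> T"
        by (auto simp: push_wcomplex_def)
      then have "x \<in> phi ` S + T" using uv(1) by (simp add: set_plus_intro)
      then have "x \<in> affine hull (phi ` S + T)" by (rule hull_inc)
      moreover have "affine hull (phi ` S + T) \<in> \<A>" using ST by (auto simp: \<A>_def)
      ultimately show "x \<in> \<Union>\<A>" by blast
    qed
  qed
  then obtain S T where ST: "S \<in> cells A" "T \<in> cells G" "N \<subseteq> affine hull (phi ` S + T)"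
    by (auto simp: \<A>_def)
  have "aff_dim N \<le> aff_dim (phi ` S + T)" using aff_dim_subset[OF ST(3)] by simp
  also have "\<dots> \<le> aff_dim S + aff_dim T - 1"
    using polyhedral_complexD(3)[OF complex_A ST(1)] cell_lin_space_const[OF complex_A ST(1)] ST(2)
    by (rule aff_dim_phi_plus)
  also have "\<dots> \<le> 4" using aff_dim_A[OF ST(1)] aff_dim_G[OF ST(2)] by simp
  finally show ?thesis .
qed

lemma aff_dim_sum_nonmax:
  assumes Z: "minkowski_sum (push_wcomplex phi A) G Z" and N: "N \<in> cells Z - max_cells (cells Z)"
  shows "aff_dim N \<le> 3"
proof -
  obtain U where U: "U \<in> max_cells (cells Z)" "aff_dim N < aff_dim U"
    using nonmax_cell_aff_dim[OF minkowski_sumD(1)[OF Z] N] by blast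
  then show ?thesis using aff_dim_sum_cell[OF Z max_cellsD(1)[OF U(1)]] by simp
qed

text \<open>Planes replace cells in the arguments about nearby points: they are finitely many closed
  subspaces, and every contributing point lies in one.\<close>

definition planes :: "(real^4) set set" where
  "planes = lin_space ` {S \<in> max_cells (cells A). weight A S \<noteq> 0}"

lemma finite_planes: "finite planes"
  using polyhedral_complexD(1)[OF complex_A] by (simp add: planes_def max_cells_def)

lemma planesD:
  assumes "P \<in> planes"
  shows "subspace P" "dim P = 2" "(\<chi> i. c) \<in> P"
proof -
  obtain S where S: "S \<in> max_cells (cells A)" "weight A S \<noteq> 0" "P = lin_space S"
    using assms by (auto simp: planes_def)
  show "subspace P" unfolding S(3) by (rule subspace_lin_space)
  show "dim P = 2" unfolding S(3) by (rule lin_space_A(1)[OF S(1,2)])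
  show "(\<chi> i. c) \<in> P" unfolding S(3) by (rule cell_lin_space_const[OF complex_A max_cellsD(1)[OF S(1)]])
qed

lemma noiseD:
  assumes "a \<in> noise x"
  obtains P T where "a $ 0 = 0" "P \<in> planes" "a \<in> P" "T \<in> cells G" "x - phi a \<in> T"
proof -
  obtain S T where *: "a $ 0 = 0" "S \<in> max_cells (cells A)" "T \<in> max_cells (cells G)" "weight A S \<noteq> 0"
    "a \<in> S" "x - phi a \<in> T"
    using assms by (auto simp: noise_def)
  then show thesis using that[of "lin_space S" T] lin_space_A(2)[of S] max_cellsD(1)[OF *(3)] by (auto simp: planes_def)
qed

end

text \<open>The four parameters map injectively, so a box of them has a 4-dimensional image, which
  finitely many affine spaces of dimension at most 3 cannot cover. Conditions on the point belong to
  \<open>\<F>\<close>, conditions on the parameters themselves to \<open>\<B>\<close>.\<close>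

lemma generic_parameter:
  fixes \<B> :: "(real \<times> real \<times> real \<times> real) set set"
  assumes d: "distinct [i, j, k, l]" and a: "\<not> (a $ i = a $ j \<and> a $ k = a $ l)" and e: "e > 0"
    and L: "finite \<F>" "\<And>L. L \<in> \<F> \<Longrightarrow> affine L \<and> aff_dim L \<le> 3"
    and H: "finite \<B>" "\<And>H. H \<in> \<B> \<Longrightarrow> affine H \<and> H \<noteq> UNIV"
  obtains s p q r where "\<bar>s - 1\<bar> < e" "r < p" "r < q" "p - r < e" "q - r < e"
    "(s, p, q, r) \<notin> \<Union>\<B>" "s *\<^sub>R phi a + pair_pt i j k l p q r \<notin> \<Union>\<F>"
proof -
  define pt where "pt = (\<lambda>(s, p, q, r). s *\<^sub>R phi a + pair_pt i j k l p q r)"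
  \<comment> \<open>The bound e / 3 separates \<open>r\<close> from \<open>p\<close> and
    \<open>q\<close>, and e bounds the differences.\<close>
  let ?U = "{1 - e<..<1 + e} \<times> {e / 3<..<e} \<times> {e / 3<..<e} \<times> {0<..<e / 3}"
  have lin_pt: "linear pt"
    unfolding pt_def by (rule linearI) (auto simp: pair_pt_def vec_eq_iff algebra_simps)
  have "inj pt"
  proof (rule linear_injective_0[OF lin_pt, THEN iffD2], intro allI impI)
    fix v assume v: "pt v = 0"
    obtain s p q r where spqr: "v = (s, p, q, r)" by (cases v)
    have ne: "i \<noteq> j" "i \<noteq> k" "i \<noteq> l" "j \<noteq> k" "j \<noteq> l" "k \<noteq> l" using d by auto
    have "pt v $ e = 0" for e using v by simp
    then have z: "s * phi a $ e + pair_pt i j k l p q r $ e = 0" for e by (simp add: pt_def spqr)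
    have eqs: "s * (a $ i + a $ j) + p = 0" "s * (a $ k + a $ l) + q = 0" "s * (a $ i + a $ k) + r = 0"
      "s * (a $ i + a $ l) + r = 0" "s * (a $ j + a $ k) + r = 0"
      using z[of "edge i j"] z[of "edge k l"] z[of "edge i k"] z[of "edge i l"] z[of "edge j k"]
      by (simp_all add: pair_pt_edge[OF d] phi_edge ne)
    have "s * (a $ k - a $ l) = 0" "s * (a $ i - a $ j) = 0"
      using eqs(3-5) unfolding right_diff_distrib distrib_left by linarith+
    then have "s = 0" using a by auto
    then show "v = 0" using eqs by (simp add: spqr zero_prod_def)
  qed
  have U: "convex ?U" "open ?U" "?U \<noteq> {}"
    using e by (auto intro!: convex_Times open_Times simp: convex_real_interval)
  have "\<exists>v\<in>?U. \<forall>M\<in>\<B> \<union> (-`) pt ` \<F>. v \<notin> M"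
  proof (rule convex_avoid_affine)
    show "finite (\<B> \<union> (-`) pt ` \<F>)" using L(1) H(1) by simp
    show "affine M" if "M \<in> \<B> \<union> (-`) pt ` \<F>" for M
      using that H(2) L(2) affine_linear_vimage[OF lin_pt] by blast
    show "\<not> ?U \<subseteq> M" if "M \<in> \<B> \<union> (-`) pt ` \<F>" for M
    proof
      assume sub: "?U \<subseteq> M"
      consider "M \<in> \<B>" | L where "L \<in> \<F>" "M = pt -` L" using \<open>M \<in> _\<close> by blast
      then show False
      proof cases
        case 1
        then have "affine hull ?U \<subseteq> M" using sub H(2) by (intro hull_minimal) auto
        then show False using affine_hull_open[OF U(2,3)] H(2)[OF 1] by auto
      next
        case 2
        have "aff_dim (pt ` ?U) = aff_dim ?U" by (rule aff_dim_injective_linear_image[OF lin_pt \<open>inj pt\<close>])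
        also have "\<dots> = 4" using aff_dim_open[OF U(2,3)] by simp
        finally have "aff_dim (pt ` ?U) = 4" .
        moreover have "pt ` ?U \<subseteq> L" using sub 2(2) by blast
        then have "aff_dim (pt ` ?U) \<le> aff_dim L" by (rule aff_dim_subset)
        ultimately show False using L(2)[OF 2(1)] by simp
      qed
    qed
  qed (use U in auto)
  then obtain v where v: "v \<in> ?U" "\<forall>M\<in>\<B> \<union> (-`) pt ` \<F>. v \<notin> M" by (rule bexE)
  obtain s p q r where spqr: "v = (s, p, q, r)" by (cases v)
  show thesis
  proof (rule that[of s r p q])
    show "\<bar>s - 1\<bar> < e" "r < p" "r < q" "p - r < e" "q - r < e" using v(1) by (auto simp: spqr)
    show "(s, p, q, r) \<notin> \<Union>\<B>" using v(2) by (auto simp: spqr)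
    show "s *\<^sub>R phi a + pair_pt i j k l p q r \<notin> \<Union>\<F>"
    proof
      assume "s *\<^sub>R phi a + pair_pt i j k l p q r \<in> \<Union>\<F>"
      then obtain L where "L \<in> \<F>" "pt v \<in> L" by (auto simp: pt_def spqr)
      then show False using v(2) by auto
    qed
  qed
qed

lemma ex_distinct_four_with: "\<exists>j k l. distinct [i :: 4, j, k, l]"
proof -
  obtain w x y z :: 4 where d: "distinct [w, x, y, z]" using ex_distinct_four by blast
  consider "i = w" | "i = x" | "i = y" | "i = z" using distinct_four_exhaust[OF d] by blast
  then show ?thesis
  proof cases
    case 1
    then show ?thesis using d by blast
  next
    case 2
    then have "distinct [i, w, y, z]" using d by auto
    then show ?thesis by blast
  next
    case 3
    then have "distinct [i, w, x, z]" using d by auto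
    then show ?thesis by blast
  next
    case 4
    then have "distinct [i, w, x, y]" using d by auto
    then show ?thesis by blast
  qed
qed

section \<open>Comparing two curves with equal sums\<close>

locale two_fan_curves = trop_lines G K + a: fan_curve_sum A \<Gamma> G K + b: fan_curve_sum B \<Gamma> G K
  for A B :: "4 wcomplex" and \<Gamma> :: "real set" and G :: "pidx wcomplex"
    and K :: "'k::{alg_closed_field, valued_field} itself" +
  fixes Z Z' :: "pidx wcomplex"
  assumes sum_A: "minkowski_sum (push_wcomplex phi A) G Z"
    and sum_B: "minkowski_sum (push_wcomplex phi B) G Z'" and sums_eq: "Z \<approx>\<^sub>w Z'"
begin

definition vertices :: "(real^4) set set" where
  "vertices = (cells A - max_cells (cells A)) \<union> (cells B - max_cells (cells B))"

text \<open>Only \<open>T0\<close> pairs with \<open>p\<close>, so \<open>p\<close> enters with one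
  nonzero coefficient that depends on its plane alone. If all other contributing points have equal
  weights, the equality of the sums leaves the equality at \<open>p\<close>. A \<open>p\<close> that
  does not contribute lies outside both supports.\<close>

lemma test_point:
  assumes eq: "mink_local (push_wcomplex phi A) G x = mink_local (push_wcomplex phi B) G x"
    and p: "p $ 0 = 0" "p \<notin> line_one"
    and T0: "T0 \<in> max_cells (cells G)" "\<And>T. T \<in> max_cells (cells G) \<Longrightarrow> x - phi p \<in> T \<longleftrightarrow> T = T0"
    and cA: "\<And>S. S \<in> max_cells (cells A) \<Longrightarrow> weight A S \<noteq> 0 \<Longrightarrow> p \<in> S \<Longrightarrow> mink_coeff G (lin_space S) T0 \<noteq> 0"
    and cB: "\<And>S. S \<in> max_cells (cells B) \<Longrightarrow> weight B S \<noteq> 0 \<Longrightarrow> p \<in> S \<Longrightarrow> mink_coeff G (lin_space S) T0 \<noteq> 0"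
    and noise: "\<And>a. a \<in> a.noise x \<union> b.noise x \<Longrightarrow> a \<noteq> p \<Longrightarrow> a \<notin> line_one \<and> weight_at A a = weight_at B a"
  shows "weight_at A p = weight_at B p"
proof -
  define W where "W = a.noise x \<union> b.noise x"
  have fin: "finite W" by (simp add: W_def a.finite_noise b.finite_noise)
  have line: "a \<notin> line_one" if "a \<in> W" for a using noise[of a] that p(2) unfolding W_def by blast
  have zero: "a $ 0 = 0" if "a \<in> W" for a using that by (auto simp: W_def a.noise_def b.noise_def)
  let ?c = "\<lambda>a. \<Sum>T\<in>max_cells (cells G). if x - phi a \<in> T then mink_coeff G (span {a, \<chi> i. 1}) T else 0"
  have "(\<Sum>a\<in>W. weight_at A a * ?c a) = (\<Sum>a\<in>W. weight_at B a * ?c a)"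
    using eq a.mink_local_noise[OF fin _ line zero, of x] b.mink_local_noise[OF fin _ line zero, of x]
    by (simp add: W_def)
  then have sum0: "(\<Sum>a\<in>W. (weight_at A a - weight_at B a) * ?c a) = 0"
    by (simp add: left_diff_distrib sum_subtractf)
  show ?thesis
  proof (cases "p \<in> W")
    case True
    have "(\<Sum>a\<in>W. (weight_at A a - weight_at B a) * ?c a) = (\<Sum>a\<in>{p}. (weight_at A a - weight_at B a) * ?c a)"
      using fin True noise by (intro sum.mono_neutral_right) (auto simp: W_def)
    then have "(weight_at A p - weight_at B p) * ?c p = 0" using sum0 by simp
    moreover have "?c p = mink_coeff G (span {p, \<chi> i. 1}) T0"
    proof -
      have "?c p = (\<Sum>T\<in>max_cells (cells G). if T = T0 then mink_coeff G (span {p, \<chi> i. 1}) T else 0)"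
        by (intro sum.cong refl) (simp add: T0(2))
      then show ?thesis using T0(1) polyhedral_complexD(1)[OF complex_G] by (simp add: sum.delta max_cells_def)
    qed
    moreover have "mink_coeff G (span {p, \<chi> i. 1}) T0 \<noteq> 0"
    proof -
      consider S where "S \<in> max_cells (cells A)" "weight A S \<noteq> 0" "p \<in> S"
        | S where "S \<in> max_cells (cells B)" "weight B S \<noteq> 0" "p \<in> S"
        using True by (auto simp: W_def a.noise_def b.noise_def)
      then show ?thesis
      proof cases
        case 1
        then show ?thesis using cA[OF 1] a.lin_space_A(3)[OF 1 p(2)] by simp
      next
        case 2
        then show ?thesis using cB[OF 2] b.lin_space_A(3)[OF 2 p(2)] by simp
      qed
    qed
    ultimately show ?thesis by simp
  next
    case False
    have "p \<notin> support A"
    proof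
      assume "p \<in> support A"
      then obtain S where S: "S \<in> max_cells (cells A)" "weight A S \<noteq> 0" "p \<in> S" by (auto simp: support_def)
      then have "p \<in> a.noise x" using T0 cA[OF S] p(1) by (auto simp: a.noise_def)
      then show False using False by (simp add: W_def)
    qed
    moreover have "p \<notin> support B"
    proof
      assume "p \<in> support B"
      then obtain S where S: "S \<in> max_cells (cells B)" "weight B S \<noteq> 0" "p \<in> S" by (auto simp: support_def)
      then have "p \<in> b.noise x" using T0 cB[OF S] p(1) by (auto simp: b.noise_def)
      then show False using False by (simp add: W_def)
    qed
    ultimately show ?thesis by (simp add: weight_at_outside)
  qed
qed

lemma vertices_aff_dim:
  assumes "N \<in> vertices"
  shows "N \<noteq> {}" "(\<chi> i. 1) \<in> lin_space N" "aff_dim N \<le> 1"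
proof -
  consider "N \<in> cells A - max_cells (cells A)" | "N \<in> cells B - max_cells (cells B)"
    using assms by (auto simp: vertices_def)
  then have "N \<noteq> {} \<and> (\<chi> i. 1) \<in> lin_space N \<and> aff_dim N \<le> 1"
  proof cases
    case 1
    then have "N \<in> cells A" by simp
    then show ?thesis
      using polyhedral_complexD(3)[OF a.complex_A] cell_lin_space_const[OF a.complex_A] a.nonmax_A[OF 1] by simp
  next
    case 2
    then have "N \<in> cells B" by simp
    then show ?thesis
      using polyhedral_complexD(3)[OF b.complex_A] cell_lin_space_const[OF b.complex_A] b.nonmax_A[OF 2] by simp
  qed
  then show "N \<noteq> {}" "(\<chi> i. 1) \<in> lin_space N" "aff_dim N \<le> 1" by auto
qed

lemma line_one_aff_dim:
  "(line_one :: (real^4) set) \<noteq> {}" "(\<chi> i. 1) \<in> lin_space (line_one :: (real^4) set)" "aff_dim (line_one :: (real^4) set) \<le> 1"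
proof -
  show "(line_one :: (real^4) set) \<noteq> {}" using const_in_line_one by blast
  have "(\<chi> i. 1) - (\<chi> i. 0) \<in> lin_space (line_one :: (real^4) set)"
    by (rule diff_in_lin_space) (rule const_in_line_one)+
  moreover have "(\<chi> i. 1) - (\<chi> i. 0) = ((\<chi> i. 1) :: real^4)" by (simp add: vec_eq_iff)
  ultimately show "(\<chi> i. 1) \<in> lin_space (line_one :: (real^4) set)" by simp
  show "aff_dim (line_one :: (real^4) set) \<le> 1"
    by (simp add: aff_dim_subspace[OF subspace_line_one] dim_line_one)
qed

text \<open>Avoiding these makes \<open>x\<close> generic for both sums, keeps contributing points
  off the vertices and off the origin of the quotient, and keeps the chosen summand
  \<open>pair_pt\<close> off the lower-dimensional cells of \<open>G\<close>.\<close>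

definition bad_spaces :: "real^4 \<Rightarrow> (real^pidx) set set" where
  "bad_spaces a = (hull) affine ` ((cells Z - max_cells (cells Z)) \<union> (cells Z' - max_cells (cells Z'))
     \<union> (\<lambda>(N, T). phi ` N + T) ` (insert line_one vertices \<times> cells G)
     \<union> (\<lambda>N. phi ` span {a, \<chi> i. 1} + N) ` (cells G - max_cells (cells G)))"

lemma bad_spaces:
  shows "finite (bad_spaces a)" and "L \<in> bad_spaces a \<Longrightarrow> affine L \<and> aff_dim L \<le> 3"
proof -
  show "finite (bad_spaces a)"
    unfolding bad_spaces_def vertices_def
    using polyhedral_complexD(1)[OF minkowski_sumD(1)[OF sum_A]] polyhedral_complexD(1)[OF minkowski_sumD(1)[OF sum_B]]
      polyhedral_complexD(1)[OF complex_G] polyhedral_complexD(1)[OF a.complex_A] polyhedral_complexD(1)[OF b.complex_A]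
    by simp
  assume L: "L \<in> bad_spaces a"
  have small: "aff_dim (phi ` N + T) \<le> 3"
    if "N \<noteq> {}" "(\<chi> i. 1) \<in> lin_space N" "aff_dim N \<le> 1" "T \<in> cells G" for N T
    using a.aff_dim_phi_plus[OF that(1,2,4)] that(3) aff_dim_G[OF that(4)] by simp
  from L obtain M where M: "L = affine hull M" "M \<in> (cells Z - max_cells (cells Z)) \<union> (cells Z' - max_cells (cells Z'))
     \<union> (\<lambda>(N, T). phi ` N + T) ` (insert line_one vertices \<times> cells G)
     \<union> (\<lambda>N. phi ` span {a, \<chi> i. 1} + N) ` (cells G - max_cells (cells G))"
    unfolding bad_spaces_def by (rule imageE)
  from M(2) consider "M \<in> cells Z - max_cells (cells Z)" | "M \<in> cells Z' - max_cells (cells Z')"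
    | "M \<in> (\<lambda>(N, T). phi ` N + T) ` (insert line_one vertices \<times> cells G)"
    | "M \<in> (\<lambda>N. phi ` span {a, \<chi> i. 1} + N) ` (cells G - max_cells (cells G))"
    by (elim UnE)
  then have "aff_dim M \<le> 3"
  proof cases
    case 1
    then show ?thesis using a.aff_dim_sum_nonmax[OF sum_A 1] by simp
  next
    case 2
    then show ?thesis using b.aff_dim_sum_nonmax[OF sum_B 2] by simp
  next
    case 3
    then obtain N T where NT: "M = phi ` N + T" "N \<in> insert line_one vertices" "T \<in> cells G" by auto
    then have "N \<noteq> {} \<and> (\<chi> i. 1) \<in> lin_space N \<and> aff_dim N \<le> 1"
      using vertices_aff_dim[of N] line_one_aff_dim by blast
    then show ?thesis unfolding NT(1) using small[of N T] NT(3) by blast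
  next
    case 4
    then obtain N where N: "M = phi ` span {a, \<chi> i. 1} + N" "N \<in> cells G - max_cells (cells G)" by (rule imageE)
    let ?P = "span {a, \<chi> i. 1} :: (real^4) set"
    have ne: "?P \<noteq> {}" using span_0 by blast
    have "(\<chi> i. 1) - 0 \<in> lin_space ?P" by (intro diff_in_lin_space) (auto intro: span_base span_0)
    then have one: "(\<chi> i. 1) \<in> lin_space ?P" by simp
    have "dim {a, \<chi> i. 1} \<le> 2" using dim_le_card'[of "{a, \<chi> i. 1}"] card_insert_le_m1[of 2 "{\<chi> i. 1}" a] by simp
    then have "aff_dim ?P \<le> 2" using aff_dim_subspace[OF subspace_span, of "{a, \<chi> i. 1}"] by simp
    then show ?thesis
      unfolding N(1) using a.aff_dim_phi_plus[OF ne one, of N] N(2) nonmax_G[OF N(2)] by simp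
  qed
  then show "affine L \<and> aff_dim L \<le> 3" using M(1) by simp
qed

text \<open>Disposes of the displacements along e_i + e_j, so that only the two other alternatives
  of \<open>noise_cases\<close> remain as a hypothesis. Planes missing \<open>a0\<close> have
  positive distance from it, so a short displacement happens in a plane through \<open>a0\<close>;
  that plane cannot also contain e_i + e_j, since \<open>a0\<close> would then have equal
  coordinates in both pairs.\<close>

lemma weight_at_eq_by_noise:
  fixes \<B> :: "(real \<times> real \<times> real \<times> real) set set"
  assumes d: "distinct [i, j, k, l]"
    and a0: "a0 \<notin> \<Union>vertices" "\<not> (a0 $ i = a0 $ j \<and> a0 $ k = a0 $ l)"
    and B: "finite \<B>" "\<And>H. H \<in> \<B> \<Longrightarrow> affine H \<and> H \<noteq> UNIV"
    and noise: "\<And>s p q r a P. s > 0 \<Longrightarrow> r < p \<Longrightarrow> r < q \<Longrightarrow> (s, p, q, r) \<notin> \<Union>\<B> \<Longrightarrow>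
      P \<in> a.planes \<union> b.planes \<Longrightarrow> a \<in> P \<Longrightarrow> a \<notin> \<Union>vertices \<Longrightarrow> a \<notin> line_one \<Longrightarrow>
      (let z = a - s *\<^sub>R a0 in
        (z $ k = z $ l \<and> min (z $ i) (z $ j) = z $ k + (p - r) \<and> z $ i \<noteq> z $ j) \<or>
        (z $ i = z $ j \<and> min (z $ k) (z $ l) = z $ i + (q - r) \<and> z $ k \<noteq> z $ l)) \<Longrightarrow>
      weight_at A a = weight_at B a"
  shows "weight_at A a0 = weight_at B a0"
proof -
  let ?f = "axis i 1 + axis j 1 :: real^4"
  have ne: "i \<noteq> j" "i \<noteq> k" "i \<noteq> l" "j \<noteq> k" "j \<noteq> l" "k \<noteq> l" using d by auto
  have line: "a0 \<notin> line_one" using a0(2) by (auto simp: line_one_def)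
  define V where "V = {P \<in> a.planes \<union> b.planes. a0 \<notin> P}"
  have sub: "subspace P" "dim P = 2" "(\<chi> i. c) \<in> P" if "P \<in> a.planes \<union> b.planes" for P c
    using that a.planesD b.planesD by auto
  have "closed (\<Union>V)"
    by (rule closed_Union) (auto simp: V_def a.finite_planes b.finite_planes intro!: closed_subspace sub)
  moreover have "a0 \<in> - \<Union>V" by (auto simp: V_def)
  ultimately obtain \<delta> where \<delta>: "\<delta> > 0" "ball a0 \<delta> \<subseteq> - \<Union>V" using openE open_Compl by metis
  obtain eA where eA: "eA > 0" "\<And>s. \<bar>s - 1\<bar> < eA \<Longrightarrow> weight_at A (s *\<^sub>R a0) = weight_at A a0"
    using a.weight_at_scale[of a0] a0(1) by (auto simp: vertices_def)
  obtain eB where eB: "eB > 0" "\<And>s. \<bar>s - 1\<bar> < eB \<Longrightarrow> weight_at B (s *\<^sub>R a0) = weight_at B a0"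
    using b.weight_at_scale[of a0] a0(1) by (auto simp: vertices_def)
  \<comment> \<open>\<open>eA\<close> and \<open>eB\<close> protect the weights under scaling, 1 / 2
    keeps \<open>s\<close> away from 0, and the last bound keeps the displaced point within \<delta>
    of \<open>a0\<close>.\<close>
  define e where "e = Min {eA, eB, 1 / 2, \<delta> / (2 * (norm ?f + 1))}"
  have "\<delta> / (2 * (norm ?f + 1)) > 0" using \<delta>(1) by (intro divide_pos_pos mult_pos_pos add_nonneg_pos) auto
  then have "e > 0" unfolding e_def using eA(1) eB(1) by (subst Min_gr_iff) auto
  moreover have "e \<le> eA" "e \<le> eB" "e \<le> 1 / 2" "e \<le> \<delta> / (2 * (norm ?f + 1))"
    unfolding e_def by (intro Min_le; simp)+
  ultimately have e: "e > 0" "e \<le> eA" "e \<le> eB" "e \<le> 1 / 2" "e \<le> \<delta> / (2 * (norm ?f + 1))" by blast+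
  obtain s p q r where spqr: "\<bar>s - 1\<bar> < e" "r < p" "r < q" "p - r < e" "q - r < e"
    "(s, p, q, r) \<notin> \<Union>\<B>" "s *\<^sub>R phi a0 + pair_pt i j k l p q r \<notin> \<Union>(bad_spaces a0)"
    by (rule generic_parameter[OF d a0(2) e(1) bad_spaces(1) bad_spaces(2) B])
  define x where "x = s *\<^sub>R phi a0 + pair_pt i j k l p q r"
  have s: "s > 1 / 2" using spqr(1) e(4) by linarith
  have bad: "x \<notin> N" if "affine hull N \<in> bad_spaces a0" for N
    using spqr(7) that hull_inc[of x N affine] by (auto simp: x_def)
  have gZ: "x \<notin> N" if "N \<in> cells Z - max_cells (cells Z)" for N
    by (rule bad) (use that in \<open>auto simp: bad_spaces_def\<close>)
  have gZ': "x \<notin> N" if "N \<in> cells Z' - max_cells (cells Z')" for N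
    by (rule bad) (use that in \<open>auto simp: bad_spaces_def\<close>)
  have gN: "x \<notin> phi ` N + T" if "N \<in> insert line_one vertices" "T \<in> cells G" for N T
    by (rule bad) (use that in \<open>auto simp: bad_spaces_def\<close>)
  have gG: "pair_pt i j k l p q r \<notin> N" if "N \<in> cells G - max_cells (cells G)" for N
  proof
    assume "pair_pt i j k l p q r \<in> N"
    moreover have "s *\<^sub>R a0 \<in> span {a0, \<chi> i. 1}" by (intro span_scale span_base) simp
    ultimately have "phi (s *\<^sub>R a0) + pair_pt i j k l p q r \<in> phi ` span {a0, \<chi> i. 1} + N"
      by (intro set_plus_intro) auto
    moreover have "x \<notin> phi ` span {a0, \<chi> i. 1} + N"
      by (rule bad) (use that in \<open>auto simp: bad_spaces_def\<close>)
    ultimately show False by (simp add: x_def linear_cmul[OF linear_phi])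
  qed
  have eq: "mink_local (push_wcomplex phi A) G x = mink_local (push_wcomplex phi B) G x"
    by (rule mink_local_eq[OF sum_A sum_B sums_eq gZ gZ'])
  obtain T0 where T0: "T0 \<in> cells G" "pair_pt i j k l p q r \<in> T0"
    using pair_pt_in_G[OF d spqr(2,3)] by blast
  note pc = pair_cell[OF d spqr(2,3) gG T0]
  define c where "c = - (s * a0 $ 0)"
  define pt where "pt = s *\<^sub>R a0 + (\<chi> i. c)"
  have pt0: "pt $ 0 = 0" by (simp add: pt_def c_def)
  have ptne: "\<not> (pt $ i = pt $ j \<and> pt $ k = pt $ l)" using a0(2) s by (simp add: pt_def)
  then have ptl: "pt \<notin> line_one" by (auto simp: line_one_def)
  have xpt: "x - phi pt = pair_pt i j k l p q r + (\<chi> e. - 2 * c)"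
    unfolding x_def pt_def linear_add[OF linear_phi] linear_cmul[OF linear_phi] phi_const
    by (simp add: vec_eq_iff)
  have only: "x - phi pt \<in> T \<longleftrightarrow> T = T0" if T: "T \<in> max_cells (cells G)" for T
  proof
    have shift: "y + (\<chi> e. c') \<in> U" if "y \<in> U" "U \<in> cells G" for y c' U
      using polyhedral_complexD(4)[OF complex_G that(2,1)] .
    show "T = T0" if "x - phi pt \<in> T"
    proof -
      have "x - phi pt + (\<chi> e. 2 * c) \<in> T" by (rule shift[OF that max_cellsD(1)[OF T]])
      moreover have "x - phi pt + (\<chi> e. 2 * c) = pair_pt i j k l p q r" unfolding xpt by (simp add: vec_eq_iff)
      ultimately have "pair_pt i j k l p q r \<in> T" by simp
      then show ?thesis using max_cell_eq[OF complex_G pc(1) max_cellsD(1)[OF T] pc(2)] by simp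
    qed
    show "x - phi pt \<in> T" if "T = T0" unfolding that xpt by (rule shift[OF T0(2,1)])
  qed
  have "weight_at A pt = weight_at B pt"
  proof (rule test_point[OF eq pt0 ptl pc(1) only])
    show "mink_coeff G (lin_space S) T0 \<noteq> 0" if "S \<in> max_cells (cells A)" "weight A S \<noteq> 0" "pt \<in> S" for S
      by (rule a.mink_coeff_pair_nonzero[OF d that ptne pc(1,3,4)])
    show "mink_coeff G (lin_space S) T0 \<noteq> 0" if "S \<in> max_cells (cells B)" "weight B S \<noteq> 0" "pt \<in> S" for S
      by (rule b.mink_coeff_pair_nonzero[OF d that ptne pc(1,3,4)])
    fix a assume a: "a \<in> a.noise x \<union> b.noise x" "a \<noteq> pt"
    obtain P T where PT: "a $ 0 = 0" "P \<in> a.planes \<union> b.planes" "a \<in> P" "T \<in> cells G" "x - phi a \<in> T"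
      using a(1) by (elim UnE) (erule a.noiseD b.noiseD, blast)+
    have xa: "x \<in> phi ` N + T" if "a \<in> N" for N
    proof -
      have "phi a + (x - phi a) \<in> phi ` N + T" using that PT(5) by (intro set_plus_intro) auto
      then show ?thesis by simp
    qed
    have al: "a \<notin> line_one" using gN[OF _ PT(4), of line_one] xa by blast
    have av: "a \<notin> \<Union>vertices" using gN[OF _ PT(4)] xa by blast
    define z where "z = a - s *\<^sub>R a0"
    have "pair_pt i j k l p q r - phi z = x - phi a"
      by (simp add: x_def z_def linear_diff[OF linear_phi] linear_cmul[OF linear_phi])
    then have "pair_pt i j k l p q r - phi z \<in> \<Union>(cells G)" using PT(4,5) by auto
    from noise_cases[OF d spqr(2,3) this]
    consider "z $ i = z $ j \<and> z $ k = z $ l \<and> r - q \<le> z $ i - z $ k \<and> z $ i - z $ k \<le> p - r"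
      | "(z $ k = z $ l \<and> min (z $ i) (z $ j) = z $ k + (p - r) \<and> z $ i \<noteq> z $ j) \<or>
        (z $ i = z $ j \<and> min (z $ k) (z $ l) = z $ i + (q - r) \<and> z $ k \<noteq> z $ l)" by blast
    then show "a \<notin> line_one \<and> weight_at A a = weight_at B a"
    proof cases
      case 2
      then have "weight_at A a = weight_at B a"
        using noise[OF _ spqr(2,3,6) PT(2,3) av al] s by (simp add: Let_def z_def)
      then show ?thesis using al by simp
    next
      case 1
      \<comment> \<open>In this alternative \<open>z\<close> is \<open>m\<close> times e_i + e_j
        plus the constant \<open>w\<close>; the aim is \<open>m = 0\<close>.\<close>
      define m where "m = z $ i - z $ k"
      define w where "w = z $ k"
      have z: "z = m *\<^sub>R ?f + (\<chi> x. w)"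
        by (rule vec4_eqI[OF d]) (use 1 ne in \<open>auto simp: axis_def m_def w_def\<close>)
      have aw: "a = s *\<^sub>R a0 + z" by (simp add: z_def)
      have "\<bar>m\<bar> < e" using 1 spqr(4,5) by (auto simp: m_def w_def)
      have "a - (\<chi> x. w) \<in> P" by (rule subspace_diff[OF sub(1)[OF PT(2)] PT(3) sub(3)[OF PT(2)]])
      moreover have "a - (\<chi> x. w) = s *\<^sub>R (a0 + (m / s) *\<^sub>R ?f)"
      proof -
        have "a = s *\<^sub>R a0 + (m *\<^sub>R ?f + (\<chi> x. w))" using aw z by simp
        then show ?thesis using s by (simp add: scaleR_right_distrib)
      qed
      ultimately have "(1 / s) *\<^sub>R (s *\<^sub>R (a0 + (m / s) *\<^sub>R ?f)) \<in> P"
        using subspace_mul[OF sub(1)[OF PT(2)]] by metis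
      then have bP: "a0 + (m / s) *\<^sub>R ?f \<in> P" using s by simp
      have "dist a0 (a0 + (m / s) *\<^sub>R ?f) = \<bar>m\<bar> / s * norm ?f" using s by (simp add: dist_norm)
      also have "\<dots> \<le> (2 * e) * norm ?f"
      proof (rule mult_right_mono)
        have "\<bar>m\<bar> \<le> e" using \<open>\<bar>m\<bar> < e\<close> by simp
        also have "e \<le> 2 * e * s" using s e(1) by simp
        finally show "\<bar>m\<bar> / s \<le> 2 * e" using s by (simp add: divide_le_eq)
      qed simp
      also have "\<dots> < (2 * e) * (norm ?f + 1)" using e(1) by simp
      also have "\<dots> \<le> \<delta>"
      proof -
        have pos: "2 * (norm ?f + 1) > 0" by (intro mult_pos_pos add_nonneg_pos) auto
        have "e * (2 * (norm ?f + 1)) \<le> \<delta>" using e(5) unfolding pos_le_divide_eq[OF pos] .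
        then show ?thesis by (simp add: mult_ac)
      qed
      finally have "a0 + (m / s) *\<^sub>R ?f \<notin> \<Union>V" using \<delta>(2) by auto
      \<comment> \<open>The ball around \<open>a0\<close> meets no plane that misses
        \<open>a0\<close>.\<close>
      then have a0P: "a0 \<in> P" using bP PT(2) by (auto simp: V_def)
      have "m = 0"
      proof (rule ccontr)
        assume "m \<noteq> 0"
        have "(a0 + (m / s) *\<^sub>R ?f) - a0 \<in> P" by (rule subspace_diff[OF sub(1)[OF PT(2)] bP a0P])
        then have "(m / s) *\<^sub>R ?f \<in> P" by simp
        then have "(s / m) *\<^sub>R ((m / s) *\<^sub>R ?f) \<in> P" by (rule subspace_mul[OF sub(1)[OF PT(2)]])
        then have fP: "?f \<in> P" using \<open>m \<noteq> 0\<close> s by simp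
        have fl: "?f \<notin> line_one"
        proof
          assume "?f \<in> line_one"
          then obtain c where "?f = (\<chi> i. c)" by (auto simp: line_one_def)
          then have "?f $ i = ?f $ k" by simp
          then show False using ne by (simp add: axis_def)
        qed
        have "a0 \<in> span {?f, \<chi> i. 1}" using plane_eq_span[OF sub[OF PT(2)] fP fl] a0P by simp
        then obtain u where "a0 - u *\<^sub>R ?f \<in> span {\<chi> i. 1}" using span_breakdown_eq by blast
        then obtain v where "a0 - u *\<^sub>R ?f = (\<chi> i. v)" unfolding span_one by (auto simp: line_one_def)
        then have "a0 $ x = u * ?f $ x + v" for x
          by (simp add: vec_eq_iff) (metis add.commute diff_add_cancel)
        then have "a0 $ i = a0 $ j" "a0 $ k = a0 $ l" using ne by (auto simp: axis_def)
        then show False using a0(2) by simp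
      qed
      then have "a = s *\<^sub>R a0 + (\<chi> x. w)" using aw z by simp
      moreover from this have "w = c" using PT(1) by (simp add: c_def)
      ultimately have "a = pt" by (simp add: pt_def)
      then show ?thesis using a(2) by simp
    qed
  qed
  then have "weight_at A (s *\<^sub>R a0) = weight_at B (s *\<^sub>R a0)"
    unfolding pt_def weight_at_shift[OF a.complex_A] weight_at_shift[OF b.complex_A] .
  moreover have "\<bar>s - 1\<bar> < eA" "\<bar>s - 1\<bar> < eB" using spqr(1) e by auto
  ultimately show ?thesis using eA(2) eB(2) by simp
qed

text \<open>\<open>on_axis i a\<close> says that \<open>a\<close> is a multiple of the \<open>i\<close>-th unit vector modulo \<open>(1,1,1,1)\<close>.\<close>

definition on_axis :: "4 \<Rightarrow> real^4 \<Rightarrow> bool" where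
  "on_axis i a \<longleftrightarrow> (\<forall>x y. x \<noteq> i \<longrightarrow> y \<noteq> i \<longrightarrow> a $ x = a $ y)"

text \<open>Off the axes no three coordinates agree, so some pairing separates both pairs. For it, a
  torn displacement puts \<open>s *\<^sub>R a0\<close> plus a multiple of e_i + e_j into the span of
  a plane and a unit vector. By \<open>plane_avoids\<close> this is a proper condition on the
  parameters, which generic ones violate; so no such displacement occurs.\<close>

lemma weight_at_off_axis:
  assumes a0: "a0 \<notin> \<Union>vertices" "\<And>m. \<not> on_axis m a0"
  shows "weight_at A a0 = weight_at B a0"
proof -
  obtain i j k l :: 4 where d0: "distinct [i, j, k, l]" using ex_distinct_four by blast
  have "\<exists>i j k l. distinct [i, j, k, l] \<and> a0 $ i \<noteq> a0 $ j \<and> a0 $ k \<noteq> a0 $ l"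
  proof (rule ccontr)
    assume no: "\<not> ?thesis"
    have no': "a0 $ i = a0 $ j \<or> a0 $ k = a0 $ l" if "distinct [i, j, k, l]" for i j k l
      using no that by blast
    have 1: "a0 $ i = a0 $ j \<or> a0 $ k = a0 $ l" using no'[OF d0] .
    have 2: "a0 $ i = a0 $ k \<or> a0 $ j = a0 $ l" by (rule no') (use d0 in auto)
    have 3: "a0 $ i = a0 $ l \<or> a0 $ j = a0 $ k" by (rule no') (use d0 in auto)
    have ax: "on_axis m a0" if "distinct [m, x, y, z]" "a0 $ x = a0 $ y" "a0 $ x = a0 $ z" for m x y z
      unfolding on_axis_def
    proof (intro allI impI)
      fix u v assume "u \<noteq> m" "v \<noteq> m"
      then have "u = x \<or> u = y \<or> u = z" "v = x \<or> v = y \<or> v = z"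
        using distinct_four_exhaust[OF that(1), of u] distinct_four_exhaust[OF that(1), of v] by auto
      then show "a0 $ u = a0 $ v" using that(2,3) by auto
    qed
    have "(a0 $ i = a0 $ j \<and> a0 $ i = a0 $ k) \<or> (a0 $ i = a0 $ j \<and> a0 $ i = a0 $ l)
      \<or> (a0 $ i = a0 $ k \<and> a0 $ i = a0 $ l) \<or> (a0 $ j = a0 $ k \<and> a0 $ j = a0 $ l)"
      using 1 2 3 by auto
    then show False
      using ax[of l i j k] ax[of k i j l] ax[of j i k l] ax[of i j k l] d0 a0(2) by auto
  qed
  then obtain i j k l where d: "distinct [i, j, k, l]" and ij: "a0 $ i \<noteq> a0 $ j" and kl: "a0 $ k \<noteq> a0 $ l"
    by blast
  have ne: "i \<noteq> j" "i \<noteq> k" "i \<noteq> l" "j \<noteq> k" "j \<noteq> l" "k \<noteq> l" using d by auto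
  let ?f = "axis i 1 + axis j 1 :: real^4"
  let ?P = "a.planes \<union> b.planes"
  let ?g = "\<lambda>(s, p, q :: real, r). s *\<^sub>R a0 + (p - r) *\<^sub>R ?f"
  let ?h = "\<lambda>(s, p :: real, q, r). s *\<^sub>R a0 + (r - q) *\<^sub>R ?f"
  \<comment> \<open>\<open>G1\<close> and \<open>G2\<close> are the parameter conditions from the
    second and third alternative of \<open>noise_cases\<close>; \<open>m\<close> is the coordinate
    that the tear leaves free.\<close>
  define G1 where "G1 P m = ?g -` span (insert (axis m 1) P)" for P m
  define G2 where "G2 P m = ?h -` span (insert (axis m 1) P)" for P m
  define \<B> where "\<B> = (\<lambda>(P, m). G1 P m) ` (?P \<times> UNIV) \<union> (\<lambda>(P, m). G2 P m) ` (?P \<times> UNIV)"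
  have sub: "subspace P" "dim P = 2" "(\<chi> i. c) \<in> P" if "P \<in> ?P" for P c
    using that a.planesD b.planesD by auto
  have lin: "linear ?g" "linear ?h"
    by (auto intro!: linearI simp: algebra_simps)
  have avoid: "\<not> (a0 \<in> span (insert (axis m 1) P) \<and> ?f \<in> span (insert (axis m 1) P))" if "P \<in> ?P" for P m
    by (rule plane_avoids[OF d sub[OF that] ij kl])
  show ?thesis
  proof (rule weight_at_eq_by_noise[OF d a0(1), of \<B>])
    show "\<not> (a0 $ i = a0 $ j \<and> a0 $ k = a0 $ l)" using ij by simp
    show "finite \<B>" unfolding \<B>_def by (intro finite_UnI finite_imageI finite_cartesian_product) (auto simp: a.finite_planes b.finite_planes)
    show "affine H \<and> H \<noteq> UNIV" if "H \<in> \<B>" for H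
    proof -
      from that consider P m where "P \<in> ?P" "H = G1 P m" | P m where "P \<in> ?P" "H = G2 P m"
        unfolding \<B>_def by auto
      then show ?thesis
      proof cases
        case 1
        \<comment> \<open>These parameter vectors map to \<open>a0\<close> and e_i + e_j.\<close>
        have "(1, 0, 0, 0) \<notin> H \<or> (0, 1, 0, 0) \<notin> H" using avoid[OF 1(1), of m] unfolding 1(2) G1_def by simp
        then have "H \<noteq> UNIV" by blast
        then show ?thesis unfolding 1(2) G1_def using subspace_linear_preimage[OF lin(1) subspace_span] by blast
      next
        case 2
        have "(1, 0, 0, 0) \<notin> H \<or> (0, 0, 0, 1) \<notin> H" using avoid[OF 2(1), of m] unfolding 2(2) G2_def by simp
        then have "H \<noteq> UNIV" by blast
        then show ?thesis unfolding 2(2) G2_def using subspace_linear_preimage[OF lin(2) subspace_span] by blast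
      qed
    qed
    fix s p q r :: real and a P
    assume spqr: "(s, p, q, r) \<notin> \<Union>\<B>" and P: "P \<in> ?P" "a \<in> P"
      and z: "let z = a - s *\<^sub>R a0 in
        (z $ k = z $ l \<and> min (z $ i) (z $ j) = z $ k + (p - r) \<and> z $ i \<noteq> z $ j) \<or>
        (z $ i = z $ j \<and> min (z $ k) (z $ l) = z $ i + (q - r) \<and> z $ k \<noteq> z $ l)"
    define z' where "z' = a - s *\<^sub>R a0"
    have az: "a = s *\<^sub>R a0 + z'" by (simp add: z'_def)
    have inW: "a - t *\<^sub>R axis m 1 - (\<chi> x. c) \<in> span (insert (axis m 1) P)" for t m c
      using P(2) sub(3)[OF P(1)] by (intro span_diff span_scale) (auto intro: span_base)
    from z consider "z' $ k = z' $ l" "min (z' $ i) (z' $ j) = z' $ k + (p - r)"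
      | "z' $ i = z' $ j" "min (z' $ k) (z' $ l) = z' $ i + (q - r)"
      unfolding Let_def z'_def[symmetric] by blast
    then have False
    proof cases
      case 1
      \<comment> \<open>\<open>m\<close> is the larger coordinate of the torn pair and
        \<open>t\<close> its excess over the smaller one.\<close>
      define m where "m = (if z' $ i \<le> z' $ j then j else i)"
      define t where "t = \<bar>z' $ i - z' $ j\<bar>"
      have "z' = (p - r) *\<^sub>R ?f + t *\<^sub>R axis m 1 + (\<chi> x. z' $ k)"
        by (rule vec4_eqI[OF d]) (use 1 ne in \<open>auto simp: axis_def m_def t_def min_def split: if_splits\<close>)
      then have "s *\<^sub>R a0 + (p - r) *\<^sub>R ?f = a - t *\<^sub>R axis m 1 - (\<chi> x. z' $ k)"
        using az by (simp add: algebra_simps)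
      then have "(s, p, q, r) \<in> G1 P m" using inW by (simp add: G1_def)
      then show False using spqr P(1) unfolding \<B>_def by blast
    next
      case 2
      define m where "m = (if z' $ k \<le> z' $ l then l else k)"
      define t where "t = \<bar>z' $ k - z' $ l\<bar>"
      have "z' = (r - q) *\<^sub>R ?f + t *\<^sub>R axis m 1 + (\<chi> x. z' $ i + (q - r))"
        by (rule vec4_eqI[OF d]) (use 2 ne in \<open>auto simp: axis_def m_def t_def min_def split: if_splits\<close>)
      then have "s *\<^sub>R a0 + (r - q) *\<^sub>R ?f = a - t *\<^sub>R axis m 1 - (\<chi> x. z' $ i + (q - r))"
        using az by (simp add: algebra_simps)
      then have "(s, p, q, r) \<in> G2 P m" using inW by (simp add: G2_def)
      then show False using spqr P(1) unfolding \<B>_def by blast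
    qed
    then show "weight_at A a = weight_at B a" ..
  qed
qed

text \<open>As \<open>a0\<close> raises coordinate \<open>i\<close>, both remaining alternatives
  produce points without three equal coordinates. These are off all axes, where the weights already
  agree.\<close>

lemma weight_at_positive_axis:
  assumes a0: "a0 \<notin> \<Union>vertices" "on_axis i a0" "\<And>x. x \<noteq> i \<Longrightarrow> a0 $ x < a0 $ i"
  shows "weight_at A a0 = weight_at B a0"
proof -
  obtain j k l where d: "distinct [i, j, k, l]" using ex_distinct_four_with by blast
  have ne: "i \<noteq> j" "i \<noteq> k" "i \<noteq> l" "j \<noteq> k" "j \<noteq> l" "k \<noteq> l" using d by auto
  have eq: "a0 $ k = a0 $ j" "a0 $ l = a0 $ j" using a0(2) ne unfolding on_axis_def by metis+
  have lt: "a0 $ j < a0 $ i" using a0(3) ne by auto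
  show ?thesis
  proof (rule weight_at_eq_by_noise[OF d a0(1), of "{}"])
    fix s p q r :: real and a P
    assume s: "s > 0" and pq: "r < p" "r < q" and a: "a \<notin> \<Union>vertices"
      and z: "let z = a - s *\<^sub>R a0 in
        (z $ k = z $ l \<and> min (z $ i) (z $ j) = z $ k + (p - r) \<and> z $ i \<noteq> z $ j) \<or>
        (z $ i = z $ j \<and> min (z $ k) (z $ l) = z $ i + (q - r) \<and> z $ k \<noteq> z $ l)"
    have "s * a0 $ j < s * a0 $ i" using s lt by simp
    then have c: "(a $ k = a $ l \<and> a $ k < a $ i \<and> a $ k < a $ j) \<or>
        (a $ j < a $ i \<and> a $ j < a $ k \<and> a $ j < a $ l \<and> a $ k \<noteq> a $ l)"
      using z pq by (auto simp: Let_def eq min_def split: if_splits)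
    show "weight_at A a = weight_at B a"
    proof (rule weight_at_off_axis[OF a])
      show "\<not> on_axis m a" for m
      proof
        assume m: "on_axis m a"
        have e: "a $ x = a $ y" if "x \<noteq> m" "y \<noteq> m" for x y
          using m that unfolding on_axis_def by blast
        consider "m = i" | "m = j" | "m = k" | "m = l" using distinct_four_exhaust[OF d] by blast
        then show False
          by cases (use c ne e[of j k] e[of i k] e[of i l] e[of k l] e[of j l] e[of i j] in auto)
      qed
    qed
  qed (use eq lt in auto)
qed

text \<open>As \<open>a0\<close> lowers coordinate \<open>i\<close>, it may come level with k and l
  while j stays above them: the contributing point is then on the positive half of the axis of j.
  All others are off the axes.\<close>

lemma weight_at_negative_axis:
  assumes a0: "a0 \<notin> \<Union>vertices" "on_axis i a0" "\<And>x. x \<noteq> i \<Longrightarrow> a0 $ i < a0 $ x"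
  shows "weight_at A a0 = weight_at B a0"
proof -
  obtain j k l where d: "distinct [i, j, k, l]" using ex_distinct_four_with by blast
  have ne: "i \<noteq> j" "i \<noteq> k" "i \<noteq> l" "j \<noteq> k" "j \<noteq> l" "k \<noteq> l" using d by auto
  have eq: "a0 $ k = a0 $ j" "a0 $ l = a0 $ j" using a0(2) ne unfolding on_axis_def by metis+
  have lt: "a0 $ i < a0 $ j" using a0(3) ne by auto
  show ?thesis
  proof (rule weight_at_eq_by_noise[OF d a0(1), of "{}"])
    fix s p q r :: real and a P
    assume s: "s > 0" and pq: "r < p" "r < q" and a: "a \<notin> \<Union>vertices"
      and z: "let z = a - s *\<^sub>R a0 in
        (z $ k = z $ l \<and> min (z $ i) (z $ j) = z $ k + (p - r) \<and> z $ i \<noteq> z $ j) \<or>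
        (z $ i = z $ j \<and> min (z $ k) (z $ l) = z $ i + (q - r) \<and> z $ k \<noteq> z $ l)"
    have "s * a0 $ i < s * a0 $ j" using s lt by simp
    then have c: "(a $ k = a $ l \<and> a $ k < a $ j) \<or>
        (a $ i < a $ j \<and> a $ j < a $ k \<and> a $ j < a $ l \<and> a $ k \<noteq> a $ l)"
      using z pq by (auto simp: Let_def eq min_def split: if_splits)
    show "weight_at A a = weight_at B a"
    proof (cases "\<exists>m. on_axis m a")
      case False
      then show ?thesis using weight_at_off_axis[OF a] by blast
    next
      case True
      then obtain m where m: "on_axis m a" by blast
      have e: "a $ x = a $ y" if "x \<noteq> m" "y \<noteq> m" for x y
        using m that unfolding on_axis_def by blast
      consider "m = i" | "m = j" | "m = k" | "m = l" using distinct_four_exhaust[OF d] by blast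
      then have mj: "m = j \<and> a $ k < a $ j"
        by cases (use c ne e[of j k] e[of i k] e[of i l] e[of k l] e[of j l] e[of i j] in auto)
      have "a $ x < a $ j" if "x \<noteq> j" for x using e[of x k] mj that ne by auto
      then show ?thesis using weight_at_positive_axis[OF a] m mj by blast
    qed
  qed (use eq lt in auto)
qed

lemma weight_at_eq:
  assumes "a \<notin> \<Union>vertices" "a \<notin> line_one"
  shows "weight_at A a = weight_at B a"
proof (cases "\<exists>i. on_axis i a")
  case False
  then show ?thesis using weight_at_off_axis[OF assms(1)] by blast
next
  case True
  then obtain i where i: "on_axis i a" by blast
  obtain j k l where d: "distinct [i, j, k, l]" using ex_distinct_four_with by blast
  have "j \<noteq> i" using d by auto
  then have eq: "a $ x = a $ j" if "x \<noteq> i" for x using i that unfolding on_axis_def by blast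
  have "a $ i \<noteq> a $ j"
  proof
    assume "a $ i = a $ j"
    then have "a = (\<chi> x. a $ j)" using eq by (simp add: vec_eq_iff) metis
    then show False using assms(2) const_in_line_one by metis
  qed
  then show ?thesis
    using weight_at_positive_axis[OF assms(1) i] weight_at_negative_axis[OF assms(1) i] eq
    by (metis linorder_neqE_linordered_idom)
qed

end

theorem theorem3p9:
  fixes \<Sigma> \<Sigma>' :: "4 wcomplex" and \<Gamma>\<^sub>0 Z Z' :: "pidx wcomplex"
  assumes "tropical_curve (value_group TYPE('k::{alg_closed_field, valued_field})) \<Sigma>"
    and "tropical_curve (value_group TYPE('k)) \<Sigma>'"
    and "is_fan_set (support \<Sigma>)"
    and "is_fan_set (support \<Sigma>')"
    and "tropicalization (lines_through_unit_point :: ('k^pidx) set) \<Gamma>\<^sub>0"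
    and "minkowski_sum (push_wcomplex phi \<Sigma>) \<Gamma>\<^sub>0 Z"
    and "minkowski_sum (push_wcomplex phi \<Sigma>') \<Gamma>\<^sub>0 Z'"
    and "Z \<approx>\<^sub>w Z'"
  shows "\<Sigma> \<approx>\<^sub>w \<Sigma>'"
proof -
  interpret two_fan_curves \<Sigma> \<Sigma>' "value_group TYPE('k)" \<Gamma>\<^sub>0 "TYPE('k)" Z Z'
    by unfold_locales (use assms in auto)
  show ?thesis
  proof (rule wcomplex_eq_generic)
    show "polyhedral_complex (cells \<Sigma>)" "pure_dim 1 (cells \<Sigma>)"
      by (rule a.complex_A a.pure_A)+
    show "polyhedral_complex (cells \<Sigma>')" "pure_dim 1 (cells \<Sigma>')"
      by (rule b.complex_A b.pure_A)+
    \<comment> \<open>The origin of the quotient does not determine the plane of a cell through it;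
      having dimension 0, it can be left out.\<close>
    show "finite {line_one :: (real^4) set}" by simp
    show "tdim E < 1" if "E \<in> {line_one :: (real^4) set}" for E
      using that line_one_aff_dim(3) by (simp add: tdim_def)
    show "weight_at \<Sigma> a = weight_at \<Sigma>' a"
      if "a \<notin> \<Union>{line_one}" "a \<notin> \<Union>(cells \<Sigma> - max_cells (cells \<Sigma>))"
        "a \<notin> \<Union>(cells \<Sigma>' - max_cells (cells \<Sigma>'))" for a
      by (rule weight_at_eq) (use that in \<open>auto simp: vertices_def\<close>)
  qed
qed

end
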